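(* Let $1<p<\infty$ and let $\mu$ be a locally doubling measure on $\mathbb{R}$ supporting a local $p$-Poincaré inequality. Then the following are equivalent: (a) There exists a positive nonconstant $p$-harmonic function on $(\mathbb{R},\mu)$. (b) There exists a positive nonconstant quasiharmonic function on $(\mathbb{R},\mu)$. (c) There is a weight $w$ such that $d\mu=w\,dx$ and $$\min\biggl\{\int_{-\infty}^0w^{1/(1-p)}\,dx,\ \int_0^\infty w^{1/(1-p)}\,dx\biggr\}<\infty.$$
   Context: $1<p<\infty$; $X=(\mathbb{R},\mu)$ is the real line with the Euclidean metric and a positive complete Borel measure $\mu$ with $0<\mu(B)<\infty$ for all balls (bounded open intervals) $B$. For a ball $B=B(x,r)$, $\lambda B=B(x,\lambda r)$, $r_B=r$. Upper gradients. Curves are nonconstant, compact and rectifiable, parameterized by arc length $ds$. A property holds for $p$-almost every curve if for the family $\Gamma$ of curves for which it fails there is a Borel function $0\le\rho\in L^p(X)$ with $\int_\gamma\rho\,ds=\infty$ for all $\gamma\in\Gamma$. A measurable $g:X\to[0,\infty]$ is a $p$-weak upper gradient of $u:X\to[-\infty,\infty]$ if for $p$-almost every curve $\gamma:[0,l_\gamma]\to X$, $|u(\gamma(0))-u(\gamma(l_\gamma))|\le\int_\gamma g\,ds$ (left-hand side $\infty$ if a term is $\pm\infty$). If $u$ has a $p$-weak upper gradient in $L^p_{\rm loc}$, then $g_u$ denotes the minimal one (a.e. smallest). For measurable $u$, $\|u\|_{N^{1,p}(X)}^p=\int_X|u|^p\,d\mu+\inf_g\int_Xg^p\,d\mu$,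 infimum over $p$-weak upper gradients $g$ of $u$, and $N^{1,p}(X)=\{u:\|u\|_{N^{1,p}(X)}<\infty\}$; $N^{1,p}(E)$ is defined by regarding a measurable set $E$ as a metric measure space in its own right. Local assumptions. $\mu$ is locally doubling if for every $x_0$ there are $r_0>0$, $C>0$ (depending on $x_0$) with $\mu(2B)\le C\mu(B)$ for all balls $B\subset B(x_0,r_0)$. $\mu$ supports a local $p$-Poincaré inequality if for every $x_0$ there are $r_0>0$, $C>0$, $\lambda\ge1$ (depending on $x_0$) such that for all balls $B\subset B(x_0,r_0)$, all integrable $u$ on $\lambda B$ and all $p$-weak upper gradients $g$ of $u$, $\frac1{\mu(B)}\int_B|u-u_B|\,d\mu\le Cr_B\bigl(\frac1{\mu(\lambda B)}\int_{\lambda B}g^p\,d\mu\bigr)^{1/p}$, where $u_B=\frac1{\mu(B)}\int_Bu\,d\mu$. Quasiharmonic functions. A function $u$ on $X$ with $u\in N^{1,p}(G)$ for every bounded open $G\subset X$ is a quasiminimizer on $X$ if there is $Q\ge1$ with $\int_{\{\varphi\ne0\}}g_u^p\,d\mu\le Q\int_{\{\varphi\ne0\}}g_{u+\varphi}^p\,d\mu$ for all $\varphi$ in the closure in $N^{1,p}(X)$ of the functions in $N^{1,p}(X)$ vanishing outside some bounded open set (this closure is $N^{1,p}(X)$). A continuous (real-valued) quasiminimizer is called quasiharmonic, and $p$-harmonic if $Q=1$ is possible. A weight is a nonnegative locally integrable function. *)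

theory Defs
  imports "HOL-Analysis.Analysis"
begin

text \<open>
  Real powers of extended nonnegative numbers with the usual conventions \<open>0\<^sup>a = \<infinity>\<close> for \<open>a < 0\<close>
  and \<open>\<infinity>\<^sup>a = \<infinity>\<close> for \<open>a > 0\<close> (the library has \<open>0 powr a = 0\<close> for every \<open>a\<close>, which would be
  wrong for \<open>w\<^sup>1\<^sup>/\<^sup>(\<^sup>1\<^sup>-\<^sup>p\<^sup>)\<close> on the zero set of a weight).
\<close>

definition enn_powr :: "ennreal \<Rightarrow> real \<Rightarrow> ennreal" where
  "enn_powr x a =
     (if (x = 0 \<and> a < 0) \<or> (x = \<infinity> \<and> a > 0) then \<infinity> else ennreal (enn2real x powr a))"

text \<open>
  A complete Borel measure is the completion of a measure on the Borel sets.
\<close>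

definition complete_borel_measure :: "real measure \<Rightarrow> bool" where
  "complete_borel_measure \<mu> \<longleftrightarrow> (\<exists>N. sets N = sets borel \<and> \<mu> = completion N)"

definition positive_finite_on_balls :: "real measure \<Rightarrow> bool" where
  "positive_finite_on_balls \<mu> \<longleftrightarrow>
     (\<forall>x r. 0 < r \<longrightarrow> 0 < emeasure \<mu> (ball x r) \<and> emeasure \<mu> (ball x r) < \<infinity>)"

section \<open>Curves and weak upper gradients\<close>

text \<open>
  For a subset \<open>E\<close> of the line, \<open>E\<close> with the restricted metric and measure is a metric measure
  space in its own right; functions on \<open>E\<close> are represented by functions on the whole line, whose
  values outside \<open>E\<close> play no role below.
\<close>

definition curve_length :: "(real \<Rightarrow> real) \<Rightarrow> real \<Rightarrow> real \<Rightarrow> ennreal" where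
  "curve_length \<gamma> a b =
     (SUP ts \<in> {ts. sorted ts \<and> set ts \<subseteq> {a..b}}.
        \<Sum>i<length ts - 1. ennreal (dist (\<gamma> (ts ! i)) (\<gamma> (ts ! Suc i))))"

text \<open>
  Nonconstant compact rectifiable curves \<open>\<gamma> : [0,l] \<rightarrow> E\<close> parameterized by arc length;
  such a curve is nonconstant exactly when its length \<open>l\<close> is positive.
\<close>

definition arclength_curve :: "real set \<Rightarrow> (real \<Rightarrow> real) \<Rightarrow> real \<Rightarrow> bool" where
  "arclength_curve E \<gamma> l \<longleftrightarrow>
     0 < l \<and> \<gamma> ` {0..l} \<subseteq> E \<and> continuous_on {0..l} \<gamma> \<and>
     (\<forall>t\<in>{0..l}. curve_length \<gamma> 0 t = ennreal t)"

definition line_integral :: "(real \<Rightarrow> ennreal) \<Rightarrow> (real \<Rightarrow> real) \<Rightarrow> real \<Rightarrow> ennreal" where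
  "line_integral g \<gamma> l = (\<integral>\<^sup>+t\<in>{0..l}. g (\<gamma> t) \<partial>lebesgue)"

definition p_almost_every_curve ::
    "real measure \<Rightarrow> real \<Rightarrow> real set \<Rightarrow> ((real \<Rightarrow> real) \<Rightarrow> real \<Rightarrow> bool) \<Rightarrow> bool" where
  "p_almost_every_curve \<mu> p E P \<longleftrightarrow>
     (\<exists>\<rho>::real \<Rightarrow> ennreal. \<rho> \<in> borel_measurable (restrict_space borel E) \<and>
        (\<integral>\<^sup>+x\<in>E. enn_powr (\<rho> x) p \<partial>\<mu>) < \<infinity> \<and>
        (\<forall>\<gamma> l. arclength_curve E \<gamma> l \<and> \<not> P \<gamma> l \<longrightarrow> line_integral \<rho> \<gamma> l = \<infinity>))"

definition ereal_gap :: "ereal \<Rightarrow> ereal \<Rightarrow> ennreal" where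
  "ereal_gap a b =
     (if \<bar>a\<bar> = \<infinity> \<or> \<bar>b\<bar> = \<infinity> then \<infinity> else ennreal \<bar>real_of_ereal a - real_of_ereal b\<bar>)"

definition weak_upper_gradient ::
    "real measure \<Rightarrow> real \<Rightarrow> real set \<Rightarrow> (real \<Rightarrow> ereal) \<Rightarrow> (real \<Rightarrow> ennreal) \<Rightarrow> bool" where
  "weak_upper_gradient \<mu> p E u g \<longleftrightarrow>
     g \<in> borel_measurable (restrict_space \<mu> E) \<and>
     p_almost_every_curve \<mu> p E
       (\<lambda>\<gamma> l. ereal_gap (u (\<gamma> 0)) (u (\<gamma> l)) \<le> line_integral g \<gamma> l)"

definition Lp_loc :: "real measure \<Rightarrow> real \<Rightarrow> (real \<Rightarrow> ennreal) \<Rightarrow> bool" where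
  "Lp_loc \<mu> p g \<longleftrightarrow> g \<in> borel_measurable \<mu> \<and>
     (\<forall>x. \<exists>r>0. (\<integral>\<^sup>+y\<in>ball x r. enn_powr (g y) p \<partial>\<mu>) < \<infinity>)"

definition is_minimal_weak_upper_gradient ::
    "real measure \<Rightarrow> real \<Rightarrow> (real \<Rightarrow> ereal) \<Rightarrow> (real \<Rightarrow> ennreal) \<Rightarrow> bool" where
  "is_minimal_weak_upper_gradient \<mu> p u g \<longleftrightarrow>
     weak_upper_gradient \<mu> p UNIV u g \<and> Lp_loc \<mu> p g \<and>
     (\<forall>h. weak_upper_gradient \<mu> p UNIV u h \<and> Lp_loc \<mu> p h \<longrightarrow> (AE x in \<mu>. g x \<le> h x))"

text \<open>
  The function \<open>g\<^sub>u\<close>; any two candidates agree almost everywhere.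
\<close>

definition minimal_weak_upper_gradient ::
    "real measure \<Rightarrow> real \<Rightarrow> (real \<Rightarrow> ereal) \<Rightarrow> real \<Rightarrow> ennreal" where
  "minimal_weak_upper_gradient \<mu> p u = (SOME g. is_minimal_weak_upper_gradient \<mu> p u g)"

section \<open>Newtonian spaces\<close>

definition N1p_norm :: "real measure \<Rightarrow> real \<Rightarrow> real set \<Rightarrow> (real \<Rightarrow> ereal) \<Rightarrow> ennreal" where
  "N1p_norm \<mu> p E u =
     enn_powr ((\<integral>\<^sup>+x\<in>E. enn_powr (e2ennreal \<bar>u x\<bar>) p \<partial>\<mu>) +
               (INF g \<in> {g. weak_upper_gradient \<mu> p E u g}. \<integral>\<^sup>+x\<in>E. enn_powr (g x) p \<partial>\<mu>))
              (1 / p)"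

definition N1p :: "real measure \<Rightarrow> real \<Rightarrow> real set \<Rightarrow> (real \<Rightarrow> ereal) set" where
  "N1p \<mu> p E = {u. u \<in> borel_measurable (restrict_space \<mu> E) \<and> N1p_norm \<mu> p E u < \<infinity>}"

definition N1p_bounded_support :: "real measure \<Rightarrow> real \<Rightarrow> (real \<Rightarrow> ereal) set" where
  "N1p_bounded_support \<mu> p =
     {\<psi> \<in> N1p \<mu> p UNIV. \<exists>G. open G \<and> bounded G \<and> (\<forall>x. x \<notin> G \<longrightarrow> \<psi> x = 0)}"

definition N1p_test_functions :: "real measure \<Rightarrow> real \<Rightarrow> (real \<Rightarrow> ereal) set" where
  "N1p_test_functions \<mu> p =
     {\<phi> \<in> N1p \<mu> p UNIV.
        \<forall>\<epsilon>>0. \<exists>\<psi>\<in>N1p_bounded_support \<mu> p. N1p_norm \<mu> p UNIV (\<lambda>x. \<phi> x - \<psi> x) < \<epsilon>}"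

section \<open>Local doubling and local Poincare inequality\<close>

definition locally_doubling :: "real measure \<Rightarrow> bool" where
  "locally_doubling \<mu> \<longleftrightarrow>
     (\<forall>x0. \<exists>r0>0. \<exists>C>0. \<forall>x r. 0 < r \<and> ball x r \<subseteq> ball x0 r0 \<longrightarrow>
        emeasure \<mu> (ball x (2 * r)) \<le> ennreal C * emeasure \<mu> (ball x r))"

text \<open>
  Integrable functions may take the values \<open>\<plusminus>\<infinity>\<close> on a null set, where \<open>real_of_ereal\<close> returns \<open>0\<close>;
  this does not affect their mean values.
\<close>

definition integrable_ereal_on :: "real measure \<Rightarrow> real set \<Rightarrow> (real \<Rightarrow> ereal) \<Rightarrow> bool" where
  "integrable_ereal_on \<mu> E u \<longleftrightarrow>
     u \<in> borel_measurable (restrict_space \<mu> E) \<and> (\<integral>\<^sup>+x\<in>E. e2ennreal \<bar>u x\<bar> \<partial>\<mu>) < \<infinity>"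

definition mean_value :: "real measure \<Rightarrow> real set \<Rightarrow> (real \<Rightarrow> ereal) \<Rightarrow> real" where
  "mean_value \<mu> B u = (LINT x:B|\<mu>. real_of_ereal (u x)) / measure \<mu> B"

definition local_Poincare :: "real measure \<Rightarrow> real \<Rightarrow> bool" where
  "local_Poincare \<mu> p \<longleftrightarrow>
     (\<forall>x0. \<exists>r0>0. \<exists>C>0. \<exists>\<Lambda>\<ge>1. \<forall>x r. 0 < r \<and> ball x r \<subseteq> ball x0 r0 \<longrightarrow>
        (\<forall>u g. integrable_ereal_on \<mu> (ball x (\<Lambda> * r)) u \<and>
               weak_upper_gradient \<mu> p (ball x (\<Lambda> * r)) u g \<longrightarrow>
          (\<integral>\<^sup>+y\<in>ball x r. e2ennreal \<bar>u y - ereal (mean_value \<mu> (ball x r) u)\<bar> \<partial>\<mu>)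
              / emeasure \<mu> (ball x r)
          \<le> ennreal (C * r) *
             enn_powr ((\<integral>\<^sup>+y\<in>ball x (\<Lambda> * r). enn_powr (g y) p \<partial>\<mu>)
                         / emeasure \<mu> (ball x (\<Lambda> * r))) (1 / p)))"

section \<open>Quasiminimizers\<close>

text \<open>
  Under the standing assumptions Newtonian functions are finite everywhere on the line, so the
  library's convention \<open>\<infinity> - \<infinity> = \<infinity>\<close> is irrelevant for the sums and differences of functions
  occurring here and in \<^const>\<open>N1p_test_functions\<close>.
\<close>

definition quasiminimizer_with ::
    "real measure \<Rightarrow> real \<Rightarrow> real \<Rightarrow> (real \<Rightarrow> ereal) \<Rightarrow> bool" where
  "quasiminimizer_with \<mu> p Q u \<longleftrightarrow>
     (\<forall>G. open G \<and> bounded G \<longrightarrow> u \<in> N1p \<mu> p G) \<and>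
     (\<forall>\<phi>\<in>N1p_test_functions \<mu> p.
        (\<integral>\<^sup>+x\<in>{x. \<phi> x \<noteq> 0}. enn_powr (minimal_weak_upper_gradient \<mu> p u x) p \<partial>\<mu>)
        \<le> ennreal Q *
          (\<integral>\<^sup>+x\<in>{x. \<phi> x \<noteq> 0}.
             enn_powr (minimal_weak_upper_gradient \<mu> p (\<lambda>y. u y + \<phi> y) x) p \<partial>\<mu>))"

definition quasiharmonic :: "real measure \<Rightarrow> real \<Rightarrow> (real \<Rightarrow> real) \<Rightarrow> bool" where
  "quasiharmonic \<mu> p u \<longleftrightarrow>
     continuous_on UNIV u \<and> (\<exists>Q\<ge>1. quasiminimizer_with \<mu> p Q (\<lambda>x. ereal (u x)))"

definition p_harmonic :: "real measure \<Rightarrow> real \<Rightarrow> (real \<Rightarrow> real) \<Rightarrow> bool" where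
  "p_harmonic \<mu> p u \<longleftrightarrow>
     continuous_on UNIV u \<and> quasiminimizer_with \<mu> p 1 (\<lambda>x. ereal (u x))"

section \<open>Weights\<close>

definition weight :: "(real \<Rightarrow> real) \<Rightarrow> bool" where
  "weight w \<longleftrightarrow> (\<forall>x. 0 \<le> w x) \<and> (\<forall>K. compact K \<longrightarrow> set_integrable lebesgue K w)"

text \<open>
  The relation \<open>d\<mu> = w dx\<close> between complete measures. The completion matters only if \<open>w\<close> vanishes
  on a set of positive Lebesgue measure, all of whose subsets are then null.
\<close>

definition has_weight :: "real measure \<Rightarrow> (real \<Rightarrow> real) \<Rightarrow> bool" where
  "has_weight \<mu> w \<longleftrightarrow> \<mu> = completion (density lebesgue (\<lambda>x. ennreal (w x)))"

end

theory Submission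
  imports Defs
begin

text \<open>
  Write \<open>\<sigma> = w\<^bsup>1/(1-p)\<^esup>\<close> for the dual weight of \<open>w\<close>, so that \<open>\<sigma>\<^bsup>p\<^esup> w = \<sigma>\<close> and \<open>\<sigma>\<^bsup>p-1\<^esup> w = 1\<close>. The
  theorem rests on one structural fact: doubling and the Poincare inequality force \<open>d\<mu> = w dx\<close> with
  \<open>w > 0\<close> almost everywhere and \<open>\<sigma>\<close> locally integrable (\<open>poincare_imp_weighted_line\<close>). To see this,
  test the Poincare inequality on a small ball \<open>B\<close> with the primitive of a function \<open>g\<close> living on the
  middle third \<open>J\<close> of \<open>B\<close>. This gives \<open>(\<integral>\<^sub>J g dx)\<^bsup>p\<^esup> \<mu>(B) \<le> C r\<^bsup>p\<^esup> \<integral>\<^sub>J g\<^bsup>p\<^esup> d\<mu>\<close>. The indicator of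
  the complement of a Lebesgue null set \<open>N\<close> yields \<open>\<mu>(B) \<le> C \<mu>(B - N)\<close> and hence absolute continuity;
  truncations of \<open>\<sigma>\<close> bound \<open>\<integral>\<^sub>J \<sigma> dx\<close>.

  Local integrability of \<open>\<sigma>\<close> makes \<open>L\<^bsup>p\<^esup>(\<mu>)\<close> functions locally integrable, so no segment belongs to an
  exceptional family of curves. A function \<open>g\<close> is therefore a weak upper gradient of a function \<open>u\<close> on the
  line as soon as, and only if, it controls the increments of \<open>u\<close> over intervals. Consequently Newtonian
  functions are locally absolutely continuous and \<open>g\<^sub>u = \<bar>u'\<bar>\<close>
  (\<open>minimal_weak_upper_gradient_ac\<close>), and the problem becomes one of calculus of variations in one
  variable, whose natural coordinate is a primitive \<open>\<Sigma>\<close> of \<open>\<sigma>\<close>.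

  If one of the two integrals of \<open>\<sigma>\<close> is finite, then \<open>\<Sigma>\<close> is bounded on one side, and \<open>\<Sigma>\<close> or \<open>-\<Sigma>\<close>
  plus a constant is positive. It is \<open>p\<close>-harmonic: by convexity its energy changes under a perturbation
  \<open>\<phi>\<close> by at least a multiple of \<open>\<integral> \<phi>' dx\<close> over \<open>{\<phi> \<noteq> 0}\<close>, and that integral vanishes
  (\<open>integral_derivative_eq_0\<close>, \<open>p_harmonic_dual_primitive\<close>).

  Conversely, comparing a quasiharmonic \<open>u\<close> on \<open>[x,y]\<close> with the function that is affine in \<open>\<Sigma>\<close> and
  has the same end values bounds the oscillation of \<open>u\<close> on \<open>[a,b] \<subseteq> [x,y]\<close> by \<open>\<bar>u(y) - u(x)\<bar>\<close> times
  a power of \<open>(\<Sigma>(b) - \<Sigma>(a)) / (\<Sigma>(y) - \<Sigma>(x))\<close> (\<open>quasiminimizer_oscillation\<close>). If \<open>\<Sigma>\<close> is unbounded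
  on both sides and \<open>u\<close> is positive and nonconstant, then \<open>u\<close> must be large far out on both sides;
  it takes equal values at two points \<open>x\<close>, \<open>y\<close> enclosing \<open>a\<close>, \<open>b\<close>, and the estimate makes it constant in
  between (\<open>quasiharmonic_imp_dual_finite\<close>).
\<close>

section \<open>Comparing Borel measures on intervals\<close>

lemma open_bounded_interval_eq:
  fixes S :: "real set"
  assumes "open S" "is_interval S" "S \<noteq> {}" "bounded S"
  shows "S = {Inf S<..<Sup S}"
proof (intro set_eqI iffI)
  fix x assume x: "x \<in> S"
  then obtain e where e: "e > 0" "ball x e \<subseteq> S" using assms(1) open_contains_ball by blast
  have "x - e/2 \<in> S" "x + e/2 \<in> S" using e by (auto simp: subset_iff dist_real_def)
  then have "Inf S \<le> x - e/2" "x + e/2 \<le> Sup S"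
    using assms(4) by (auto intro!: cInf_lower cSup_upper bounded_imp_bdd_below bounded_imp_bdd_above)
  then show "x \<in> {Inf S<..<Sup S}" using e by auto
next
  fix x assume x: "x \<in> {Inf S<..<Sup S}"
  obtain y where "y \<in> S" "y < x"
    using x cInf_less_iff[OF assms(3) bounded_imp_bdd_below[OF assms(4)]] by auto
  moreover obtain z where "z \<in> S" "x < z"
    using x less_cSup_iff[OF assms(3) bounded_imp_bdd_above[OF assms(4)]] by auto
  ultimately show "x \<in> S" using assms(2) unfolding is_interval_1 by (meson less_imp_le)
qed

text \<open>
  Open sets are countable disjoint unions of open intervals, and outer regularity of \<open>N\<close> carries the
  inequality from open sets to Borel sets. Upper gradients and the Poincare inequality only give
  information on intervals; this lemma is what turns it into statements about null sets.
\<close>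

lemma emeasure_le_of_open_intervals:
  fixes M N :: "real measure"
  assumes M: "sets M = sets borel"
    and N: "sets N = sets borel" "emeasure N UNIV < \<infinity>"
    and le: "\<And>a b. a < b \<Longrightarrow> emeasure M {a<..<b} \<le> emeasure N {a<..<b}"
    and A: "A \<in> sets borel"
  shows "emeasure M A \<le> emeasure N A"
proof -
  have int: "emeasure M I \<le> emeasure N I" if I: "open I" "is_interval I" for I
  proof -
    define J where "J n = I \<inter> {- real n<..<real n}" for n
    have J: "range J \<subseteq> sets borel" "incseq J" "(\<Union>n. J n) = I"
    proof -
      show "range J \<subseteq> sets borel" using I by (auto simp: J_def)
      show "incseq J" by (auto simp: J_def incseq_def)
      show "(\<Union>n. J n) = I"
      proof (intro set_eqI iffI)
        fix x assume "x \<in> I"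
        obtain n :: nat where "\<bar>x\<bar> < real n" using reals_Archimedean2 by blast
        then show "x \<in> (\<Union>n. J n)" using \<open>x \<in> I\<close> by (intro UN_I[of n]) (auto simp: J_def)
      qed (auto simp: J_def)
    qed
    have "emeasure M (J n) \<le> emeasure N (J n)" for n
    proof (cases "J n = {}")
      case False
      have eq: "J n = {Inf (J n)<..<Sup (J n)}"
        using I False unfolding J_def
        by (intro open_bounded_interval_eq) (auto simp: is_interval_Int is_interval_oo intro: bounded_Int)
      then have "Inf (J n) < Sup (J n)" using False by (metis greaterThanLessThan_empty_iff not_le)
      from le[OF this] show ?thesis by (simp only: eq[symmetric])
    qed simp
    then have "(SUP n. emeasure M (J n)) \<le> (SUP n. emeasure N (J n))" by (intro SUP_mono) blast
    then show ?thesis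
      using SUP_emeasure_incseq[of J M] SUP_emeasure_incseq[of J N] J M(1) N(1) by simp
  qed
  have op: "emeasure M U \<le> emeasure N U" if U: "open U" for U
  proof -
    have cnt: "countable (components U)"
      using U pairwise_disjoint_components[of U]
      by (intro countable_disjoint_open_subsets)
         (auto simp: disjoint_def pairwise_def disjnt_def intro: open_components)
    have op': "open C" "is_interval C" if "C \<in> components U" for C
      using that U open_components[of U C] in_components_connected[of C U]
      by (auto simp: is_interval_connected_1)
    have disj: "disjoint_family_on (\<lambda>C. C) (components U)"
      using pairwise_disjoint_components[of U]
      by (auto simp: disjoint_family_on_def pairwise_def disjnt_def)
    have eq: "emeasure L U = (\<integral>\<^sup>+C. emeasure L C \<partial>count_space (components U))"
      if L: "sets L = sets borel" for L :: "real measure"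
    proof -
      have "emeasure L (\<Union>C\<in>components U. C) = (\<integral>\<^sup>+C. emeasure L C \<partial>count_space (components U))"
        using cnt disj op' by (intro emeasure_UN_countable) (auto simp: L)
      then show ?thesis by simp
    qed
    show ?thesis unfolding eq[OF M] eq[OF N(1)]
      using int op' by (intro nn_integral_mono) auto
  qed
  have "emeasure N A = (INF U\<in>{U. A \<subseteq> U \<and> open U}. emeasure N U)"
    using N A by (intro outer_regular) (auto simp: sets_eq_imp_space_eq[OF N(1)])
  also have "\<dots> \<ge> emeasure M A"
  proof (rule INF_greatest)
    fix U assume "U \<in> {U. A \<subseteq> U \<and> open U}"
    then have "emeasure M A \<le> emeasure M U" "emeasure M U \<le> emeasure N U"
      using op M by (auto intro!: emeasure_mono)
    then show "emeasure M A \<le> emeasure N U" by simp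
  qed
  finally show ?thesis .
qed

text \<open>
  The measures with densities \<open>F\<close> and \<open>G\<close> are comparable on intervals, hence on the Borel set
  \<open>{G < F}\<close>, where the comparison forces \<open>\<integral> (F - G) = 0\<close>. This takes the place of Lebesgue's
  differentiation theorem: no pointwise derivative occurs anywhere below.
\<close>

lemma AE_le_of_interval_integrals:
  fixes F G :: "real \<Rightarrow> ennreal"
  assumes [measurable]: "F \<in> borel_measurable borel" "G \<in> borel_measurable borel"
    and le: "\<And>a b. a < b \<Longrightarrow> (\<integral>\<^sup>+x\<in>{a..b}. F x \<partial>lborel) \<le> (\<integral>\<^sup>+x\<in>{a..b}. G x \<partial>lborel)"
    and fin: "\<And>a b. a < b \<Longrightarrow> (\<integral>\<^sup>+x\<in>{a..b}. G x \<partial>lborel) < \<infinity>"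
  shows "AE x in lborel. F x \<le> G x"
proof -
  have *: "AE x in lborel. x \<in> {- real (Suc n)<..<real (Suc n)} \<longrightarrow> F x \<le> G x" for n
  proof -
    define B where "B = {- real (Suc n)<..<real (Suc n)}"
    have [measurable]: "B \<in> sets borel" by (simp add: B_def)
    define M where "M = density lborel (\<lambda>x. F x * indicator B x)"
    define N where "N = density lborel (\<lambda>x. G x * indicator B x)"
    have io: "(\<integral>\<^sup>+x\<in>{a<..<b}. H x \<partial>lborel) = (\<integral>\<^sup>+x\<in>{a..b}. H x \<partial>lborel)" for H :: "real \<Rightarrow> ennreal" and a b
      using AE_lborel_singleton[of a] AE_lborel_singleton[of b]
      by (intro nn_integral_cong_AE) (auto split: split_indicator elim!: eventually_elim2)
    have eq: "emeasure (density lborel (\<lambda>x. H x * indicator B x)) {a<..<b}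
        = (\<integral>\<^sup>+x\<in>{max a (- real (Suc n))..min b (real (Suc n))}. H x \<partial>lborel)" 
      if [measurable]: "H \<in> borel_measurable borel" for H :: "real \<Rightarrow> ennreal" and a b
      unfolding io[symmetric]
      by (subst emeasure_density) (auto simp: B_def intro!: nn_integral_cong split: split_indicator)
    have le': "emeasure M {a<..<b} \<le> emeasure N {a<..<b}" for a b
      unfolding M_def N_def eq[OF assms(1)] eq[OF assms(2)]
      using le[of "max a (- real (Suc n))" "min b (real (Suc n))"]
      by (cases "max a (- real (Suc n)) < min b (real (Suc n))") (auto simp: io[symmetric])
    have "emeasure N UNIV = (\<integral>\<^sup>+x\<in>{- real (Suc n)..real (Suc n)}. G x \<partial>lborel)"
      unfolding N_def io[symmetric] by (subst emeasure_density) (auto simp: B_def)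
    then have "emeasure N UNIV < \<infinity>" using fin[of "- real (Suc n)" "real (Suc n)"] by simp
    define A where "A = {x\<in>B. G x < F x}"
    have [measurable]: "A \<in> sets borel" unfolding A_def by measurable
    have "emeasure M A \<le> emeasure N A"
      by (rule emeasure_le_of_open_intervals)
        (use le' \<open>emeasure N UNIV < \<infinity>\<close> in \<open>auto simp: M_def N_def\<close>)
    moreover have "emeasure M A = (\<integral>\<^sup>+x. F x * indicator A x \<partial>lborel)"
      unfolding M_def by (subst emeasure_density) (auto simp: A_def intro!: nn_integral_cong split: split_indicator)
    moreover have NA: "emeasure N A = (\<integral>\<^sup>+x. G x * indicator A x \<partial>lborel)"
      unfolding N_def by (subst emeasure_density) (auto simp: A_def intro!: nn_integral_cong split: split_indicator)
    moreover have "emeasure N A < \<infinity>"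
      using \<open>emeasure N UNIV < \<infinity>\<close> emeasure_mono[of A UNIV N] by (auto simp: N_def intro: le_less_trans)
    ultimately have "(\<integral>\<^sup>+x. F x * indicator A x - G x * indicator A x \<partial>lborel) = 0"
      by (subst nn_integral_diff)
         (auto simp: A_def[symmetric] diff_eq_0_ennreal less_top intro!: AE_I2 split: split_indicator,
          auto simp: A_def)
    then have "AE x in lborel. F x * indicator A x - G x * indicator A x = 0"
      by (subst (asm) nn_integral_0_iff_AE) auto
    then show ?thesis
      by eventually_elim (auto simp: A_def B_def ennreal_minus_eq_0 split: split_indicator_asm dest: ennreal_minus_eq_0)
  qed
  have "AE x in lborel. \<forall>n. x \<in> {- real (Suc n)<..<real (Suc n)} \<longrightarrow> F x \<le> G x"
    using * by (subst AE_all_countable) auto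
  then show ?thesis
  proof eventually_elim
    case (elim x)
    obtain n where "\<bar>x\<bar> < real n" using reals_Archimedean2 by blast
    then have "x \<in> {- real (Suc n)<..<real (Suc n)}" by auto
    then show ?case using elim by blast
  qed
qed

lemma nn_integral_mono_measure:
  assumes "sets M = sets N" and le: "\<And>A. A \<in> sets N \<Longrightarrow> emeasure M A \<le> emeasure N A"
    and g: "g \<in> borel_measurable N"
  shows "(\<integral>\<^sup>+x. g x \<partial>M) \<le> (\<integral>\<^sup>+x. g x \<partial>N)"
  using g
proof (induction rule: borel_measurable_induct)
  note [measurable_cong] = assms(1)
  note [simp] = assms(1) sets_eq_imp_space_eq[OF assms(1)]
  {
    case (cong f g) then show ?case by (simp cong: nn_integral_cong_simp)
  next
    case (set A) then show ?case using le by simp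
  next
    case (mult u c) 
    then have "u \<in> borel_measurable M" by measurable
    with mult show ?case by (simp add: nn_integral_cmult mult_left_mono)
  next
    case (add u v) 
    then have "u \<in> borel_measurable M" "v \<in> borel_measurable M" by measurable
    with add show ?case by (simp add: nn_integral_add add_mono)
  next
    case (seq U) 
    then have *: "\<And>i. U i \<in> borel_measurable M" by measurable
    have eq: "(\<integral>\<^sup>+x. (SUP i. U i x) \<partial>L) = (SUP i. \<integral>\<^sup>+x. U i x \<partial>L)" if "\<And>i. U i \<in> borel_measurable L" for L
      using seq that by (intro nn_integral_monotone_convergence_SUP) auto
    have "(\<integral>\<^sup>+x. (SUP i. U i x) \<partial>M) \<le> (\<integral>\<^sup>+x. (SUP i. U i x) \<partial>N)"
      unfolding eq[OF *] eq[OF seq(1)] by (rule SUP_mono) (use seq in blast)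
    then show ?case by (simp add: SUP_apply[abs_def] image_comp)
  }
qed

section \<open>Locally absolutely continuous functions\<close>

text \<open>
  Local absolute continuity, encoded through a chosen Borel density \<open>f\<close>, which is unique up to null
  sets; \<open>f\<close> plays the role of \<open>u'\<close>.
\<close>

definition ac_derivative :: "(real \<Rightarrow> real) \<Rightarrow> (real \<Rightarrow> real) \<Rightarrow> bool" where
  "ac_derivative u f \<longleftrightarrow> f \<in> borel_measurable borel \<and>
     (\<forall>a b. a \<le> b \<longrightarrow> set_integrable lborel {a..b} f \<and> u b - u a = (LINT x:{a..b}|lborel. f x))"

lemma ac_derivative_measurable [measurable_dest]: "ac_derivative u f \<Longrightarrow> f \<in> borel_measurable borel"
  by (simp add: ac_derivative_def)

lemma ac_derivativeD:
  assumes "ac_derivative u f" "a \<le> b"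
  shows "set_integrable lborel {a..b} f" "u b - u a = (LINT x:{a..b}|lborel. f x)"
  using assms by (auto simp: ac_derivative_def)

lemma ac_derivative_add:
  assumes "ac_derivative u f" "ac_derivative v g"
  shows "ac_derivative (\<lambda>x. u x + v x) (\<lambda>x. f x + g x)"
proof -
  have "u b + v b - (u a + v a) = (LINT x:{a..b}|lborel. f x + g x)" if "a \<le> b" for a b
    using ac_derivativeD(2)[OF assms(1) that] ac_derivativeD(2)[OF assms(2) that]
      ac_derivativeD(1)[OF assms(1) that] ac_derivativeD(1)[OF assms(2) that]
    by (subst set_integral_add(2)) auto
  then show ?thesis using assms unfolding ac_derivative_def by (auto intro!: set_integral_add(1))
qed

lemma ac_derivative_cmult:
  assumes "ac_derivative u f"
  shows "ac_derivative (\<lambda>x. c * u x) (\<lambda>x. c * f x)"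
  using assms unfolding ac_derivative_def
  by (auto simp: right_diff_distrib[symmetric] intro!: set_integrable_mult_right)

lemma ac_derivative_add_const:
  "ac_derivative u f \<Longrightarrow> ac_derivative (\<lambda>x. u x + c) f"
  by (simp add: ac_derivative_def)

text \<open>
  Freezing \<open>d\<close> outside \<open>[x,y]\<close> multiplies its derivative by an indicator. This localizes global
  statements, and it produces test functions supported in \<open>[x,y]\<close> when \<open>d\<close> vanishes at both ends.
\<close>

lemma ac_derivative_restrict:
  assumes d: "ac_derivative d f" and xy: "x \<le> y"
  shows "ac_derivative (\<lambda>t. d (max x (min y t))) (\<lambda>t. f t * indicator {x..y} t)"
  unfolding ac_derivative_def
proof (intro conjI allI impI)
  have [measurable]: "f \<in> borel_measurable borel" using d by measurable
  show "(\<lambda>t. f t * indicator {x..y} t) \<in> borel_measurable borel" by measurable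
  fix a b :: real assume ab: "a \<le> b"
  have "set_integrable lborel ({a..b} \<inter> {x..y}) f"
    using ac_derivativeD(1)[OF d ab] by (rule set_integrable_subset) auto
  then show "set_integrable lborel {a..b} (\<lambda>t. f t * indicator {x..y} t)"
    unfolding set_integrable_def 
    by (rule back_subst[where P="integrable lborel"]) (auto split: split_indicator)
  have "(LINT t:{a..b}|lborel. f t * indicator {x..y} t) = (LINT t:{a..b}\<inter>{x..y}|lborel. f t)"
    unfolding set_lebesgue_integral_def by (intro Bochner_Integration.integral_cong) (auto split: split_indicator)
  also have "\<dots> = (LINT t:{max x (min y a)..max x (min y b)}|lborel. f t)"
  proof (cases "{a..b} \<inter> {x..y} = {}")
    case False
    then have "{a..b} \<inter> {x..y} = {max x (min y a)..max x (min y b)}" using ab xy by auto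
    then show ?thesis by (rule arg_cong)
  next
    case True
    then have e: "max x (min y a) = max x (min y b)" using ab xy by auto
    have "d (max x (min y b)) - d (max x (min y b)) = (LINT t:{max x (min y b)..max x (min y b)}|lborel. f t)"
      by (rule ac_derivativeD(2)[OF d]) simp
    then show ?thesis by (subst True) (simp add: e set_lebesgue_integral_def)
  qed
  also have "\<dots> = d (max x (min y b)) - d (max x (min y a))"
    by (rule ac_derivativeD(2)[OF d, symmetric]) (use ab in auto)
  finally show "d (max x (min y b)) - d (max x (min y a)) = (LINT t:{a..b}|lborel. f t * indicator {x..y} t)" by simp
qed

lemma ac_derivative_imp_continuous:
  assumes "ac_derivative u f"
  shows "continuous_on UNIV u"
proof -
  have "continuous_on {-n<..<n} u" for n :: real
  proof (cases "n > 0")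
    case True
    have i: "set_integrable lborel {a..b} f" if "a \<le> b" for a b
      using ac_derivativeD[OF assms that] by auto
    have "continuous_on {-n..n} (\<lambda>x. u (-n) + integral {-n..x} f)"
      using set_borel_integral_eq_integral(1)[OF i] True by (intro continuous_intros indefinite_integral_continuous_1) auto
    moreover have "u (-n) + integral {-n..x} f = u x" if "x \<in> {-n..n}" for x
      using set_borel_integral_eq_integral(2)[OF i[of "-n" x]] ac_derivativeD(2)[OF assms, of "-n" x] that by auto
    ultimately have "continuous_on {-n..n} u" using continuous_on_cong by (metis (no_types, lifting))
    then show ?thesis by (rule continuous_on_subset) auto
  qed simp
  then have "continuous_on (\<Union>n\<in>UNIV. {-n<..<n}) u"
    by (intro continuous_on_open_UN) auto
  moreover have "(\<Union>n\<in>UNIV. {-n<..<n}) = (UNIV :: real set)"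
  proof (intro set_eqI iffI UNIV_I)
    fix x :: real show "x \<in> (\<Union>n\<in>UNIV. {-n<..<n})" by (intro UN_I[of "\<bar>x\<bar> + 1"]) auto
  qed
  ultimately show ?thesis by simp
qed

lemma ac_derivative_imp_borel [measurable_dest]: "ac_derivative u f \<Longrightarrow> u \<in> borel_measurable borel"
  by (rule borel_measurable_continuous_onI[OF ac_derivative_imp_continuous])

lemma ac_derivative_abs_le:
  assumes "ac_derivative u f" "a \<le> b"
  shows "ennreal \<bar>u b - u a\<bar> \<le> (\<integral>\<^sup>+x\<in>{a..b}. ennreal \<bar>f x\<bar> \<partial>lborel)"
proof -
  note i = ac_derivativeD[OF assms]
  have "ennreal (norm (LINT x|lborel. indicator {a..b} x *\<^sub>R f x)) \<le> (\<integral>\<^sup>+x. norm (indicator {a..b} x *\<^sub>R f x) \<partial>lborel)"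
    by (rule integral_norm_bound_ennreal) (use i in \<open>simp add: set_integrable_def\<close>)
  also have "\<dots> = (\<integral>\<^sup>+x\<in>{a..b}. ennreal \<bar>f x\<bar> \<partial>lborel)"
    by (intro nn_integral_cong) (auto split: split_indicator)
  finally show ?thesis using i by (simp add: set_lebesgue_integral_def)
qed

lemma set_integrable_imp_nn_integral_finite:
  fixes f :: "real \<Rightarrow> real"
  assumes "set_integrable lborel A f"
  shows "(\<integral>\<^sup>+x\<in>A. ennreal \<bar>f x\<bar> \<partial>lborel) < \<infinity>"
proof -
  have "(\<integral>\<^sup>+x. norm (indicator A x *\<^sub>R f x) \<partial>lborel) < \<infinity>"
    using assms unfolding set_integrable_def integrable_iff_bounded by simp
  also have "(\<integral>\<^sup>+x. norm (indicator A x *\<^sub>R f x) \<partial>lborel) = (\<integral>\<^sup>+x\<in>A. ennreal \<bar>f x\<bar> \<partial>lborel)"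
    by (intro nn_integral_cong) (auto split: split_indicator)
  finally show ?thesis .
qed

text \<open>
  Minimality of \<open>\<bar>u'\<bar>\<close> among the functions controlling the increments of \<open>u\<close>. Since \<open>h\<close> bounds
  \<open>\<integral> e f\<close> for both signs \<open>e\<close>, the interval integrals of the positive part of \<open>e f\<close> are at most those of
  its negative part plus \<open>h\<close>.
\<close>

lemma ac_derivative_AE_le:
  fixes h :: "real \<Rightarrow> ennreal"
  assumes u: "ac_derivative u f" and [measurable]: "h \<in> borel_measurable lebesgue"
    and le: "\<And>a b. a < b \<Longrightarrow> ennreal \<bar>u b - u a\<bar> \<le> (\<integral>\<^sup>+x\<in>{a..b}. h x \<partial>lborel)"
    and fin: "\<And>a b. a < b \<Longrightarrow> (\<integral>\<^sup>+x\<in>{a..b}. h x \<partial>lborel) < \<infinity>"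
  shows "AE x in lborel. ennreal \<bar>f x\<bar> \<le> h x"
proof -
  have [measurable]: "f \<in> borel_measurable borel" using u by measurable
  obtain h' where h'[measurable]: "h' \<in> borel_measurable borel" and hh: "AE x in lborel. h x = h' x"
    using completion_ex_borel_measurable[of h lborel] assms(2) by auto
  have hi: "(\<integral>\<^sup>+x\<in>A. h x \<partial>lborel) = (\<integral>\<^sup>+x\<in>A. h' x \<partial>lborel)" for A
    using hh by (intro nn_integral_cong_AE) auto
  have key: "AE x in lborel. ennreal (e * f x) \<le> ennreal (- (e * f x)) + h' x" if e: "\<bar>e\<bar> = 1" for e :: real
  proof (rule AE_le_of_interval_integrals)
    fix a b :: real assume ab: "a < b"
    have i: "set_integrable lborel {a..b} (\<lambda>x. e * f x)"
      using ac_derivativeD(1)[OF u, of a b] ab by (intro set_integrable_mult_right) auto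
    have fin1: "(\<integral>\<^sup>+x\<in>{a..b}. ennreal (- (e * f x)) \<partial>lborel) < \<infinity>"
      by (rule le_less_trans[OF _ set_integrable_imp_nn_integral_finite[OF i]])
         (auto intro!: nn_integral_mono ennreal_leI mult_right_mono)
    have fin2: "(\<integral>\<^sup>+x\<in>{a..b}. ennreal (e * f x) \<partial>lborel) < \<infinity>"
      by (rule le_less_trans[OF _ set_integrable_imp_nn_integral_finite[OF i]])
         (auto intro!: nn_integral_mono ennreal_leI mult_right_mono)
    have int: "integrable lborel (\<lambda>x. indicator {a..b} x *\<^sub>R (e * f x))" using i by (simp add: set_integrable_def)
    have eq1: "(\<integral>\<^sup>+x. ennreal (indicator {a..b} x *\<^sub>R (e * f x)) \<partial>lborel) = (\<integral>\<^sup>+x\<in>{a..b}. ennreal (e * f x) \<partial>lborel)"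
      by (intro nn_integral_cong) (auto split: split_indicator)
    have eq2: "(\<integral>\<^sup>+x. ennreal (- (indicator {a..b} x *\<^sub>R (e * f x))) \<partial>lborel) = (\<integral>\<^sup>+x\<in>{a..b}. ennreal (- (e * f x)) \<partial>lborel)"
      by (intro nn_integral_cong) (auto split: split_indicator)
    have "e * (u b - u a) = (LINT x:{a..b}|lborel. e * f x)"
      using ac_derivativeD(2)[OF u, of a b] ab by simp
    also have "\<dots> = enn2real (\<integral>\<^sup>+x\<in>{a..b}. ennreal (e * f x) \<partial>lborel) - enn2real (\<integral>\<^sup>+x\<in>{a..b}. ennreal (- (e * f x)) \<partial>lborel)"
      unfolding set_lebesgue_integral_def real_lebesgue_integral_def[OF int] eq1 eq2 ..
    finally have *: "enn2real (\<integral>\<^sup>+x\<in>{a..b}. ennreal (e * f x) \<partial>lborel) \<le> enn2real (\<integral>\<^sup>+x\<in>{a..b}. ennreal (- (e * f x)) \<partial>lborel) + \<bar>u b - u a\<bar>"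
      using e by (auto simp: abs_if split: if_splits)
    have "(\<integral>\<^sup>+x\<in>{a..b}. ennreal (e * f x) \<partial>lborel) = ennreal (enn2real (\<integral>\<^sup>+x\<in>{a..b}. ennreal (e * f x) \<partial>lborel))"
      using fin2 by (simp add: less_top)
    also have "\<dots> \<le> ennreal (enn2real (\<integral>\<^sup>+x\<in>{a..b}. ennreal (- (e * f x)) \<partial>lborel) + \<bar>u b - u a\<bar>)"
      using * by (rule ennreal_leI)
    also have "\<dots> = (\<integral>\<^sup>+x\<in>{a..b}. ennreal (- (e * f x)) \<partial>lborel) + ennreal \<bar>u b - u a\<bar>"
      using fin1 by (subst ennreal_plus) (auto simp: less_top)
    also have "\<dots> \<le> (\<integral>\<^sup>+x\<in>{a..b}. ennreal (- (e * f x)) \<partial>lborel) + (\<integral>\<^sup>+x\<in>{a..b}. h' x \<partial>lborel)"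
      using le[OF ab] by (intro add_left_mono) (simp add: hi)
    also have sum: "\<dots> = (\<integral>\<^sup>+x\<in>{a..b}. (ennreal (- (e * f x)) + h' x) \<partial>lborel)"
      by (subst nn_integral_add[symmetric]) (auto simp: distrib_right)
    finally show "(\<integral>\<^sup>+x\<in>{a..b}. ennreal (e * f x) \<partial>lborel) \<le> (\<integral>\<^sup>+x\<in>{a..b}. (ennreal (- (e * f x)) + h' x) \<partial>lborel)" .
    show "(\<integral>\<^sup>+x\<in>{a..b}. (ennreal (- (e * f x)) + h' x) \<partial>lborel) < \<infinity>"
      using fin1 fin[OF ab] by (simp add: sum[symmetric] hi)
  qed measurable
  have "AE x in lborel. ennreal (f x) \<le> ennreal (- f x) + h' x" using key[of 1] by simp
  moreover have "AE x in lborel. ennreal (- f x) \<le> ennreal (f x) + h' x" using key[of "-1"] by simp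
  ultimately show ?thesis using hh
  proof eventually_elim
    case (elim x)
    then show ?case by (cases "0 \<le> f x") (auto simp: ennreal_neg)
  qed
qed

lemma ac_derivative_of_integrable:
  assumes [measurable]: "f \<in> borel_measurable borel" and i: "\<And>b. set_integrable lborel {..b} f"
  shows "ac_derivative (\<lambda>x. LINT t:{..x}|lborel. f t) f"
  unfolding ac_derivative_def
proof (intro conjI allI impI)
  fix a b :: real assume ab: "a \<le> b"
  show int: "set_integrable lborel {a..b} f" using i[of b] by (rule set_integrable_subset) auto
  have io: "set_integrable lborel {a<..b} f" using i[of b] by (rule set_integrable_subset) auto
  have "(LINT t:{..a} \<union> {a<..b}|lborel. f t) = (LINT t:{..a}|lborel. f t) + (LINT t:{a<..b}|lborel. f t)"
    using i io by (intro set_integral_Un) auto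
  also have "{..a} \<union> {a<..b} = {..b}" using ab by auto
  also have "(LINT t:{a<..b}|lborel. f t) = (LINT t:{a..b}|lborel. f t)"
    unfolding set_lebesgue_integral_def using AE_lborel_singleton[of a]
    by (intro integral_cong_AE) (auto split: split_indicator)
  finally show "(LINT t:{..b}|lborel. f t) - (LINT t:{..a}|lborel. f t) = (LINT t:{a..b}|lborel. f t)" by simp
qed simp

lemma AE_finite_of_locally_finite_integral:
  fixes h :: "real \<Rightarrow> ennreal"
  assumes [measurable]: "h \<in> borel_measurable borel"
    and fin: "\<And>n::nat. (\<integral>\<^sup>+x\<in>{- real n..real n}. h x \<partial>lborel) < \<infinity>"
  shows "AE x in lborel. h x \<noteq> \<infinity>"
proof -
  have "AE x in lborel. \<forall>n::nat. h x * indicator {- real n..real n} x \<noteq> \<infinity>"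
    by (subst AE_all_countable, intro allI nn_integral_PInf_AE) (use fin in \<open>auto simp: less_top\<close>)
  then show ?thesis
  proof eventually_elim
    case (elim x)
    obtain n :: nat where "\<bar>x\<bar> < real n" using reals_Archimedean2 by blast
    then have "x \<in> {-real n..real n}" by auto
    then show ?case using elim[rule_format, of n] by auto
  qed
qed

text \<open>
  Adding to \<open>u\<close> the primitive \<open>G\<close> of \<open>g\<close> gives a nondecreasing continuous function \<open>F\<close> with
  increments at most \<open>2 \<integral> g\<close>. Its Stieltjes measure is therefore absolutely continuous, and its
  Radon-Nikodym density minus \<open>g\<close> is a derivative of \<open>u\<close>.
\<close>

text \<open>
  Only local bounds, possibly by unrelated functions \<open>g n\<close>, are available for functions that are
  Newtonian on bounded sets. The functions \<open>u\<close> frozen outside \<open>[-n,n]\<close> have derivatives by the global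
  statement; these agree almost everywhere on overlaps and are glued.
\<close>

lemma ex_ac_derivative_of_integrable_bound:
  fixes g :: "real \<Rightarrow> ennreal"
  assumes g: "g \<in> borel_measurable lebesgue" and fin: "(\<integral>\<^sup>+x. g x \<partial>lborel) < \<infinity>"
    and le: "\<And>a b. a < b \<Longrightarrow> ennreal \<bar>u b - u a\<bar> \<le> (\<integral>\<^sup>+x\<in>{a..b}. g x \<partial>lborel)"
  obtains f where "ac_derivative u f"
proof -
  obtain h where h[measurable]: "h \<in> borel_measurable borel" and gh: "AE x in lborel. g x = h x"
    using completion_ex_borel_measurable[of g lborel] g by auto
  have fh: "(\<integral>\<^sup>+x. h x \<partial>lborel) < \<infinity>"
    using fin nn_integral_cong_AE[OF gh] by simp
  define r where "r x = enn2real (h x)" for x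
  have [measurable]: "r \<in> borel_measurable borel" unfolding r_def by measurable
  have "AE x in lborel. h x \<noteq> \<infinity>" using fh by (intro nn_integral_PInf_AE) auto
  then have gr: "AE x in lborel. g x = ennreal (r x)"
    using gh by eventually_elim (auto simp: r_def less_top)
  have rint: "integrable lborel r"
  proof (rule integrableI_nonneg)
    show "(\<integral>\<^sup>+x. ennreal (r x) \<partial>lborel) < \<infinity>"
      using fin nn_integral_cong_AE[OF gr] by simp
  qed (auto simp: r_def)
  then have rs: "set_integrable lborel A r" if "A \<in> sets borel" for A
    using that unfolding set_integrable_def by (intro integrable_mult_indicator) auto
  define G where "G x = (LINT t:{..x}|lborel. r t)" for x
  have G: "ac_derivative G r"
    unfolding G_def by (rule ac_derivative_of_integrable) (auto intro: rs)
  have gG: "(\<integral>\<^sup>+x\<in>{a..b}. ennreal (r x) \<partial>lborel) = ennreal (G b - G a)" if "a \<le> b" for a b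
  proof -
    have "(\<integral>\<^sup>+x. ennreal (r x * indicator {a..b} x) \<partial>lborel) = ennreal (\<integral>x. r x * indicator {a..b} x \<partial>lborel)"
      using rs[of "{a..b}"] by (intro nn_integral_eq_integral) (auto simp: set_integrable_def r_def mult.commute)
    also have "(\<integral>x. r x * indicator {a..b} x \<partial>lborel) = G b - G a"
      unfolding ac_derivativeD(2)[OF G that] set_lebesgue_integral_def by (simp add: mult.commute)
    also have "(\<integral>\<^sup>+x. ennreal (r x * indicator {a..b} x) \<partial>lborel) = (\<integral>\<^sup>+x\<in>{a..b}. ennreal (r x) \<partial>lborel)"
      by (intro nn_integral_cong) (auto split: split_indicator)
    finally show ?thesis .
  qed
  have Gmono: "G a \<le> G b" if "a \<le> b" for a b
    using ac_derivativeD(2)[OF G that] 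
    by (simp add: set_lebesgue_integral_def r_def) (smt (verit) Bochner_Integration.integral_nonneg_AE AE_I2 enn2real_nonneg indicator_pos_le mult_nonneg_nonneg)
  have uG: "\<bar>u b - u a\<bar> \<le> \<bar>G b - G a\<bar>" for a b
  proof -
    have *: "\<bar>u b - u a\<bar> \<le> G b - G a" if "a < b" for a b
    proof -
      have "ennreal \<bar>u b - u a\<bar> \<le> (\<integral>\<^sup>+x\<in>{a..b}. g x \<partial>lborel)" by (rule le[OF that])
      also have "\<dots> = (\<integral>\<^sup>+x\<in>{a..b}. ennreal (r x) \<partial>lborel)"
        using gr by (intro nn_integral_cong_AE) auto
      also have "\<dots> = ennreal (G b - G a)" using that by (intro gG) simp
      finally show ?thesis using Gmono[of a b] that by (simp add: ennreal_le_iff)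
    qed
    show ?thesis using *[of a b] *[of b a] by (cases a b rule: linorder_cases) (auto simp: abs_minus_commute)
  qed
  define F where "F x = u x + G x" for x
  have Fmono: "F a \<le> F b" if "a \<le> b" for a b
    using uG[of b a] Gmono[OF that] by (auto simp: F_def)
  have cG: "isCont G x" for x
    using ac_derivative_imp_continuous[OF G] by (simp add: continuous_on_eq_continuous_at)
  have cF: "isCont F x" for x
  proof -
    have "(\<lambda>y. F y - F x) \<midarrow>x\<rightarrow> 0"
    proof (rule Lim_null_comparison)
      show "\<forall>\<^sub>F y in at x. norm (F y - F x) \<le> 2 * \<bar>G y - G x\<bar>"
      proof (rule always_eventually, rule allI)
        fix y show "norm (F y - F x) \<le> 2 * \<bar>G y - G x\<bar>" using uG[of y x] unfolding F_def real_norm_def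
          by (simp add: abs_le_iff abs_if split: if_splits)
      qed
      have "(\<lambda>y. 2 * \<bar>G y - G x\<bar>) \<midarrow>x\<rightarrow> 2 * \<bar>G x - G x\<bar>"
        using cG[of x] unfolding isCont_def by (intro tendsto_intros)
      then show "(\<lambda>y. 2 * \<bar>G y - G x\<bar>) \<midarrow>x\<rightarrow> 0" by simp
    qed
    then show ?thesis unfolding isCont_def by (simp add: LIM_zero_iff)
  qed
  have emF: "emeasure (interval_measure F) {a<..b} = F b - F a" if "a \<le> b" for a b
    by (intro emeasure_interval_measure_Ioc that Fmono) 
       (auto intro: continuous_at_imp_continuous_within cF)
  have AC: "emeasure (interval_measure F) A \<le> emeasure (density lborel (\<lambda>x. ennreal (2 * r x))) A" 
    if "A \<in> sets borel" for A
  proof (rule emeasure_le_of_open_intervals)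
    have "emeasure (density lborel (\<lambda>x. ennreal (2 * r x))) UNIV = 2 * (\<integral>\<^sup>+x. ennreal (r x) \<partial>lborel)"
      by (subst emeasure_density) (auto simp: ennreal_mult' nn_integral_cmult)
    also have "\<dots> < \<infinity>" using fin nn_integral_cong_AE[OF gr] by (auto simp: ennreal_mult_less_top)
    finally show "emeasure (density lborel (\<lambda>x. ennreal (2 * r x))) UNIV < \<infinity>" .
    fix a b :: real assume ab: "a < b"
    have "emeasure (interval_measure F) {a<..<b} \<le> emeasure (interval_measure F) {a<..b}"
      by (intro emeasure_mono) auto
    also have "\<dots> = ennreal (F b - F a)" using ab by (intro emF) simp
    also have "\<dots> \<le> ennreal (2 * (G b - G a))"
      using uG[of b a] Gmono[of a b] ab by (intro ennreal_leI) (auto simp: F_def)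
    also have "\<dots> = 2 * (\<integral>\<^sup>+x\<in>{a..b}. ennreal (r x) \<partial>lborel)"
      using ab Gmono[of a b] ennreal_mult[of 2 "G b - G a"] by (subst gG) auto
    also have "\<dots> = emeasure (density lborel (\<lambda>x. ennreal (2 * r x))) {a<..<b}"
      using AE_lborel_singleton[of a] AE_lborel_singleton[of b]
      by (subst emeasure_density, simp, simp, subst nn_integral_cmult[symmetric], simp)
         (intro nn_integral_cong_AE, auto simp: ennreal_mult' split: split_indicator elim!: eventually_elim2)
    finally show "emeasure (interval_measure F) {a<..<b} \<le> emeasure (density lborel (\<lambda>x. ennreal (2 * r x))) {a<..<b}" .
  qed (use that in auto)
  have "absolutely_continuous lborel (interval_measure F)"
  proof (unfold absolutely_continuous_def, rule subsetI)
    fix A :: "real set" assume A: "A \<in> null_sets lborel"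
    then have "emeasure (density lborel (\<lambda>x. ennreal (2 * r x))) A = 0"
      by (subst emeasure_density) (auto simp: null_sets_def nn_integral_null_set)
    then show "A \<in> null_sets (interval_measure F)" using AC[of A] A by (auto simp: null_sets_def)
  qed
  then obtain k where k[measurable]: "k \<in> borel_measurable borel" and kF: "density lborel k = interval_measure F"
    using sigma_finite_measure.Radon_Nikodym[OF sigma_finite_lborel, of "interval_measure F"] by auto
  have ki: "(\<integral>\<^sup>+x\<in>{a..b}. k x \<partial>lborel) = ennreal (F b - F a)" if "a \<le> b" for a b
  proof -
    have "(\<integral>\<^sup>+x\<in>{a..b}. k x \<partial>lborel) = (\<integral>\<^sup>+x\<in>{a<..b}. k x \<partial>lborel)"
      using AE_lborel_singleton[of a] by (intro nn_integral_cong_AE) (auto split: split_indicator)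
    also have "\<dots> = emeasure (density lborel k) {a<..b}" by (subst emeasure_density) auto
    finally show ?thesis using emF[OF that] kF by simp
  qed
  have kfin: "AE x in lborel. k x \<noteq> \<infinity>"
    by (rule AE_finite_of_locally_finite_integral) (auto simp: ki)
  have "ac_derivative F (\<lambda>x. enn2real (k x))"
    unfolding ac_derivative_def
  proof (intro conjI allI impI)
    fix a b :: real assume ab: "a \<le> b"
    have "(\<integral>\<^sup>+x. ennreal (indicator {a..b} x * enn2real (k x)) \<partial>lborel) = (\<integral>\<^sup>+x\<in>{a..b}. k x \<partial>lborel)"
      using kfin by (intro nn_integral_cong_AE) (auto simp: less_top split: split_indicator elim!: eventually_mono)
    then have eq: "(\<integral>\<^sup>+x. ennreal (indicator {a..b} x * enn2real (k x)) \<partial>lborel) = ennreal (F b - F a)"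
      using ki[OF ab] by simp
    have hb: "has_bochner_integral lborel (\<lambda>x. indicator {a..b} x * enn2real (k x)) (F b - F a)"
      using eq Fmono[OF ab] by (intro has_bochner_integral_nn_integral) auto
    then show "set_integrable lborel {a..b} (\<lambda>x. enn2real (k x))"
      unfolding set_integrable_def by (auto simp: integrable.simps)
    show "F b - F a = (LINT x:{a..b}|lborel. enn2real (k x))"
      using has_bochner_integral_integral_eq[OF hb] unfolding set_lebesgue_integral_def by simp
  qed simp
  from ac_derivative_add[OF this ac_derivative_cmult[OF G, of "-1"]]
  have "ac_derivative u (\<lambda>x. enn2real (k x) + - 1 * r x)" by (simp add: F_def)
  then show thesis by (rule that)
qed

lemma ac_derivative_unique:
  assumes "ac_derivative u f" "ac_derivative u g"
  shows "AE x in lborel. f x = g x"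
proof -
  have "ac_derivative (\<lambda>x. 0) (\<lambda>x. f x + (- 1) * g x)"
    using ac_derivative_add[OF assms(1) ac_derivative_cmult[OF assms(2), of "-1"]] by simp
  then have "AE x in lborel. ennreal \<bar>f x + (- 1) * g x\<bar> \<le> 0"
    by (rule ac_derivative_AE_le) auto
  then show ?thesis by eventually_elim (simp add: ennreal_eq_0_iff)
qed

lemma ex_ac_derivative:
  fixes g :: "nat \<Rightarrow> real \<Rightarrow> ennreal"
  assumes g: "\<And>n. g n \<in> borel_measurable lebesgue"
    and fin: "\<And>n. (\<integral>\<^sup>+x\<in>{-real n..real n}. g n x \<partial>lborel) < \<infinity>"
    and le: "\<And>n a b. - real n \<le> a \<Longrightarrow> a < b \<Longrightarrow> b \<le> real n \<Longrightarrow>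
      ennreal \<bar>u b - u a\<bar> \<le> (\<integral>\<^sup>+x\<in>{a..b}. g n x \<partial>lborel)"
  obtains f where "ac_derivative u f"
    "\<And>n. AE x in lborel. x \<in> {-real n..real n} \<longrightarrow> ennreal \<bar>f x\<bar> \<le> g n x"
proof -
  define v where "v n t = u (max (- real n) (min (real n) t))" for n :: nat and t
  have gm: "(\<lambda>x. g n x * indicator {-real n..real n} x) \<in> borel_measurable lebesgue" for n
    using g[of n] by (intro borel_measurable_times_ennreal borel_measurable_indicator) auto
  have vinc: "ennreal \<bar>v n b - v n a\<bar> \<le> (\<integral>\<^sup>+x\<in>{a..b}. g n x * indicator {-real n..real n} x \<partial>lborel)"
    if ab: "a < b" for n a b
  proof -
    define c d where "c = max (- real n) (min (real n) a)" and "d = max (- real n) (min (real n) b)"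
    show ?thesis
    proof (cases "c < d")
      case True
      then have *: "- real n \<le> c" "d \<le> real n" "a \<le> c" "d \<le> b"
        using ab by (auto simp: c_def d_def)
      have "ennreal \<bar>v n b - v n a\<bar> \<le> (\<integral>\<^sup>+x\<in>{c..d}. g n x \<partial>lborel)"
        using le[of n c d] True * unfolding v_def c_def[symmetric] d_def[symmetric] by simp
      also have "\<dots> \<le> (\<integral>\<^sup>+x\<in>{a..b}. g n x * indicator {-real n..real n} x \<partial>lborel)"
        using * by (intro nn_integral_mono) (auto split: split_indicator)
      finally show ?thesis .
    next
      case False
      then have "c = d" using ab by (auto simp: c_def d_def)
      then show ?thesis by (simp add: v_def c_def d_def)
    qed
  qed
  have "\<exists>f. ac_derivative (v n) f" for n
    by (rule ex_ac_derivative_of_integrable_bound[OF gm[of n] fin[of n] vinc]) auto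
  then obtain f where f: "\<And>n. ac_derivative (v n) (f n)" by metis
  have [measurable]: "f n \<in> borel_measurable borel" for n using f by measurable
  \<comment> \<open>the index is the least \<open>n\<close> with \<open>\<bar>x\<bar> \<le> n\<close>\<close>
  define F where "F x = f (nat \<lceil>\<bar>x\<bar>\<rceil>) x" for x
  have [measurable]: "F \<in> borel_measurable borel" unfolding F_def by measurable
  have cmp: "AE x in lborel. x \<in> {-real m..real m} \<longrightarrow> f n x = f m x" if "m \<le> n" for m n
  proof -
    have "ac_derivative (\<lambda>t. v n (max (-real m) (min (real m) t))) (\<lambda>t. f n t * indicator {-real m..real m} t)"
      by (rule ac_derivative_restrict[OF f]) simp
    moreover have "(\<lambda>t. v n (max (-real m) (min (real m) t))) = (\<lambda>t. v m (max (-real m) (min (real m) t)))"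
      using that by (auto simp: v_def max_def min_def)
    moreover have "ac_derivative (\<lambda>t. v m (max (-real m) (min (real m) t))) (\<lambda>t. f m t * indicator {-real m..real m} t)"
      by (rule ac_derivative_restrict[OF f]) simp
    ultimately have "AE x in lborel. f n x * indicator {-real m..real m} x = f m x * indicator {-real m..real m} x"
      by (metis ac_derivative_unique)
    then show ?thesis by eventually_elim (auto split: split_indicator_asm)
  qed
  have "AE x in lborel. \<forall>m n. m \<le> n \<longrightarrow> x \<in> {-real m..real m} \<longrightarrow> f n x = f m x"
    using cmp by (auto simp: AE_all_countable)
  then have FF: "AE x in lborel. \<forall>n. x \<in> {-real n..real n} \<longrightarrow> F x = f n x"
  proof eventually_elim
    case (elim x)
    show ?case
    proof (intro allI impI)
      fix n assume n: "x \<in> {-real n..real n}"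
      then have "\<bar>x\<bar> \<le> real n" by auto
      then have "nat \<lceil>\<bar>x\<bar>\<rceil> \<le> n" by (simp add: ceiling_le_iff nat_le_iff)
      moreover have "\<bar>x\<bar> \<le> real (nat \<lceil>\<bar>x\<bar>\<rceil>)" by linarith
      then have "x \<in> {- real (nat \<lceil>\<bar>x\<bar>\<rceil>)..real (nat \<lceil>\<bar>x\<bar>\<rceil>)}" unfolding atLeastAtMost_iff by linarith
      ultimately show "F x = f n x" using elim unfolding F_def by metis
    qed
  qed
  have "ac_derivative u F"
    unfolding ac_derivative_def
  proof (intro conjI allI impI)
    fix a b :: real assume ab: "a \<le> b"
    obtain n :: nat where "max \<bar>a\<bar> \<bar>b\<bar> < real n" using reals_Archimedean2 by blast
    then have n: "- real n \<le> a" "a \<le> real n" "-real n \<le> b" "b \<le> real n" by auto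
    have eq: "AE x in lborel. indicator {a..b} x *\<^sub>R F x = indicator {a..b} x *\<^sub>R f n x"
      using FF n by (auto split: split_indicator elim!: eventually_mono)
    note * = ac_derivativeD[OF f[of n] ab]
    show "set_integrable lborel {a..b} F"
      using *(1) unfolding set_integrable_def by (subst integrable_cong_AE[OF _ _ eq]) auto
    have "(LINT x:{a..b}|lborel. F x) = (LINT x:{a..b}|lborel. f n x)"
      unfolding set_lebesgue_integral_def by (rule integral_cong_AE[OF _ _ eq]) auto
    then show "u b - u a = (LINT x:{a..b}|lborel. F x)"
      using *(2) n by (simp add: v_def)
  qed simp
  moreover have "AE x in lborel. x \<in> {-real n..real n} \<longrightarrow> ennreal \<bar>F x\<bar> \<le> g n x" for n
  proof -
    have "(\<integral>\<^sup>+x\<in>{a..b}. g n x * indicator {-real n..real n} x \<partial>lborel) < \<infinity>" for a b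
      by (rule le_less_trans[OF _ fin[of n]]) (auto intro!: nn_integral_mono split: split_indicator)
    then have "AE x in lborel. ennreal \<bar>f n x\<bar> \<le> g n x * indicator {-real n..real n} x"
      by (intro ac_derivative_AE_le[OF f[of n] gm[of n] vinc]) auto
    then show ?thesis using FF by eventually_elim auto
  qed
  ultimately show thesis by (rule that)
qed

text \<open>
  The function \<open>\<bar>f\<bar>\<close> cut off to \<open>{u \<noteq> 0}\<close> still controls the increments of \<open>u\<close>, because the part of
  \<open>[a,b]\<close> between the first and the last zero contributes nothing to \<open>u(b) - u(a)\<close>. By minimality
  \<open>\<bar>f\<bar>\<close> lies below its cut-off.
\<close>

lemma ac_derivative_zero_on_zeros:
  assumes u: "ac_derivative u f"
  shows "AE x in lborel. u x = 0 \<longrightarrow> f x = 0"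
proof -
  have [measurable]: "f \<in> borel_measurable borel" using u by measurable
  have cont: "continuous_on UNIV u" by (rule ac_derivative_imp_continuous[OF u])
  have [measurable]: "u \<in> borel_measurable borel" by (rule borel_measurable_continuous_onI[OF cont])
  define h where "h x = ennreal \<bar>f x\<bar> * indicator {x. u x \<noteq> 0} x" for x
  have [measurable]: "h \<in> borel_measurable borel" unfolding h_def by measurable
  have "AE x in lborel. ennreal \<bar>f x\<bar> \<le> h x"
  proof (rule ac_derivative_AE_le[OF u])
    show "h \<in> borel_measurable lebesgue" by (rule measurable_completion) simp
    fix a b :: real assume ab: "a < b"
    have "(\<integral>\<^sup>+x\<in>{a..b}. h x \<partial>lborel) \<le> (\<integral>\<^sup>+x\<in>{a..b}. ennreal \<bar>f x\<bar> \<partial>lborel)"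
      by (intro nn_integral_mono) (auto simp: h_def split: split_indicator)
    also have "\<dots> < \<infinity>"
      using ac_derivativeD(1)[OF u, of a b] ab by (intro set_integrable_imp_nn_integral_finite) auto
    finally show "(\<integral>\<^sup>+x\<in>{a..b}. h x \<partial>lborel) < \<infinity>" .
    have free: "ennreal \<bar>u d - u c\<bar> \<le> (\<integral>\<^sup>+x\<in>{c<..<d}. h x \<partial>lborel)"
      if "c \<le> d" "\<And>x. c < x \<Longrightarrow> x < d \<Longrightarrow> u x \<noteq> 0" for c d
    proof -
      have "ennreal \<bar>u d - u c\<bar> \<le> (\<integral>\<^sup>+x\<in>{c..d}. ennreal \<bar>f x\<bar> \<partial>lborel)"
        by (rule ac_derivative_abs_le[OF u that(1)])
      also have "\<dots> = (\<integral>\<^sup>+x\<in>{c<..<d}. h x \<partial>lborel)"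
        using AE_lborel_singleton[of c] AE_lborel_singleton[of d] that(2)
        by (intro nn_integral_cong_AE) (auto simp: h_def split: split_indicator elim!: eventually_elim2)
      finally show ?thesis .
    qed
    show "ennreal \<bar>u b - u a\<bar> \<le> (\<integral>\<^sup>+x\<in>{a..b}. h x \<partial>lborel)"
    proof (cases "\<exists>x\<in>{a..b}. u x = 0")
      case False
      then have "ennreal \<bar>u b - u a\<bar> \<le> (\<integral>\<^sup>+x\<in>{a<..<b}. h x \<partial>lborel)"
        using ab by (intro free) auto
      also have "\<dots> \<le> (\<integral>\<^sup>+x\<in>{a..b}. h x \<partial>lborel)"
        by (intro nn_integral_mono) (auto split: split_indicator)
      finally show ?thesis .
    next
      case True
      define Z where "Z = {a..b} \<inter> u -` {0}"
      have "closed Z" unfolding Z_def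
        using cont by (intro continuous_closed_preimage) (auto intro: continuous_on_subset)
      have Z: "Z \<noteq> {}" "bdd_below Z" "bdd_above Z" using True by (auto simp: Z_def)
      define c d where "c = Inf Z" and "d = Sup Z"
      have "c \<in> Z" "d \<in> Z" unfolding c_def d_def
        using Z \<open>closed Z\<close> by (auto intro: closed_contains_Inf closed_contains_Sup)
      then have "u c = 0" "u d = 0" "a \<le> c" "c \<le> b" "a \<le> d" "d \<le> b" by (auto simp: Z_def)
      have "c \<le> d" using \<open>c \<in> Z\<close> Z unfolding d_def by (auto intro: cSup_upper)
      have nz: "u x \<noteq> 0" if "a < x" "x < c \<or> d < x" "x < b" for x
      proof
        assume "u x = 0"
        then have "x \<in> Z" using that by (auto simp: Z_def)
        then have "c \<le> x" "x \<le> d" unfolding c_def d_def using Z by (auto intro: cInf_lower cSup_upper)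
        then show False using that by auto
      qed
      have "ennreal \<bar>u b - u a\<bar> \<le> ennreal (\<bar>u c - u a\<bar> + \<bar>u b - u d\<bar>)"
        using \<open>u c = 0\<close> \<open>u d = 0\<close> by (intro ennreal_leI) auto
      also have "\<dots> = ennreal \<bar>u c - u a\<bar> + ennreal \<bar>u b - u d\<bar>" by (simp add: ennreal_plus)
      also have "\<dots> \<le> (\<integral>\<^sup>+x\<in>{a<..<c}. h x \<partial>lborel) + (\<integral>\<^sup>+x\<in>{d<..<b}. h x \<partial>lborel)"
        using \<open>a \<le> c\<close> \<open>d \<le> b\<close> \<open>c \<le> b\<close> \<open>a \<le> d\<close> by (intro add_mono free nz) auto
      also have "\<dots> = (\<integral>\<^sup>+x. h x * indicator {a<..<c} x + h x * indicator {d<..<b} x \<partial>lborel)"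
        by (intro nn_integral_add[symmetric]) auto
      also have "\<dots> \<le> (\<integral>\<^sup>+x\<in>{a..b}. h x \<partial>lborel)"
        using \<open>c \<le> d\<close> \<open>a \<le> c\<close> \<open>d \<le> b\<close> by (intro nn_integral_mono) (auto split: split_indicator)
      finally show ?thesis .
    qed
  qed
  then show ?thesis by eventually_elim (auto simp: h_def)
qed

lemma ex_ac_primitive:
  fixes f :: "real \<Rightarrow> real"
  assumes [measurable]: "f \<in> borel_measurable borel" and i: "\<And>a b. set_integrable lborel {a..b} f"
  obtains u where "ac_derivative u f"
proof -
  have add: "(LINT x:{a..c}|lborel. f x) = (LINT x:{a..b}|lborel. f x) + (LINT x:{b..c}|lborel. f x)"
    if "a \<le> b" "b \<le> c" for a b c
  proof -
    have io: "set_integrable lborel {b<..c} f" using i[of b c] by (rule set_integrable_subset) auto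
    have "(LINT x:{a..b} \<union> {b<..c}|lborel. f x) = (LINT x:{a..b}|lborel. f x) + (LINT x:{b<..c}|lborel. f x)"
      using i io by (intro set_integral_Un) auto
    also have "{a..b} \<union> {b<..c} = {a..c}" using that by auto
    also have "(LINT x:{b<..c}|lborel. f x) = (LINT x:{b..c}|lborel. f x)"
      unfolding set_lebesgue_integral_def using AE_lborel_singleton[of b]
      by (intro integral_cong_AE) (auto split: split_indicator)
    finally show ?thesis .
  qed
  define u where "u x = (if 0 \<le> x then LINT t:{0..x}|lborel. f t else - (LINT t:{x..0}|lborel. f t))" for x
  have "u b - u a = (LINT x:{a..b}|lborel. f x)" if "a \<le> b" for a b
    using that add[of 0 a b] add[of a 0 b] add[of a b 0] by (auto simp: u_def)
  then have "ac_derivative u f" unfolding ac_derivative_def using i by auto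
  then show thesis by (rule that)
qed

section \<open>Curves on the line\<close>

lemma arclength_curve_segment:
  assumes "a < b" "{a..b} \<subseteq> E"
  shows "arclength_curve E (\<lambda>t. a + t) (b - a)"
proof -
  have "curve_length (\<lambda>t. a + t) 0 t = ennreal t" if t: "0 \<le> t" for t
    unfolding curve_length_def
  proof (rule antisym)
    show "(SUP ts \<in> {ts. sorted ts \<and> set ts \<subseteq> {0..t}}.
        \<Sum>i<length ts - 1. ennreal (dist (a + ts ! i) (a + ts ! Suc i))) \<le> ennreal t"
    proof (rule SUP_least, clarify)
      fix ts :: "real list" assume ts: "sorted ts" "set ts \<subseteq> {0..t}"
      show "(\<Sum>i<length ts - 1. ennreal (dist (a + ts ! i) (a + ts ! Suc i))) \<le> ennreal t"
      proof (cases "ts = []")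
        case False
        have "(\<Sum>i<length ts - 1. ennreal (dist (a + ts ! i) (a + ts ! Suc i)))
           = ennreal (\<Sum>i<length ts - 1. dist (a + ts ! i) (a + ts ! Suc i))"
          by (simp add: sum_ennreal)
        also have "(\<Sum>i<length ts - 1. dist (a + ts ! i) (a + ts ! Suc i)) = (\<Sum>i<length ts - 1. ts ! Suc i - ts ! i)"
          using ts(1) by (intro sum.cong) (auto simp: dist_real_def sorted_iff_nth_Suc)
        also have "\<dots> = ts ! (length ts - 1) - ts ! 0" by (rule sum_lessThan_telescope)
        also have "\<dots> \<le> t"
        proof -
          have "ts ! (length ts - 1) \<in> set ts" "ts ! 0 \<in> set ts" using False by auto
          then have "ts ! (length ts - 1) \<in> {0..t}" "ts ! 0 \<in> {0..t}" using ts(2) by blast+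
          then show ?thesis by auto
        qed
        finally show ?thesis by (simp add: ennreal_leI)
      qed simp
    qed
    show "ennreal t \<le> (SUP ts \<in> {ts. sorted ts \<and> set ts \<subseteq> {0..t}}.
        \<Sum>i<length ts - 1. ennreal (dist (a + ts ! i) (a + ts ! Suc i)))"
      by (rule SUP_upper2[of "[0, t]"]) (use t in \<open>auto simp: dist_real_def\<close>)
  qed
  then show ?thesis using assms unfolding arclength_curve_def
    by (auto intro!: continuous_intros)
qed

text \<open>
  Appending \<open>s\<close> and \<open>t\<close> to a partition of \<open>[0,s]\<close> shows that the length up to \<open>t\<close> is at least the length
  up to \<open>s\<close> plus the chord.
\<close>

lemma arclength_curve_lipschitz:
  assumes \<gamma>: "arclength_curve E \<gamma> l" and st: "0 \<le> s" "s \<le> t" "t \<le> l"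
  shows "\<bar>\<gamma> t - \<gamma> s\<bar> \<le> t - s"
proof -
  define P where "P ts = (\<Sum>i<length ts - 1. ennreal (dist (\<gamma> (ts ! i)) (\<gamma> (ts ! Suc i))))" for ts
  define d where "d = \<bar>\<gamma> t - \<gamma> s\<bar>"
  have len: "(SUP ts \<in> {ts. sorted ts \<and> set ts \<subseteq> {0..r}}. P ts) = ennreal r" if "0 \<le> r" "r \<le> l" for r
    using \<gamma> that unfolding arclength_curve_def curve_length_def P_def by auto
  have up: "P ts \<le> ennreal r" if "0 \<le> r" "r \<le> l" "sorted ts" "set ts \<subseteq> {0..r}" for r ts
    unfolding len[OF that(1,2), symmetric] using that by (intro SUP_upper) auto
  have "P [s, t] \<le> ennreal t" using st by (intro up) auto
  then have dt: "d \<le> t" using st by (simp add: P_def d_def dist_real_def abs_minus_commute)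
  have "ennreal s \<le> ennreal (t - d)"
    unfolding len[of s, OF st(1) order_trans[OF st(2,3)], symmetric]
  proof (rule SUP_least, clarify)
    fix ts assume ts: "sorted ts" "set ts \<subseteq> {0..s}"
    let ?T = "ts @ [s, t]"
    let ?a = "\<lambda>i. ennreal (dist (\<gamma> (?T ! i)) (\<gamma> (?T ! Suc i)))"
    have "P ts + ennreal d = sum ?a {..<length ts - 1} + sum ?a {length ts}"
      unfolding P_def by (intro arg_cong2[where f="(+)"] sum.cong) (auto simp: nth_append d_def dist_real_def abs_minus_commute)
    also have "\<dots> = sum ?a ({..<length ts - 1} \<union> {length ts})"
      by (intro sum.union_disjoint[symmetric]) auto
    also have "\<dots> \<le> sum ?a {..<length ?T - 1}" by (intro sum_mono2) auto
    also have "\<dots> = P ?T" by (simp add: P_def)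
    also have "\<dots> \<le> ennreal t"
    proof (rule up)
      show "sorted ?T" using ts st by (auto simp: sorted_append)
      show "set ?T \<subseteq> {0..t}" using ts st by auto
    qed (use st in auto)
    finally have le: "P ts + ennreal d \<le> ennreal t" .
    then have "P ts \<noteq> top" by (metis ennreal_neq_top ennreal_add_eq_top top.extremum_unique)
    then obtain q where "P ts = ennreal q" "0 \<le> q" by (cases "P ts") auto
    with le show "P ts \<le> ennreal (t - d)" using dt st
      by (simp add: d_def flip: ennreal_plus)
  qed
  then have "s \<le> t - d" using dt by (simp add: ennreal_le_iff)
  then show ?thesis by (simp add: d_def)
qed

text \<open>
  Take preimages \<open>s\<close> of \<open>c\<close> and \<open>t\<close> of \<open>d\<close> at minimal distance from each other. Strictly between them the
  curve stays in \<open>(c,d)\<close>, by the intermediate value theorem and minimality, and having speed at most one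
  it needs at least the time \<open>d - c\<close>. The choice treats both directions of travel at once.
\<close>

lemma arclength_curve_time_in_interval:
  assumes \<gamma>: "arclength_curve E \<gamma> l" and cd: "c < d" "c \<in> \<gamma> ` {0..l}" "d \<in> \<gamma> ` {0..l}"
  shows "ennreal (d - c) \<le> emeasure lborel {t\<in>{0..l}. c < \<gamma> t \<and> \<gamma> t < d}"
proof -
  have cont: "continuous_on {0..l} \<gamma>" using \<gamma> by (simp add: arclength_curve_def)
  define S where "S e = {0..l} \<inter> \<gamma> -` {e}" for e
  have "compact (S e)" for e
    unfolding S_def compact_eq_bounded_closed using continuous_closed_preimage[OF cont, of "{e}"]
    by (auto intro: bounded_Int)
  then have "compact (S c \<times> S d)" by (intro compact_Times)
  moreover have "S c \<times> S d \<noteq> {}" using cd by (auto simp: S_def)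
  moreover have "continuous_on (S c \<times> S d) (\<lambda>z. \<bar>fst z - snd z\<bar>)" by (intro continuous_intros)
  ultimately obtain z where z: "z \<in> S c \<times> S d" "\<And>z'. z' \<in> S c \<times> S d \<Longrightarrow> \<bar>fst z - snd z\<bar> \<le> \<bar>fst z' - snd z'\<bar>"
    using continuous_attains_inf[of "S c \<times> S d" "\<lambda>z. \<bar>fst z - snd z\<bar>"] by blast
  obtain s t where st: "z = (s, t)" by (cases z)
  have s: "s \<in> {0..l}" "\<gamma> s = c" and t: "t \<in> {0..l}" "\<gamma> t = d" using z(1) by (auto simp: st S_def)
  have mn: "\<bar>s - t\<bar> \<le> \<bar>s' - t'\<bar>" if "s' \<in> {0..l}" "\<gamma> s' = c" "t' \<in> {0..l}" "\<gamma> t' = d" for s' t'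
    using z(2)[of "(s', t')"] that by (auto simp: st S_def)
  have ivt: "\<exists>x\<in>closed_segment r q. \<gamma> x = y" if "r \<in> {0..l}" "q \<in> {0..l}" "\<gamma> r \<le> y \<and> y \<le> \<gamma> q \<or> \<gamma> q \<le> y \<and> y \<le> \<gamma> r" for r q y
  proof -
    have "closed_segment r q \<subseteq> {0..l}" using that by (auto simp: closed_segment_eq_real_ivl)
    then have "connected (\<gamma> ` closed_segment r q)"
      by (intro connected_continuous_image continuous_on_subset[OF cont] connected_segment)
    then have "y \<in> \<gamma> ` closed_segment r q"
      using that(3) unfolding is_interval_connected_1[symmetric] is_interval_1 by (meson ends_in_segment imageI)
    then show ?thesis by auto
  qed
  have sub: "{min s t<..<max s t} \<subseteq> {t\<in>{0..l}. c < \<gamma> t \<and> \<gamma> t < d}"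
  proof
    fix r assume r: "r \<in> {min s t<..<max s t}"
    then have r0: "r \<in> {0..l}" using s t by auto
    moreover have "c < \<gamma> r"
    proof (rule ccontr)
      assume "\<not> c < \<gamma> r"
      then obtain x where "x \<in> closed_segment r t" "\<gamma> x = c" using ivt[OF r0 t(1), of c] t cd by auto
      then show False using mn[of x t] r r0 t s
        by (auto simp: closed_segment_eq_real_ivl min_def max_def abs_if split: if_splits)
    qed
    moreover have "\<gamma> r < d"
    proof (rule ccontr)
      assume "\<not> \<gamma> r < d"
      then obtain x where "x \<in> closed_segment s r" "\<gamma> x = d" using ivt[OF s(1) r0, of d] s cd by auto
      then show False using mn[of s x] r r0 t s
        by (auto simp: closed_segment_eq_real_ivl min_def max_def abs_if split: if_splits)
    qed
    ultimately show "r \<in> {t\<in>{0..l}. c < \<gamma> t \<and> \<gamma> t < d}" by auto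
  qed
  have "d - c \<le> max s t - min s t"
    using arclength_curve_lipschitz[OF \<gamma>, of "min s t" "max s t"] s t cd by (auto simp: min_def max_def split: if_splits)
  then have "ennreal (d - c) \<le> emeasure lborel {min s t<..<max s t}"
    by (subst emeasure_lborel_Ioo) (auto intro!: ennreal_leI)
  also have "\<dots> \<le> emeasure lborel {t\<in>{0..l}. c < \<gamma> t \<and> \<gamma> t < d}"
  proof (rule emeasure_mono[OF sub])
    have "continuous_on {0..l} \<gamma>" by (rule cont)
    then have "\<gamma> \<in> borel_measurable (restrict_space borel {0..l})"
      by (intro borel_measurable_continuous_on_restrict)
    then have "\<gamma> -` {c<..<d} \<inter> {0..l} \<in> sets (restrict_space borel {0..l})"
      using measurable_sets[of \<gamma> "restrict_space borel {0..l}" borel "{c<..<d}"] by (simp add: space_restrict_space)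
    then have "\<gamma> -` {c<..<d} \<inter> {0..l} \<in> sets borel" by (auto simp: sets_restrict_space)
    also have "\<gamma> -` {c<..<d} \<inter> {0..l} = {t\<in>{0..l}. c < \<gamma> t \<and> \<gamma> t < d}" by auto
    finally show "{t\<in>{0..l}. c < \<gamma> t \<and> \<gamma> t < d} \<in> sets lborel" by simp
  qed
  finally show ?thesis .
qed

text \<open>
  The image of Lebesgue measure on \<open>[0,l]\<close> under \<open>\<gamma>\<close> dominates Lebesgue measure between the end points
  of \<open>\<gamma>\<close>, however often the curve turns back.
\<close>

lemma nn_integral_le_line_integral:
  assumes \<gamma>: "arclength_curve E \<gamma> l" and [measurable]: "g \<in> borel_measurable borel"
  shows "(\<integral>\<^sup>+x\<in>{min (\<gamma> 0) (\<gamma> l)..max (\<gamma> 0) (\<gamma> l)}. g x \<partial>lborel) \<le> line_integral g \<gamma> l"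
proof -
  define m M where "m = min (\<gamma> 0) (\<gamma> l)" and "M = max (\<gamma> 0) (\<gamma> l)"
  have l: "0 < l" and cont: "continuous_on {0..l} \<gamma>" using \<gamma> by (auto simp: arclength_curve_def)
  have img: "{m..M} \<subseteq> \<gamma> ` {0..l}"
  proof -
    have "connected (\<gamma> ` {0..l})" using cont by (rule connected_continuous_image) simp
    moreover have "m \<in> \<gamma> ` {0..l}" "M \<in> \<gamma> ` {0..l}" using l by (auto simp: m_def M_def min_def max_def)
    ultimately show ?thesis
      unfolding is_interval_connected_1[symmetric] is_interval_1 by (meson atLeastAtMost_iff subsetI)
  qed
  \<comment> \<open>extending \<open>\<gamma>\<close> by constants makes it a Borel function on the whole line\<close>
  define \<eta> where "\<eta> t = \<gamma> (max 0 (min l t))" for t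
  have "continuous_on UNIV \<eta>"
    unfolding \<eta>_def using l by (intro continuous_on_compose2[OF cont] continuous_intros) auto
  then have [measurable]: "\<eta> \<in> borel_measurable borel" by (rule borel_measurable_continuous_onI)
  define A where "A = density lborel (indicator {m..M} :: real \<Rightarrow> ennreal)"
  define B where "B = distr (density lborel (indicator {0..l} :: real \<Rightarrow> ennreal)) borel \<eta>"
  have emB: "emeasure B X = emeasure lborel ({0..l} \<inter> \<eta> -` X)" if "X \<in> sets borel" for X
  proof -
    have [measurable]: "\<eta> -` X \<in> sets borel" using measurable_sets[of \<eta> borel borel X] that by simp
    have "emeasure B X = (\<integral>\<^sup>+t. indicator {0..l} t * indicator (\<eta> -` X) t \<partial>lborel)"
      unfolding B_def using that by (simp add: emeasure_distr emeasure_density)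
    also have "\<dots> = (\<integral>\<^sup>+t. indicator ({0..l} \<inter> \<eta> -` X) t \<partial>lborel)"
      by (simp add: indicator_inter_arith)
    finally show ?thesis by simp
  qed
  have le: "emeasure A X \<le> emeasure B X" if "X \<in> sets borel" for X
  proof (rule emeasure_le_of_open_intervals)
    have "emeasure B UNIV \<le> emeasure lborel {0..l}" by (subst emB) auto
    also have "\<dots> < \<infinity>" using l by simp
    finally show "emeasure B UNIV < \<infinity>" .
    fix a b :: real assume "a < b"
    have "emeasure A {a<..<b} = emeasure lborel {max a m..min b M}"
      unfolding A_def using AE_lborel_singleton[of a] AE_lborel_singleton[of b]
      by (subst emeasure_density, simp, simp, subst nn_integral_indicator[symmetric], simp)
         (intro nn_integral_cong_AE, auto split: split_indicator elim!: eventually_elim2)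
    also have "\<dots> \<le> emeasure B {a<..<b}"
    proof (cases "max a m < min b M")
      case True
      then have "emeasure lborel {max a m..min b M} = ennreal (min b M - max a m)" by simp
      also have "\<dots> \<le> emeasure lborel {t\<in>{0..l}. max a m < \<gamma> t \<and> \<gamma> t < min b M}"
      proof (rule arclength_curve_time_in_interval[OF \<gamma> True])
        have "max a m \<in> {m..M}" "min b M \<in> {m..M}" using True by (auto simp: m_def M_def)
        then show "max a m \<in> \<gamma> ` {0..l}" "min b M \<in> \<gamma> ` {0..l}" using img by blast+
      qed
      also have "\<dots> \<le> emeasure lborel ({0..l} \<inter> \<eta> -` {a<..<b})"
      proof (rule emeasure_mono)
        have "\<eta> -` {a<..<b} \<in> sets borel" using measurable_sets[of \<eta> borel borel "{a<..<b}"] by simp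
        then show "{0..l} \<inter> \<eta> -` {a<..<b} \<in> sets lborel" by simp
      qed (auto simp: \<eta>_def)
      finally show ?thesis by (simp add: emB)
    next
      case False
      then have "emeasure lborel {max a m..min b M} = 0" by (auto simp: not_less emeasure_lborel_Icc_eq)
      then show ?thesis by simp
    qed
    finally show "emeasure A {a<..<b} \<le> emeasure B {a<..<b}" .
  qed (use that in \<open>auto simp: A_def B_def\<close>)
  have "(\<integral>\<^sup>+x\<in>{m..M}. g x \<partial>lborel) = (\<integral>\<^sup>+x. g x \<partial>A)"
    unfolding A_def by (subst nn_integral_density) (auto simp: mult.commute)
  also have "\<dots> \<le> (\<integral>\<^sup>+x. g x \<partial>B)"
    by (rule nn_integral_mono_measure) (use le in \<open>auto simp: A_def B_def\<close>)
  also have "\<dots> = (\<integral>\<^sup>+t\<in>{0..l}. g (\<eta> t) \<partial>lborel)"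
    unfolding B_def by (subst nn_integral_distr) (auto simp: nn_integral_density mult.commute)
  also have "\<dots> = line_integral g \<gamma> l"
    unfolding line_integral_def nn_integral_completion
    by (intro nn_integral_cong) (auto simp: \<eta>_def split: split_indicator)
  finally show ?thesis by (simp add: m_def M_def)
qed

section \<open>Testing the Poincare inequality\<close>

lemma enn_powr_ennreal:
  assumes "0 < x \<or> (0 \<le> x \<and> 0 < p)"
  shows "enn_powr (ennreal x) p = ennreal (x powr p)"
  using assms by (auto simp: enn_powr_def ennreal_eq_0_iff)

lemma enn_powr_less_top_iff: "0 < p \<Longrightarrow> enn_powr x p < top \<longleftrightarrow> x < top"
  by (auto simp: enn_powr_def less_top)

lemma enn_powr_mono:
  assumes "0 < p" "x \<le> y"
  shows "enn_powr x p \<le> enn_powr y p"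
proof (cases "y = \<infinity>")
  case False
  then have "x \<noteq> \<infinity>" "enn2real x \<le> enn2real y"
    using assms by (auto simp: top_unique less_top intro!: enn2real_mono)
  then show ?thesis using False assms by (auto simp: enn_powr_def intro!: ennreal_leI powr_mono2)
qed (use assms in \<open>auto simp: enn_powr_def\<close>)

lemma measurable_enn_powr [measurable (raw)]:
  assumes [measurable]: "f \<in> borel_measurable M"
  shows "(\<lambda>x. enn_powr (f x) p) \<in> borel_measurable M"
  unfolding enn_powr_def by measurable

text \<open>
  A bound for increments over segments extends to all curves, so that the exceptional family is empty
  and \<open>\<rho> = 0\<close> witnesses it.
\<close>

lemma weak_upper_gradientI:
  fixes u :: "real \<Rightarrow> real"
  assumes p: "0 < p" and M: "sets M = sets borel" "\<mu> = completion M"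
    and g[measurable]: "g \<in> borel_measurable borel"
    and le: "\<And>a b. a < b \<Longrightarrow> {a..b} \<subseteq> E \<Longrightarrow> ennreal \<bar>u b - u a\<bar> \<le> (\<integral>\<^sup>+x\<in>{a..b}. g x \<partial>lborel)"
  shows "weak_upper_gradient \<mu> p E (\<lambda>x. ereal (u x)) g"
  unfolding weak_upper_gradient_def p_almost_every_curve_def
proof (intro conjI exI allI impI)
  have "g \<in> borel_measurable M" by (simp add: M(1) cong: measurable_cong_sets)
  then show "g \<in> borel_measurable (restrict_space \<mu> E)"
    unfolding M(2) by (intro measurable_restrict_space1 measurable_completion)
  show "(\<lambda>_. 0) \<in> borel_measurable (restrict_space borel E)" by simp
  show "(\<integral>\<^sup>+x\<in>E. enn_powr 0 p \<partial>\<mu>) < \<infinity>"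
    using enn_powr_ennreal[of 0 p] p by simp
  fix \<gamma> :: "real \<Rightarrow> real" and l
  assume A: "arclength_curve E \<gamma> l \<and> \<not> ereal_gap (ereal (u (\<gamma> 0))) (ereal (u (\<gamma> l))) \<le> line_integral g \<gamma> l"
  then have \<gamma>: "arclength_curve E \<gamma> l" by simp
  then have l: "0 < l" and sub: "\<gamma> ` {0..l} \<subseteq> E" and cont: "continuous_on {0..l} \<gamma>"
    by (auto simp: arclength_curve_def)
  have "connected (\<gamma> ` {0..l})" using cont by (rule connected_continuous_image) simp
  moreover have "\<gamma> 0 \<in> \<gamma> ` {0..l}" "\<gamma> l \<in> \<gamma> ` {0..l}" using l by auto
  ultimately have img: "{min (\<gamma> 0) (\<gamma> l)..max (\<gamma> 0) (\<gamma> l)} \<subseteq> \<gamma> ` {0..l}"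
    unfolding is_interval_connected_1[symmetric] is_interval_1
    by (cases "\<gamma> 0 \<le> \<gamma> l") (auto simp: min_def max_def)
  have "ennreal \<bar>u (\<gamma> 0) - u (\<gamma> l)\<bar> \<le> (\<integral>\<^sup>+x\<in>{min (\<gamma> 0) (\<gamma> l)..max (\<gamma> 0) (\<gamma> l)}. g x \<partial>lborel)"
  proof (cases "\<gamma> 0 = \<gamma> l")
    case False
    with le[of "min (\<gamma> 0) (\<gamma> l)" "max (\<gamma> 0) (\<gamma> l)"] img sub show ?thesis
      by (cases "\<gamma> 0 < \<gamma> l") (auto simp: min_def max_def abs_minus_commute)
  qed simp
  also have "\<dots> \<le> line_integral g \<gamma> l" by (rule nn_integral_le_line_integral[OF \<gamma> g])
  finally have False using A by (simp add: ereal_gap_def)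
  then show "line_integral (\<lambda>_. 0) \<gamma> l = \<infinity>" ..
qed

lemma integrable_bounded_on_Icc:
  fixes g :: "real \<Rightarrow> real"
  assumes [measurable]: "g \<in> borel_measurable borel" and "\<And>y. 0 \<le> g y" "\<And>y. g y \<le> b"
  shows "set_integrable lborel {c..d} g"
  using assms(2,3) abs_ge_self[of b] by (intro set_integrable_bound[OF borel_integrable_atLeastAtMost'[of c d "\<lambda>_. b"]])
    (auto simp: set_borel_measurable_def intro!: AE_I2 intro: order_trans)

text \<open>
  A variant of the Muckenhoupt condition in testing form, on the middle third of a ball: it relates
  Lebesgue measure to \<open>M\<close> without presupposing that \<open>M\<close> has a density.
\<close>

definition test_inequality :: "real measure \<Rightarrow> real \<Rightarrow> real \<Rightarrow> real \<Rightarrow> real \<Rightarrow> bool" where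
  "test_inequality M p K x r \<longleftrightarrow>
     (\<forall>g b. g \<in> borel_measurable borel \<longrightarrow> (\<forall>y. 0 \<le> g y \<and> g y \<le> b) \<longrightarrow>
       ennreal ((LINT y:{x - r / 3..x + r / 3}|lborel. g y) powr p) * emeasure M (ball x r)
       \<le> ennreal ((K * r) powr p) * (\<integral>\<^sup>+y\<in>{x - r / 3..x + r / 3}. ennreal (g y powr p) \<partial>M))"

text \<open>
  Apply the Poincare inequality to the primitive \<open>u\<close> of \<open>g\<close> restricted to the middle third. It equals
  \<open>0\<close> on the left third and \<open>A = \<integral> g\<close> on the right third, and \<open>\<bar>m\<bar> + \<bar>A - m\<bar> \<ge> A\<close> for every mean
  value \<open>m\<close>. Doubling three times shows that each outer third carries a fixed fraction of \<open>M(B)\<close>.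
\<close>

lemma poincare_test_inequality:
  assumes p: "1 < p" and M: "sets M = sets borel" "\<mu> = completion M"
    and pos: "positive_finite_on_balls \<mu>" and dbl: "locally_doubling \<mu>" and poin: "local_Poincare \<mu> p"
  obtains \<delta> K where "0 < \<delta>" "0 < K"
    "\<And>x r. 0 < r \<Longrightarrow> ball x r \<subseteq> ball x0 \<delta> \<Longrightarrow> test_inequality M p K x r"
proof -
  note [measurable_cong] = M(1)
  from dbl obtain r1 D where r1: "0 < r1" "0 < D" and dblD: "\<forall>x r. 0 < r \<and> ball x r \<subseteq> ball x0 r1 \<longrightarrow>
      emeasure \<mu> (ball x (2 * r)) \<le> ennreal D * emeasure \<mu> (ball x r)"
    unfolding locally_doubling_def by blast
  from poin obtain r2 C \<Lambda> where r2: "0 < r2" "0 < C" "1 \<le> \<Lambda>" and PI': "\<forall>x r. 0 < r \<and> ball x r \<subseteq> ball x0 r2 \<longrightarrow>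
        (\<forall>u g. integrable_ereal_on \<mu> (ball x (\<Lambda> * r)) u \<and>
               weak_upper_gradient \<mu> p (ball x (\<Lambda> * r)) u g \<longrightarrow>
          (\<integral>\<^sup>+y\<in>ball x r. e2ennreal \<bar>u y - ereal (mean_value \<mu> (ball x r) u)\<bar> \<partial>\<mu>)
              / emeasure \<mu> (ball x r)
          \<le> ennreal (C * r) *
             enn_powr ((\<integral>\<^sup>+y\<in>ball x (\<Lambda> * r). enn_powr (g y) p \<partial>\<mu>)
                         / emeasure \<mu> (ball x (\<Lambda> * r))) (1 / p))"
    unfolding local_Poincare_def by blast
  \<comment> \<open>halving leaves room for the doubled balls around the centres of the outer thirds\<close>
  define \<delta> where "\<delta> = min r1 r2 / 2"
  define m where "m z s = measure M (ball z s)" for z s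
  have emM: "emeasure \<mu> A = emeasure M A" if "A \<in> sets borel" for A
    unfolding M(2) using that M(1) by simp
  have em: "emeasure M (ball z s) = ennreal (m z s)" "0 < m z s" if "0 < s" for z s
  proof -
    have "0 < emeasure \<mu> (ball z s) \<and> emeasure \<mu> (ball z s) < \<infinity>"
      using pos that unfolding positive_finite_on_balls_def by blast
    then have "0 < emeasure M (ball z s)" "emeasure M (ball z s) < \<infinity>"
      using emM[of "ball z s"] by auto
    then show e: "emeasure M (ball z s) = ennreal (m z s)"
      unfolding m_def by (intro emeasure_eq_ennreal_measure) auto
    show "0 < m z s" using \<open>0 < emeasure M (ball z s)\<close> unfolding e by simp
  qed
  have mD: "m z (2 * s) \<le> D * m z s" if "0 < s" "\<bar>z - x0\<bar> + s \<le> r1" for z s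
  proof -
    have "ball z s \<subseteq> ball x0 r1" using that by (auto simp: ball_subset_ball_iff dist_real_def)
    from dblD[rule_format, OF conjI[OF that(1) this]] show ?thesis
      using that em(1)[of s z] em(1)[of "2 * s" z] em(2)[of s z] r1
      by (simp add: emM flip: ennreal_mult)
  qed
  show thesis
  proof (rule that[of \<delta> "D ^ 3 * C"])
    show "0 < \<delta>" "0 < D ^ 3 * C" using r1 r2 by (auto simp: \<delta>_def)
    fix x r :: real
    assume r: "0 < r" and sub: "ball x r \<subseteq> ball x0 \<delta>"
    show "test_inequality M p (D ^ 3 * C) x r"
      unfolding test_inequality_def
    proof (intro allI impI)
      fix g :: "real \<Rightarrow> real" and b
      assume g[measurable]: "g \<in> borel_measurable borel" and bnd: "\<forall>y. 0 \<le> g y \<and> g y \<le> b"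
      then have g0: "\<And>y. 0 \<le> g y" and gb: "\<And>y. g y \<le> b" by auto
      have xr: "\<bar>x - x0\<bar> + r \<le> \<delta>" using sub r by (auto simp: ball_subset_ball_iff dist_real_def)
      define J where "J = {x - r / 3..x + r / 3}"
      define W where "W = ball x (\<Lambda> * r)"
      define A where "A = (LINT y:J|lborel. g y)"
      have [measurable]: "J \<in> sets borel" "W \<in> sets borel" by (auto simp: J_def W_def)
      have \<Lambda>r: "r \<le> \<Lambda> * r" using r r2 by simp
      have ab: "\<bar>r/3\<bar> < r" using r by simp
      have JB: "J \<subseteq> ball x r" using r by (auto simp: J_def dist_real_def abs_if)
      have BW: "ball x r \<subseteq> W" unfolding W_def using \<Lambda>r by (rule subset_ball)
      have JW: "J \<subseteq> W" using JB BW by (rule order_trans)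
      define h where "h y = g y * indicator J y" for y
      have [measurable]: "h \<in> borel_measurable borel" unfolding h_def by measurable
      have gi: "set_integrable lborel J g" unfolding J_def by (rule integrable_bounded_on_Icc[OF g g0 gb])
      then have hi: "integrable lborel h" by (simp add: set_integrable_def h_def[abs_def] mult.commute)
      then have hs: "set_integrable lborel S h" if "S \<in> sets borel" for S
        using that unfolding set_integrable_def by (intro integrable_mult_indicator) auto
      define u where "u y = (LINT t:{..y}|lborel. h t)" for y
      have u: "ac_derivative u h" unfolding u_def by (rule ac_derivative_of_integrable) (auto intro: hs)
      have h0: "0 \<le> h y" for y using g0 by (simp add: h_def)
      have uL: "u y = 0" if "y < x - r / 3" for y
      proof -
        have z: "(\<lambda>t. indicator {..y} t *\<^sub>R h t) = (\<lambda>t. 0)" using that by (auto simp: h_def J_def split: split_indicator)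
        show ?thesis unfolding u_def set_lebesgue_integral_def z by simp
      qed
      have uR: "u y = A" if "x + r / 3 \<le> y" for y
        unfolding u_def A_def set_lebesgue_integral_def
        using that by (intro Bochner_Integration.integral_cong) (auto simp: h_def J_def split: split_indicator)
      have A0: "0 \<le> A" unfolding A_def set_lebesgue_integral_def using g0 by (intro Bochner_Integration.integral_nonneg) auto
      have u0: "0 \<le> u y" for y unfolding u_def set_lebesgue_integral_def using h0 by (intro Bochner_Integration.integral_nonneg) auto
      have uA: "u y \<le> A" for y
      proof -
        have "0 \<le> u (max y (x + r/3)) - u y"
          using ac_derivativeD(2)[OF u, of y "max y (x + r/3)"] h0
          by (simp add: set_lebesgue_integral_def)
        then show ?thesis using uR[of "max y (x + r/3)"] by simp
      qed
      have [measurable]: "u \<in> borel_measurable borel" using u by measurable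
      have um: "(\<lambda>y. ereal (u y)) \<in> borel_measurable \<mu>"
        unfolding M(2) by (rule measurable_completion) measurable
      define \<omega> \<beta> where "\<omega> = m x (\<Lambda> * r)" and "\<beta> = m x r"
      have \<omega>: "emeasure M W = ennreal \<omega>" "0 < \<omega>" and \<beta>: "emeasure M (ball x r) = ennreal \<beta>" "0 < \<beta>"
        unfolding W_def \<omega>_def \<beta>_def using em r \<Lambda>r by auto
      have "ennreal \<beta> \<le> ennreal \<omega>"
        unfolding \<omega>(1)[symmetric] \<beta>(1)[symmetric] using BW by (intro emeasure_mono) (auto simp: M(1))
      then have "\<beta> \<le> \<omega>" using \<omega> by (simp add: ennreal_le_iff)
      have int: "integrable_ereal_on \<mu> W (\<lambda>y. ereal (u y))"
        unfolding integrable_ereal_on_def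
      proof
        show "(\<lambda>y. ereal (u y)) \<in> borel_measurable (restrict_space \<mu> W)"
          using um by (rule measurable_restrict_space1)
        have "(\<integral>\<^sup>+y\<in>W. e2ennreal \<bar>ereal (u y)\<bar> \<partial>\<mu>) \<le> (\<integral>\<^sup>+y\<in>W. ennreal A \<partial>\<mu>)"
          using u0 uA by (intro nn_integral_mono) (auto simp: ennreal_leI split: split_indicator)
        also have "\<dots> = ennreal A * ennreal \<omega>"
          unfolding M(2) nn_integral_completion using \<omega> by (simp add: nn_integral_cmult_indicator M(1))
        also have "\<dots> < \<infinity>" by (simp add: ennreal_mult_less_top)
        finally show "(\<integral>\<^sup>+y\<in>W. e2ennreal \<bar>ereal (u y)\<bar> \<partial>\<mu>) < \<infinity>" .
      qed
      have wug: "weak_upper_gradient \<mu> p W (\<lambda>y. ereal (u y)) (\<lambda>y. ennreal (h y))"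
      proof (rule weak_upper_gradientI[OF _ M])
        fix a b :: real assume "a < b"
        then show "ennreal \<bar>u b - u a\<bar> \<le> (\<integral>\<^sup>+x\<in>{a..b}. ennreal (h x) \<partial>lborel)"
          using ac_derivative_abs_le[OF u, of a b] h0 by simp
      qed (use p in auto)
      define X where "X = (\<integral>\<^sup>+y\<in>J. ennreal (g y powr p) \<partial>M)"
      have XW: "(\<integral>\<^sup>+y\<in>W. enn_powr (ennreal (h y)) p \<partial>\<mu>) = X"
        unfolding X_def M(2) nn_integral_completion using JW h0 g0 p
        by (intro nn_integral_cong) (auto simp: enn_powr_ennreal h_def split: split_indicator)
      have "X \<le> (\<integral>\<^sup>+y\<in>J. ennreal (b powr p) \<partial>M)"
        unfolding X_def using g0 gb p by (intro nn_integral_mono) (auto intro!: ennreal_leI powr_mono2 split: split_indicator)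
      also have "\<dots> = ennreal (b powr p) * emeasure M J" by (simp add: nn_integral_cmult_indicator M(1))
      also have "\<dots> \<le> ennreal (b powr p) * ennreal \<beta>"
        unfolding \<beta>(1)[symmetric] using JB by (intro mult_left_mono emeasure_mono) (auto simp: M(1))
      also have "\<dots> < \<infinity>" by (simp add: ennreal_mult_less_top)
      finally have "X < \<infinity>" .
      then obtain \<xi> where \<xi>: "X = ennreal \<xi>" "0 \<le> \<xi>" by (cases X) auto
      define mv where "mv = mean_value \<mu> (ball x r) (\<lambda>y. ereal (u y))"
      \<comment> \<open>balls of radius \<open>r/3\<close>, so that three doublings give radius \<open>8r/3\<close>, enough to cover \<open>B\<close>\<close>
      define L R where "L = ball (x - 2*r/3) (r/3)" and "R = ball (x + 2*r/3) (r/3)"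
      have [measurable]: "L \<in> sets borel" "R \<in> sets borel" by (auto simp: L_def R_def)
      have LB: "L \<subseteq> ball x r" "R \<subseteq> ball x r" and Ly: "\<And>y. y \<in> L \<Longrightarrow> y < x - r/3" and Ry: "\<And>y. y \<in> R \<Longrightarrow> x + r/3 \<le> y"
        using r by (auto simp: L_def R_def dist_real_def abs_if split: if_splits)
      have LR: "ennreal (\<beta> / D ^ 3) \<le> emeasure M (ball z (r/3))" if "\<bar>z - x\<bar> = 2*r/3" for z
      proof -
        have zx: "\<bar>z - x0\<bar> \<le> \<bar>x - x0\<bar> + 2 * r / 3" using that by linarith
        have z1: "\<bar>z - x0\<bar> + 4 * r / 3 \<le> r1" using zx xr min.cobounded1[of r1 r2] unfolding \<delta>_def by linarith
        have "\<beta> \<le> m z (8 * r / 3)"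
        proof -
          have "ball x r \<subseteq> ball z (8 * r / 3)" using that r by (auto simp: ball_subset_ball_iff dist_real_def abs_minus_commute)
          then have "emeasure M (ball x r) \<le> emeasure M (ball z (8 * r / 3))"
            by (intro emeasure_mono) (auto simp: M(1))
          then show ?thesis using r em(1)[of "8*r/3" z] em(2)[of "8*r/3" z] \<beta> by (simp add: ennreal_le_iff)
        qed
        also have "\<dots> \<le> D * m z (4 * r / 3)" using mD[of "4*r/3" z, OF _ z1] r by simp
        also have "\<dots> \<le> D * (D * m z (2 * r / 3))" using mD[of "2*r/3" z] z1 r r1 by (intro mult_left_mono) auto
        also have "\<dots> \<le> D * (D * (D * m z (r / 3)))" using mD[of "r/3" z] z1 r r1 by (intro mult_left_mono) auto
        also have "\<dots> = D ^ 3 * m z (r/3)" by (simp add: power3_eq_cube)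
        finally have "\<beta> / D ^ 3 \<le> m z (r/3)" using r1 by (simp add: divide_le_eq mult.commute)
        then show ?thesis using em(1)[of "r/3" z] r by (simp add: ennreal_leI)
      qed
      have disj: "L \<inter> R = {}" using Ly Ry r by fastforce
      have abs: "e2ennreal \<bar>ereal (u y) - ereal mv\<bar> = ennreal \<bar>u y - mv\<bar>" for y
        by simp
      have "ennreal (A * (\<beta> / D ^ 3)) \<le> ennreal ((\<bar>mv\<bar> + \<bar>A - mv\<bar>) * (\<beta> / D ^ 3))"
        using \<beta> r1 by (intro ennreal_leI mult_right_mono) auto
      also have "\<dots> = ennreal \<bar>mv\<bar> * ennreal (\<beta> / D ^ 3) + ennreal \<bar>A - mv\<bar> * ennreal (\<beta> / D ^ 3)"
        using \<beta> r1 by (subst (1 2) ennreal_mult[symmetric]) (simp_all only: distrib_right ennreal_plus[symmetric] abs_ge_zero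
          zero_le_divide_iff zero_le_power less_imp_le mult_nonneg_nonneg simp_thms)
      also have "\<dots> \<le> ennreal \<bar>mv\<bar> * emeasure M L + ennreal \<bar>A - mv\<bar> * emeasure M R"
        unfolding L_def R_def using r by (intro add_mono mult_left_mono LR) auto
      also have "\<dots> = (\<integral>\<^sup>+y. ennreal \<bar>mv\<bar> * indicator L y + ennreal \<bar>A - mv\<bar> * indicator R y \<partial>M)"
        by (subst nn_integral_add) (auto simp: nn_integral_cmult_indicator M(1))
      also have "\<dots> \<le> (\<integral>\<^sup>+y\<in>ball x r. ennreal \<bar>u y - mv\<bar> \<partial>M)"
        using LB disj uL uR Ly Ry by (intro nn_integral_mono) (auto split: split_indicator)
      also have "\<dots> = (\<integral>\<^sup>+y\<in>ball x r. e2ennreal \<bar>ereal (u y) - ereal mv\<bar> \<partial>\<mu>)"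
        unfolding abs M(2) nn_integral_completion ..
      finally have I: "ennreal (A * (\<beta> / D ^ 3)) / ennreal \<beta> \<le> (\<integral>\<^sup>+y\<in>ball x r. e2ennreal \<bar>ereal (u y) - ereal mv\<bar> \<partial>\<mu>) / emeasure \<mu> (ball x r)"
        by (simp add: emM \<beta> divide_right_mono_ennreal)
      have "ennreal (A / D ^ 3) = ennreal (A * (\<beta> / D ^ 3)) / ennreal \<beta>"
        using \<beta> r1 A0 by (subst divide_ennreal) auto
      also note I
      also have "(\<integral>\<^sup>+y\<in>ball x r. e2ennreal \<bar>ereal (u y) - ereal mv\<bar> \<partial>\<mu>) / emeasure \<mu> (ball x r)
        \<le> ennreal (C * r) * enn_powr (X / emeasure \<mu> W) (1 / p)"
      proof -
        have "ball x0 \<delta> \<subseteq> ball x0 r2" using r1 r2 by (intro subset_ball) (auto simp: \<delta>_def)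
        then show ?thesis
          using PI'[rule_format, of r x, OF conjI[OF r] conjI[OF int[unfolded W_def] wug[unfolded W_def]]] sub
          unfolding mv_def W_def[symmetric] XW by blast
      qed
      also have "X / emeasure \<mu> W = ennreal (\<xi> / \<omega>)"
        using \<omega> \<xi> by (simp add: emM divide_ennreal)
      also have "enn_powr (ennreal (\<xi> / \<omega>)) (1 / p) = ennreal ((\<xi> / \<omega>) powr (1 / p))"
        using p \<xi> \<omega> by (intro enn_powr_ennreal) auto
      also have "ennreal (C * r) * \<dots> = ennreal (C * r * (\<xi> / \<omega>) powr (1 / p))"
        using r2 r by (simp add: ennreal_mult)
      finally have "A / D ^ 3 \<le> C * r * (\<xi> / \<omega>) powr (1 / p)"
        using r2 r by (simp add: ennreal_le_iff)
      then have "A \<le> D ^ 3 * C * r * (\<xi> / \<omega>) powr (1 / p)"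
        using r1 by (simp add: field_simps)
      then have "A powr p \<le> (D ^ 3 * C * r * (\<xi> / \<omega>) powr (1 / p)) powr p"
        using A0 p by (intro powr_mono2) auto
      also have "\<dots> = (D ^ 3 * C * r) powr p * (\<xi> / \<omega>)"
        using r1 r2 r p \<xi> \<omega> by (simp add: powr_mult powr_powr)
      finally have "A powr p * \<omega> \<le> (D ^ 3 * C * r) powr p * \<xi>"
        using \<omega> by (simp add: field_simps)
      then have "A powr p * \<beta> \<le> (D ^ 3 * C * r) powr p * \<xi>"
        using \<open>\<beta> \<le> \<omega>\<close> by (meson order_trans mult_left_mono powr_ge_zero)
      then have "ennreal (A powr p * \<beta>) \<le> ennreal ((D ^ 3 * C * r) powr p * \<xi>)" by (rule ennreal_leI)
      then show "ennreal ((LINT y:{x - r / 3..x + r / 3}|lborel. g y) powr p) * emeasure M (ball x r)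
         \<le> ennreal ((D ^ 3 * C * r) powr p) * (\<integral>\<^sup>+y\<in>{x - r / 3..x + r / 3}. ennreal (g y powr p) \<partial>M)"
        unfolding J_def[symmetric] A_def[symmetric] X_def[symmetric] \<beta>(1) \<xi>(1)
        using \<beta> \<xi> by (simp add: ennreal_mult)
    qed
  qed
qed

lemma locally_finite_imp_finite_Icc:
  fixes L :: "real measure"
  assumes L: "sets L = sets borel" and loc: "\<And>x. \<exists>\<delta>>0. emeasure L (ball x \<delta>) < \<infinity>"
  shows "emeasure L {a..b} < \<infinity>"
proof -
  obtain \<delta> where \<delta>: "\<And>x. 0 < \<delta> x" "\<And>x. emeasure L (ball x (\<delta> x)) < \<infinity>" using loc by metis
  have "{a..b} \<subseteq> (\<Union>x\<in>{a..b}. ball x (\<delta> x))" using \<delta>(1) by auto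
  then obtain F where F: "F \<subseteq> {a..b}" "finite F" "{a..b} \<subseteq> (\<Union>x\<in>F. ball x (\<delta> x))"
    using compactE_image[of "{a..b}" "{a..b}" "\<lambda>x. ball x (\<delta> x)"] by auto
  have "emeasure L {a..b} \<le> emeasure L (\<Union>x\<in>F. ball x (\<delta> x))"
    using F by (intro emeasure_mono) (auto simp: L)
  also have "\<dots> \<le> (\<Sum>x\<in>F. emeasure L (ball x (\<delta> x)))"
    using F by (intro emeasure_subadditive_finite) (auto simp: L)
  also have "\<dots> < \<infinity>" using F \<delta>(2) by (simp add: less_top)
  finally show ?thesis .
qed

text \<open>
  Reduces to local finiteness: the measure \<open>\<infinity> \<sqdot> 1\<^sub>N L\<close> is finite on a set exactly when \<open>N\<close> is null
  there.
\<close>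

lemma locally_null_imp_null:
  fixes L :: "real measure"
  assumes L: "sets L = sets borel" and N: "N \<in> sets borel"
    and loc: "\<And>x. \<exists>\<delta>>0. emeasure L (N \<inter> ball x \<delta>) = 0"
  shows "emeasure L N = 0"
proof -
  note [measurable_cong] = L
  have [measurable]: "N \<in> sets L" using L N by simp
  define D where "D = density L (\<lambda>x. \<infinity> * indicator N x)"
  have D: "emeasure D A = \<infinity> * emeasure L (N \<inter> A)" if "A \<in> sets borel" for A
  proof -
    have [measurable]: "A \<in> sets L" using that L by simp
    have "emeasure D A = (\<integral>\<^sup>+x. \<infinity> * indicator (N \<inter> A) x \<partial>L)"
      unfolding D_def by (subst emeasure_density) (auto intro!: nn_integral_cong split: split_indicator)
    also have "\<dots> = \<infinity> * emeasure L (N \<inter> A)" by (subst nn_integral_cmult_indicator) auto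
    finally show ?thesis .
  qed
  have *: "emeasure D {-real n..real n} < \<infinity>" for n
  proof (rule locally_finite_imp_finite_Icc)
    fix x obtain \<delta> where "\<delta> > 0" "emeasure L (N \<inter> ball x \<delta>) = 0" using loc by blast
    then show "\<exists>\<delta>>0. emeasure D (ball x \<delta>) < \<infinity>" by (intro exI[of _ \<delta>]) (simp add: D)
  qed (simp add: D_def L)
  have 0: "emeasure L (N \<inter> {-real n..real n}) = 0" for n
    using *[of n] by (auto simp: D ennreal_mult_less_top)
  have "emeasure L N \<le> emeasure L (\<Union>n. N \<inter> {-real n..real n})"
  proof (rule emeasure_mono)
    show "N \<subseteq> (\<Union>n. N \<inter> {-real n..real n})"
    proof
      fix x assume "x \<in> N"
      obtain n :: nat where "\<bar>x\<bar> < real n" using reals_Archimedean2 by blast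
      then show "x \<in> (\<Union>n. N \<inter> {-real n..real n})" using \<open>x \<in> N\<close> by (intro UN_I[of n]) auto
    qed
  qed (use L N in auto)
  also have "\<dots> = 0" by (rule emeasure_UN_eq_0) (use 0 L N in auto)
  finally show ?thesis by simp
qed

text \<open>
  Let \<open>N\<close> be a Lebesgue null set. For the indicator of its complement the left side of the testing
  inequality is the same as for the constant \<open>1\<close>, while the right side only sees \<open>M\<close> off \<open>N\<close>. So
  \<open>M(B) \<le> C M(B - N)\<close> for all small balls, hence \<open>M(A) \<le> C M(A - N)\<close> for Borel sets \<open>A\<close> near \<open>x0\<close>;
  now take \<open>A = N\<close>.
\<close>

lemma poincare_imp_absolutely_continuous:
  assumes p: "1 < p" and M: "sets M = sets borel" "\<mu> = completion M"
    and pos: "positive_finite_on_balls \<mu>" and dbl: "locally_doubling \<mu>" and poin: "local_Poincare \<mu> p"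
    and N: "N \<in> sets borel" "emeasure lborel N = 0"
  shows "emeasure M N = 0"
proof (rule locally_null_imp_null[OF M(1) N(1)])
  fix x0
  note [measurable_cong] = M(1)
  note [measurable] = N(1)
  obtain \<delta> K where \<delta>: "0 < \<delta>" "0 < K" and test0: "\<And>x r. 0 < r \<Longrightarrow> ball x r \<subseteq> ball x0 \<delta> \<Longrightarrow> test_inequality M p K x r"
    using poincare_test_inequality[OF p M pos dbl poin] by metis
  note test = test0[unfolded test_inequality_def, rule_format]
  have ball: "emeasure M (ball x r) \<le> ennreal ((3 * K / 2) powr p) * emeasure M (ball x r - N)"
    if r: "0 < r" and sub: "ball x r \<subseteq> ball x0 \<delta>" for x r
  proof -
    define J where "J = {x - r / 3..x + r / 3}"
    have [measurable]: "J \<in> sets borel" by (simp add: J_def)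
    have "(LINT y:J|lborel. indicator (-N) y) = (LINT y:J|lborel. (1::real))"
      unfolding set_lebesgue_integral_def
    proof (rule integral_cong_AE)
      have "AE y in lborel. y \<notin> N" using N by (intro AE_not_in) (auto simp: null_sets_def)
      then show "AE y in lborel. indicator J y *\<^sub>R (indicator (-N) y :: real) = indicator J y *\<^sub>R (1::real)"
        by eventually_elim (auto split: split_indicator)
    qed measurable
    also have "\<dots> = 2 * r / 3" using r by (simp add: J_def set_lebesgue_integral_def)
    finally have A: "(LINT y:J|lborel. indicator (-N) y) = 2 * r / 3" .
    have "ennreal ((2 * r / 3) powr p) * emeasure M (ball x r)
       \<le> ennreal ((K * r) powr p) * (\<integral>\<^sup>+y\<in>J. ennreal (indicator (-N) y powr p) \<partial>M)"
      using test[OF r sub, of "indicator (-N)" 1] N(1) unfolding J_def[symmetric] A by (auto split: split_indicator)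
    also have "(\<integral>\<^sup>+y\<in>J. ennreal (indicator (-N) y powr p) \<partial>M) = (\<integral>\<^sup>+y. indicator (J - N) y \<partial>M)"
      by (intro nn_integral_cong) (auto split: split_indicator)
    also have "\<dots> \<le> emeasure M (ball x r - N)"
      using r by (subst nn_integral_indicator) (auto simp: J_def dist_real_def M(1) abs_if intro!: emeasure_mono)
    finally have *: "ennreal ((2 * r / 3) powr p) * emeasure M (ball x r) \<le> ennreal ((K * r) powr p) * emeasure M (ball x r - N)"
      by (simp add: mult_left_mono)
    have "(K * r) powr p = (2 * r / 3) powr p * (3 * K / 2) powr p"
      using r \<delta> by (subst powr_mult[symmetric]) auto
    with * have "ennreal ((2 * r / 3) powr p) * emeasure M (ball x r) \<le> ennreal ((2 * r / 3) powr p) * (ennreal ((3 * K / 2) powr p) * emeasure M (ball x r - N))"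
      by (simp add: ennreal_mult mult.assoc)
    then show ?thesis using r by (subst (asm) ennreal_mult_le_mult_iff) auto
  qed
  define B0 where "B0 = ball x0 \<delta>"
  have [measurable]: "B0 \<in> sets borel" by (simp add: B0_def)
  define M1 where "M1 = density M (indicator B0 :: real \<Rightarrow> ennreal)"
  define M2 where "M2 = density M (\<lambda>x. ennreal ((3 * K / 2) powr p) * indicator (B0 - N) x)"
  have e1: "emeasure M1 A = emeasure M (B0 \<inter> A)" if "A \<in> sets borel" for A
  proof -
    have [measurable]: "A \<in> sets M" using that M(1) by simp
    have "emeasure M1 A = (\<integral>\<^sup>+x. indicator B0 x * indicator A x \<partial>M)"
      unfolding M1_def by (rule emeasure_density) measurable
    also have "\<dots> = (\<integral>\<^sup>+x. indicator (B0 \<inter> A) x \<partial>M)" by (simp add: indicator_inter_arith)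
    also have "\<dots> = emeasure M (B0 \<inter> A)" by (rule nn_integral_indicator) measurable
    finally show ?thesis .
  qed
  have e2: "emeasure M2 A = ennreal ((3 * K / 2) powr p) * emeasure M ((B0 - N) \<inter> A)" if "A \<in> sets borel" for A
  proof -
    have [measurable]: "A \<in> sets M" using that M(1) by simp
    have "emeasure M2 A = (\<integral>\<^sup>+x. ennreal ((3 * K / 2) powr p) * indicator (B0 - N) x * indicator A x \<partial>M)"
      unfolding M2_def by (rule emeasure_density) measurable
    also have "\<dots> = (\<integral>\<^sup>+x. ennreal ((3 * K / 2) powr p) * indicator ((B0 - N) \<inter> A) x \<partial>M)"
      by (simp add: indicator_inter_arith mult.assoc)
    also have "\<dots> = ennreal ((3 * K / 2) powr p) * emeasure M ((B0 - N) \<inter> A)"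
      by (rule nn_integral_cmult_indicator) measurable
    finally show ?thesis .
  qed
  have "emeasure M1 N \<le> emeasure M2 N"
  proof (rule emeasure_le_of_open_intervals)
    have "emeasure \<mu> (ball x0 \<delta>) < \<infinity>" using pos \<delta> unfolding positive_finite_on_balls_def by blast
    then have "emeasure M B0 < \<infinity>" unfolding M(2) B0_def using M(1) by simp
    moreover have "emeasure M (B0 - N) \<le> emeasure M B0" by (intro emeasure_mono) (auto simp: M(1))
    ultimately show "emeasure M2 UNIV < \<infinity>" by (auto simp: e2 ennreal_mult_less_top)
    fix a b :: real assume "a < b"
    define c d where "c = max a (x0 - \<delta>)" and "d = min b (x0 + \<delta>)"
    have cd: "B0 \<inter> {a<..<b} = {c<..<d}" by (auto simp: B0_def c_def d_def dist_real_def)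
    show "emeasure M1 {a<..<b} \<le> emeasure M2 {a<..<b}"
    proof (cases "c < d")
      case True
      have b: "{c<..<d} = ball ((c+d)/2) ((d-c)/2)" by (rule greaterThanLessThan_eq_ball)
      have "ball ((c+d)/2) ((d-c)/2) \<subseteq> ball x0 \<delta>" using cd b unfolding B0_def by auto
      from ball[OF _ this] True
      have "emeasure M {c<..<d} \<le> ennreal ((3 * K / 2) powr p) * emeasure M ({c<..<d} - N)"
        unfolding b by simp
      moreover have "(B0 - N) \<inter> {a<..<b} = {c<..<d} - N" using cd by auto
      ultimately show ?thesis by (simp add: e1 e2 cd)
    next
      case False
      then show ?thesis by (simp add: e1 cd)
    qed
  qed (auto simp: M1_def M2_def M(1) N(1))
  also have "emeasure M2 N = 0"
  proof -
    have "(B0 - N) \<inter> N = {}" by auto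
    then show ?thesis unfolding e2[OF N(1)] by simp
  qed
  finally have "emeasure M (N \<inter> B0) = 0" using N(1) by (simp add: e1 Int_commute)
  then show "\<exists>\<delta>>0. emeasure M (N \<inter> ball x0 \<delta>) = 0" using \<delta> by (auto simp: B0_def)
qed

text \<open>
  The right side of the testing inequality vanishes for the indicator of \<open>{w = 0}\<close>.
\<close>

lemma poincare_imp_weight_pos:
  assumes p: "1 < p" and M: "sets M = sets borel" "\<mu> = completion M"
    and pos: "positive_finite_on_balls \<mu>" and dbl: "locally_doubling \<mu>" and poin: "local_Poincare \<mu> p"
    and w[measurable]: "w \<in> borel_measurable borel" and w0: "\<And>x. 0 \<le> w x" and Mw: "M = density lborel (\<lambda>x. ennreal (w x))"
  shows "AE x in lborel. 0 < w x"
proof -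
  define N where "N = {x. w x = 0}"
  have [measurable]: "N \<in> sets borel" unfolding N_def by measurable
  have "emeasure lborel N = 0"
  proof (rule locally_null_imp_null)
    fix x0
    obtain \<delta> K where \<delta>: "0 < \<delta>" "0 < K" and test0: "\<And>x r. 0 < r \<Longrightarrow> ball x r \<subseteq> ball x0 \<delta> \<Longrightarrow> test_inequality M p K x r"
    using poincare_test_inequality[OF p M pos dbl poin] by metis
  note test = test0[unfolded test_inequality_def, rule_format]
    define J where "J = {x0 - \<delta> / 3..x0 + \<delta> / 3}"
    have [measurable]: "J \<in> sets borel" by (simp add: J_def)
    have "ennreal ((LINT y:J|lborel. indicator N y) powr p) * emeasure M (ball x0 \<delta>)
         \<le> ennreal ((K * \<delta>) powr p) * (\<integral>\<^sup>+y\<in>J. ennreal (indicator N y powr p) \<partial>M)"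
      using test[OF \<delta>(1) subset_refl, of "indicator N" 1] unfolding J_def by (auto split: split_indicator)
    also have "(\<integral>\<^sup>+y\<in>J. ennreal (indicator N y powr p) \<partial>M) = 0"
      unfolding Mw by (subst nn_integral_density) (auto simp: nn_integral_0_iff_AE N_def intro!: AE_I2 split: split_indicator)
    finally have "ennreal ((LINT y:J|lborel. indicator N y) powr p) * emeasure M (ball x0 \<delta>) = 0" by simp
    moreover have "emeasure M (ball x0 \<delta>) \<noteq> 0"
    proof -
      have "0 < emeasure \<mu> (ball x0 \<delta>)" using pos \<delta> unfolding positive_finite_on_balls_def by blast
      then show ?thesis unfolding M(2) using M(1) by simp
    qed
    ultimately have "(LINT y:J|lborel. indicator N y) = (0::real)" by (auto simp: ennreal_eq_0_iff powr_def split: if_splits)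
    moreover have "(LINT y:J|lborel. indicator N y) = measure lborel (J \<inter> N)"
      unfolding set_lebesgue_integral_def by (simp add: indicator_inter_arith[symmetric])
    moreover have "emeasure lborel (J \<inter> N) < \<infinity>"
    proof -
      have "emeasure lborel (J \<inter> N) \<le> emeasure lborel J" by (intro emeasure_mono) auto
      also have "\<dots> < \<infinity>" by (auto simp: J_def emeasure_lborel_Icc_eq)
      finally show ?thesis .
    qed
    ultimately have "emeasure lborel (J \<inter> N) = 0" by (simp add: emeasure_eq_ennreal_measure)
    moreover have "emeasure lborel (N \<inter> ball x0 (\<delta>/3)) \<le> emeasure lborel (J \<inter> N)"
      by (intro emeasure_mono) (auto simp: J_def dist_real_def abs_if split: if_splits)
    ultimately show "\<exists>\<delta>>0. emeasure lborel (N \<inter> ball x0 \<delta>) = 0" using \<delta> by (intro exI[of _ "\<delta>/3"]) auto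
  qed auto
  then have "AE x in lborel. x \<notin> N" by (intro AE_not_in) (auto simp: null_sets_def)
  then show ?thesis by eventually_elim (use w0 in \<open>auto simp: N_def less_le\<close>)
qed

text \<open>
  The bounded functions \<open>g = \<sigma> 1\<^bsub>{w \<ge> 1/n}\<^esub>\<close> satisfy \<open>g\<^bsup>p\<^esup> w = g\<close>. With \<open>A = \<integral>\<^sub>J g\<close> the testing
  inequality reads \<open>A\<^bsup>p\<^esup> M(B) \<le> C A\<close>, which bounds \<open>A\<close> independently of \<open>n\<close> because \<open>p > 1\<close>.
\<close>

lemma poincare_imp_dual_weight_locally_integrable:
  assumes p: "1 < p" and M: "sets M = sets borel" "\<mu> = completion M"
    and pos: "positive_finite_on_balls \<mu>" and dbl: "locally_doubling \<mu>" and poin: "local_Poincare \<mu> p"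
    and w[measurable]: "w \<in> borel_measurable borel" and w0: "\<And>x. 0 \<le> w x" and Mw: "M = density lborel (\<lambda>x. ennreal (w x))"
  shows "(\<integral>\<^sup>+x\<in>{a..b}. ennreal (w x powr (1 / (1 - p))) \<partial>lborel) < \<infinity>"
proof -
  define s where "s x = w x powr (1 / (1 - p))" for x
  have [measurable]: "s \<in> borel_measurable borel" unfolding s_def by measurable
  have "emeasure (density lborel (\<lambda>x. ennreal (s x))) {a..b} < \<infinity>"
  proof (rule locally_finite_imp_finite_Icc)
    fix x0
    obtain \<delta> K where \<delta>: "0 < \<delta>" "0 < K" and test0: "\<And>x r. 0 < r \<Longrightarrow> ball x r \<subseteq> ball x0 \<delta> \<Longrightarrow> test_inequality M p K x r"
    using poincare_test_inequality[OF p M pos dbl poin] by metis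
  note test = test0[unfolded test_inequality_def, rule_format]
    define J where "J = {x0 - \<delta> / 3..x0 + \<delta> / 3}"
    have [measurable]: "J \<in> sets borel" by (simp add: J_def)
    have "0 < emeasure \<mu> (ball x0 \<delta>) \<and> emeasure \<mu> (ball x0 \<delta>) < \<infinity>" using pos \<delta> unfolding positive_finite_on_balls_def by blast
    then have *: "0 < emeasure M (ball x0 \<delta>)" "emeasure M (ball x0 \<delta>) < \<infinity>" unfolding M(2) using M(1) by auto
    then obtain \<beta> where \<beta>: "emeasure M (ball x0 \<delta>) = ennreal \<beta>" "0 < \<beta>"
      by (cases "emeasure M (ball x0 \<delta>)") auto
    define \<kappa> where "\<kappa> = ((K * \<delta>) powr p / \<beta>) powr (1 / (p - 1))"
    define L where "L = density lborel (\<lambda>x. ennreal (s x) * indicator J x)"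
    define E where "E n = {x. 1 / real (Suc n) \<le> w x}" for n
    have [measurable]: "E n \<in> sets borel" for n unfolding E_def by measurable
    have LE: "emeasure L (E n) \<le> ennreal \<kappa>" for n
    proof -
      define g where "g x = s x * indicator (E n) x" for x
      have [measurable]: "g \<in> borel_measurable borel" unfolding g_def by measurable
      have g0: "0 \<le> g y" for y by (simp add: g_def s_def)
      have gb: "g y \<le> (1 / real (Suc n)) powr (1 / (1 - p))" for y
        unfolding g_def s_def E_def using p by (auto intro!: powr_mono2' split: split_indicator)
      have gp: "g y powr p * w y = g y" for y
      proof (cases "y \<in> E n")
        case True
        then have "0 < w y" unfolding E_def by (auto intro: less_le_trans[of 0 "1 / real (Suc n)"])
        then have "g y powr p * w y = w y powr (p / (1 - p)) * w y powr 1" using True by (simp add: g_def s_def powr_powr)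
        also have "\<dots> = w y powr (p / (1 - p) + 1)" by (simp add: powr_add)
        also have "p / (1 - p) + 1 = 1 / (1 - p)" using p by (simp add: field_simps)
        finally show ?thesis using True by (simp add: g_def s_def)
      qed (simp add: g_def)
      define A where "A = (LINT y:J|lborel. g y)"
      have gi: "set_integrable lborel J g" unfolding J_def by (rule integrable_bounded_on_Icc) (auto intro: g0 gb)
      have A0: "0 \<le> A" unfolding A_def set_lebesgue_integral_def using g0 by (intro Bochner_Integration.integral_nonneg) auto
      have gA: "(\<integral>\<^sup>+y\<in>J. ennreal (g y) \<partial>lborel) = ennreal A"
      proof -
        have "(\<integral>\<^sup>+y. ennreal (indicator J y *\<^sub>R g y) \<partial>lborel) = ennreal A"
          unfolding A_def set_lebesgue_integral_def using gi g0 by (intro nn_integral_eq_integral) (auto simp: set_integrable_def)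
        moreover have "(\<integral>\<^sup>+y. ennreal (indicator J y *\<^sub>R g y) \<partial>lborel) = (\<integral>\<^sup>+y\<in>J. ennreal (g y) \<partial>lborel)"
          by (intro nn_integral_cong) (auto split: split_indicator)
        ultimately show ?thesis by simp
      qed
      have "(\<integral>\<^sup>+y\<in>J. ennreal (g y powr p) \<partial>M) = (\<integral>\<^sup>+y\<in>J. ennreal (g y) \<partial>lborel)"
        unfolding Mw
      proof (subst nn_integral_density)
        show "(\<integral>\<^sup>+x. ennreal (w x) * (ennreal (g x powr p) * indicator J x) \<partial>lborel) = (\<integral>\<^sup>+y\<in>J. ennreal (g y) \<partial>lborel)"
        proof (rule nn_integral_cong)
          fix y
          have "ennreal (w y) * ennreal (g y powr p) = ennreal (g y)"
            using w0[of y] gp[of y] by (subst ennreal_mult[symmetric]) (auto simp: mult.commute)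
          then show "ennreal (w y) * (ennreal (g y powr p) * indicator J y) = ennreal (g y) * indicator J y"
            by (simp add: mult.assoc[symmetric])
        qed
      qed measurable
      with test[OF \<delta>(1) subset_refl, of g] gA \<beta> g0 gb
      have "ennreal (A powr p) * ennreal \<beta> \<le> ennreal ((K * \<delta>) powr p) * ennreal A"
        unfolding J_def[symmetric] A_def[symmetric] by auto
      then have le: "A powr p * \<beta> \<le> (K * \<delta>) powr p * A"
        using \<beta> A0 by (simp add: ennreal_mult[symmetric] ennreal_le_iff)
      have "A \<le> \<kappa>"
      proof (cases "A = 0")
        case False
        then have "0 < A" using A0 by simp
        have "A powr p = A powr (p - 1) * A" using \<open>0 < A\<close> powr_add[of A "p - 1" 1] by simp
        then have "A powr (p - 1) \<le> (K * \<delta>) powr p / \<beta>"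
          using le \<open>0 < A\<close> \<beta> by (simp add: field_simps)
        then have "(A powr (p - 1)) powr (1 / (p - 1)) \<le> \<kappa>"
          unfolding \<kappa>_def using p by (intro powr_mono2) auto
        then show ?thesis using p \<open>0 < A\<close> by (simp add: powr_powr)
      qed (simp add: \<kappa>_def)
      moreover have "emeasure L (E n) = (\<integral>\<^sup>+y\<in>J. ennreal (g y) \<partial>lborel)"
        unfolding L_def g_def by (subst emeasure_density) (auto intro!: nn_integral_cong split: split_indicator)
      ultimately show ?thesis using gA by (simp add: ennreal_leI)
    qed
    have "emeasure L (\<Union>n. E n) = (SUP n. emeasure L (E n))"
    proof (rule SUP_emeasure_incseq[symmetric])
      show "incseq E" unfolding E_def incseq_def
        by (auto intro: order_trans[rotated] simp: frac_le)
    qed (auto simp: L_def)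
    also have "\<dots> \<le> ennreal \<kappa>" using LE by (intro SUP_least) auto
    finally have "emeasure L (\<Union>n. E n) < \<infinity>" by (auto intro: le_less_trans)
    moreover have "emeasure (density lborel (\<lambda>x. ennreal (s x))) (ball x0 (\<delta>/3)) \<le> emeasure L (\<Union>n. E n)"
    proof -
      have U: "x \<in> (\<Union>n. E n)" if "s x \<noteq> 0" for x
      proof -
        have "0 < w x" using that w0[of x] by (auto simp: s_def less_le)
        then obtain n where "1 / real (Suc n) < w x" using nat_approx_posE by blast
        then show ?thesis by (auto simp: E_def intro!: exI[of _ n])
      qed
      have JJ: "x \<in> J" if "x \<in> ball x0 (\<delta>/3)" for x using that by (auto simp: J_def dist_real_def abs_if split: if_splits)
      have "ennreal (s x) * indicator (ball x0 (\<delta>/3)) x \<le> ennreal (s x) * indicator J x * indicator (\<Union>n. E n) x" for x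
      proof (cases "s x = 0 \<or> x \<notin> ball x0 (\<delta>/3)")
        case False
        then have "x \<in> J" "x \<in> (\<Union>n. E n)" using U JJ by blast+
        then show ?thesis by (simp only: indicator_simps mult_1_right) (simp split: split_indicator)
      qed auto
      then show ?thesis unfolding L_def by (simp add: emeasure_density nn_integral_mono)
    qed
    ultimately show "\<exists>\<delta>>0. emeasure (density lborel (\<lambda>x. ennreal (s x))) (ball x0 \<delta>) < \<infinity>"
      using \<delta> by (intro exI[of _ "\<delta>/3"]) (auto intro: le_less_trans)
  qed simp
  then show ?thesis by (subst (asm) emeasure_density) (auto simp: s_def)
qed

text \<open>
  What is used of the hypotheses on \<open>\<mu>\<close> from here on. The weight is a Borel representative that is
  positive everywhere, so that its dual weight is a real function.
\<close>

locale weighted_line =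
  fixes \<mu> :: "real measure" and w :: "real \<Rightarrow> real" and p :: real
  assumes p: "1 < p"
    and w_measurable [measurable]: "w \<in> borel_measurable borel"
    and w_pos: "0 < w x"
    and \<mu>_eq: "\<mu> = completion (density lborel (\<lambda>x. ennreal (w x)))"
    and w_finite: "(\<integral>\<^sup>+x\<in>{a..b}. ennreal (w x) \<partial>lborel) < \<infinity>"
    and dual_finite: "(\<integral>\<^sup>+x\<in>{a..b}. ennreal (w x powr (1 / (1 - p))) \<partial>lborel) < \<infinity>"

lemma poincare_imp_weighted_line:
  assumes p: "1 < p" and compl: "complete_borel_measure \<mu>"
    and pos: "positive_finite_on_balls \<mu>" and dbl: "locally_doubling \<mu>" and poin: "local_Poincare \<mu> p"
  obtains w where "weighted_line \<mu> w p"
proof -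
  from compl obtain M where M: "sets M = sets borel" "\<mu> = completion M"
    unfolding complete_borel_measure_def by blast
  have Mfin: "emeasure M {a..b} < \<infinity>" for a b
  proof (rule locally_finite_imp_finite_Icc[OF M(1)])
    fix x
    have "emeasure \<mu> (ball x 1) < \<infinity>" using pos unfolding positive_finite_on_balls_def by (meson zero_less_one)
    then show "\<exists>\<delta>>0. emeasure M (ball x \<delta>) < \<infinity>" unfolding M(2) using M(1) by (intro exI[of _ 1]) simp
  qed
  have "absolutely_continuous lborel M"
    using poincare_imp_absolutely_continuous[OF p M pos dbl poin] M(1)
    by (auto simp: absolutely_continuous_def null_sets_def)
  then obtain h where h[measurable]: "h \<in> borel_measurable borel" and hM: "density lborel h = M"
    using sigma_finite_measure.Radon_Nikodym[OF sigma_finite_lborel, of M] M(1) by auto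
  have hi: "(\<integral>\<^sup>+x\<in>{a..b}. h x \<partial>lborel) < \<infinity>" for a b
    using Mfin[of a b] unfolding hM[symmetric] by (subst (asm) emeasure_density) auto
  have hfin: "AE x in lborel. h x \<noteq> \<infinity>"
    by (rule AE_finite_of_locally_finite_integral) (use hi in auto)
  define v where "v x = enn2real (h x)" for x
  have [measurable]: "v \<in> borel_measurable borel" unfolding v_def by measurable
  have "AE x in lborel. h x = ennreal (v x)" using hfin by eventually_elim (auto simp: v_def less_top)
  then have Mv: "M = density lborel (\<lambda>x. ennreal (v x))"
    unfolding hM[symmetric] by (intro density_cong) auto
  have v0: "0 \<le> v x" for x by (simp add: v_def)
  have vpos: "AE x in lborel. 0 < v x" by (rule poincare_imp_weight_pos[OF p M pos dbl poin _ v0 Mv]) simp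
  define w where "w x = (if v x = 0 then 1 else v x)" for x
  have [measurable]: "w \<in> borel_measurable borel" unfolding w_def by measurable
  have wv: "AE x in lborel. w x = v x" using vpos by eventually_elim (auto simp: w_def)
  have Mw: "M = density lborel (\<lambda>x. ennreal (w x))"
    unfolding Mv using wv by (intro density_cong) (auto elim!: eventually_mono)
  have wpos: "0 < w x" for x using v0[of x] by (auto simp: w_def less_le)
  have "weighted_line \<mu> w p"
  proof
    show "(\<integral>\<^sup>+x\<in>{a..b}. ennreal (w x powr (1 / (1 - p))) \<partial>lborel) < \<infinity>" for a b
      using wpos by (intro poincare_imp_dual_weight_locally_integrable[OF p M pos dbl poin _ _ Mw]) (auto intro: less_imp_le)
    show "(\<integral>\<^sup>+x\<in>{a..b}. ennreal (w x) \<partial>lborel) < \<infinity>" for a b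
      using Mfin[of a b] unfolding Mw by (subst (asm) emeasure_density) auto
  qed (use p wpos M(2) Mw in auto)
  then show thesis by (rule that)
qed

section \<open>Newtonian functions on a weighted line\<close>

context weighted_line
begin

text \<open>
  The dual weight \<open>\<sigma>\<close>. Since \<open>\<sigma>\<^bsup>p-1\<^esup> w\<close> is constant, functions with derivative \<open>c \<sigma>\<close> solve the
  \<open>p\<close>-Laplace equation.
\<close>

definition dual :: "real \<Rightarrow> real" where "dual x = w x powr (1 / (1 - p))"

abbreviation dual_mass :: "real set \<Rightarrow> ennreal" where
  "dual_mass A \<equiv> \<integral>\<^sup>+x\<in>A. ennreal (dual x) \<partial>lborel"

abbreviation energy :: "(real \<Rightarrow> real) \<Rightarrow> real set \<Rightarrow> ennreal" where
  "energy f A \<equiv> \<integral>\<^sup>+x\<in>A. ennreal (\<bar>f x\<bar> powr p * w x) \<partial>lborel"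

lemma dual_measurable [measurable]: "dual \<in> borel_measurable borel"
  unfolding dual_def by measurable

lemma dual_pos: "0 < dual x"
  using w_pos[of x] by (simp add: dual_def)

lemma dual_powr_weight: "dual x powr (p - 1) * w x = 1"
proof -
  have "1 / (1 - p) * (p - 1) = - 1" using p by (simp add: field_simps)
  then have "dual x powr (p - 1) = w x powr (-1)" by (simp only: dual_def powr_powr)
  then show ?thesis using w_pos[of x] by (simp add: powr_minus)
qed

lemma dual_energy: "dual x powr p * w x = dual x"
proof -
  have "dual x powr p = dual x powr (p - 1) * dual x"
    using dual_pos[of x] powr_add[of "dual x" "p - 1" 1] by simp
  then have "dual x powr p * w x = dual x * (dual x powr (p - 1) * w x)" by simp
  then show ?thesis by (simp add: dual_powr_weight)
qed

lemma dual_integral_finite: "dual_mass {a..b} < \<infinity>"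
  using dual_finite by (simp add: dual_def)

text \<open>
  Used with a free parameter \<open>c\<close>, this replaces Hoelder's inequality throughout. If \<open>t > c \<sigma>\<close>, then
  \<open>t\<^bsup>1-p\<^esup> \<le> (c \<sigma>)\<^bsup>1-p\<^esup> = c\<^bsup>1-p\<^esup> w\<close>.
\<close>

lemma young_dual:
  assumes "0 \<le> t" "0 < c"
  shows "t \<le> c * dual x + c powr (1 - p) * (t powr p * w x)"
proof (cases "t \<le> c * dual x")
  case True
  then show ?thesis using w_pos[of x] by (auto intro: order_trans)
next
  case False
  then have t: "c * dual x < t" by simp
  moreover have "0 < c * dual x" using assms dual_pos[of x] by simp
  ultimately have "0 < t" by linarith
  have "t = t powr p * t powr (1 - p)" using \<open>0 < t\<close> by (simp add: powr_add[symmetric])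
  also have "\<dots> \<le> t powr p * (c * dual x) powr (1 - p)"
    using t p assms dual_pos[of x] by (intro mult_left_mono powr_mono2') auto
  also have "(c * dual x) powr (1 - p) = c powr (1 - p) * w x"
  proof -
    have "dual x powr (1 - p) = w x" using p w_pos[of x] by (simp add: dual_def powr_powr)
    then show ?thesis using assms dual_pos[of x] by (simp add: powr_mult)
  qed
  finally show ?thesis using assms dual_pos[of x] by (simp add: mult_ac add_increasing)
qed

lemma young_dual_ennreal:
  assumes "0 < c"
  shows "h \<le> ennreal c * ennreal (dual x) + ennreal (c powr (1 - p)) * (enn_powr h p * ennreal (w x))"
proof (cases h)
  case (real t)
  have "ennreal t \<le> ennreal (c * dual x + c powr (1 - p) * (t powr p * w x))"
    using young_dual[OF _ assms] real by (intro ennreal_leI) auto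
  then show ?thesis
    using real p assms dual_pos[of x] w_pos[of x] by (simp add: enn_powr_ennreal ennreal_mult less_imp_le)
next
  case top
  then show ?thesis using p assms w_pos[of x] by (simp add: enn_powr_def ennreal_mult_top ennreal_top_mult ennreal_eq_0_iff)
qed

lemma \<mu>_density: "\<mu> = density lebesgue (\<lambda>x. ennreal (w x))"
  unfolding \<mu>_eq by (rule completion_density_eq) (auto simp: w_pos)

lemma sets_\<mu> [measurable_cong]: "sets \<mu> = sets lebesgue"
  unfolding \<mu>_density by simp

lemma space_\<mu> [simp]: "space \<mu> = UNIV"
  unfolding \<mu>_density by simp

lemma borel_measurable_\<mu>: "f \<in> borel_measurable \<mu> \<longleftrightarrow> f \<in> borel_measurable lebesgue"
  using measurable_cong_sets[OF sets_\<mu> refl, of borel] by auto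

lemma AE_\<mu>: "(AE x in \<mu>. P x) \<longleftrightarrow> (AE x in lborel. P x)"
  unfolding \<mu>_eq AE_completion_iff by (subst AE_density) (auto simp: w_pos)

lemma nn_integral_\<mu>:
  assumes "f \<in> borel_measurable lebesgue"
  shows "(\<integral>\<^sup>+x. f x \<partial>\<mu>) = (\<integral>\<^sup>+x. f x * ennreal (w x) \<partial>lborel)"
proof -
  have "(\<integral>\<^sup>+x. f x \<partial>\<mu>) = (\<integral>\<^sup>+x. ennreal (w x) * f x \<partial>lebesgue)"
    unfolding \<mu>_density
    by (rule nn_integral_density) (use assms in \<open>auto intro!: measurable_completion\<close>)
  then show ?thesis by (simp add: nn_integral_completion mult.commute)
qed

lemma energy_eq:
  assumes [measurable]: "f \<in> borel_measurable borel" "A \<in> sets borel"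
  shows "(\<integral>\<^sup>+x\<in>A. enn_powr (ennreal \<bar>f x\<bar>) p \<partial>\<mu>) = energy f A"
proof -
  have "(\<lambda>x. enn_powr (ennreal \<bar>f x\<bar>) p * indicator A x) \<in> borel_measurable lebesgue"
    by (rule measurable_completion) measurable
  then have "(\<integral>\<^sup>+x\<in>A. enn_powr (ennreal \<bar>f x\<bar>) p \<partial>\<mu>)
      = (\<integral>\<^sup>+x. enn_powr (ennreal \<bar>f x\<bar>) p * indicator A x * ennreal (w x) \<partial>lborel)"
    by (rule nn_integral_\<mu>)
  also have "\<dots> = energy f A"
    using p w_pos by (intro nn_integral_cong) (auto simp: enn_powr_ennreal ennreal_mult less_imp_le split: split_indicator)
  finally show ?thesis .
qed

lemma nn_integral_le_dual_plus_energy: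
  assumes [measurable]: "A \<in> sets borel" and h: "(\<lambda>x. h x * indicator A x) \<in> borel_measurable lebesgue" and c: "0 < c"
  shows "(\<integral>\<^sup>+x\<in>A. h x \<partial>lborel)
    \<le> ennreal c * dual_mass A + ennreal (c powr (1 - p)) * (\<integral>\<^sup>+x\<in>A. enn_powr (h x) p \<partial>\<mu>)"
proof -
  define k where "k x = h x * indicator A x" for x
  have [measurable]: "k \<in> borel_measurable lebesgue" unfolding k_def[abs_def] by (rule h)
  have k0: "enn_powr (k x) p = enn_powr (h x) p * indicator A x" for x
    using p by (auto simp: k_def enn_powr_def split: split_indicator)
  have [measurable]: "dual \<in> borel_measurable lebesgue" "w \<in> borel_measurable lebesgue"
    by (auto intro: measurable_completion)
  have A: "A \<in> sets lebesgue" by (simp add: sets_completionI_sets)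
  have [measurable]: "(\<lambda>x. ennreal (dual x) * indicator A x) \<in> borel_measurable lebesgue" using A by measurable
  have "(\<integral>\<^sup>+x\<in>A. h x \<partial>lborel) = (\<integral>\<^sup>+x. k x \<partial>lebesgue)" by (simp add: k_def nn_integral_completion)
  also have "\<dots> \<le> (\<integral>\<^sup>+x. ennreal c * (ennreal (dual x) * indicator A x) + ennreal (c powr (1 - p)) * (enn_powr (k x) p * ennreal (w x)) \<partial>lebesgue)"
    using young_dual_ennreal[OF c] by (intro nn_integral_mono) (auto simp: k_def split: split_indicator)
  also have "\<dots> = ennreal c * (\<integral>\<^sup>+x. ennreal (dual x) * indicator A x \<partial>lebesgue) + ennreal (c powr (1 - p)) * (\<integral>\<^sup>+x. enn_powr (k x) p * ennreal (w x) \<partial>lebesgue)"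
    by (subst nn_integral_add) (auto simp: nn_integral_cmult)
  also have "(\<integral>\<^sup>+x. enn_powr (k x) p * ennreal (w x) \<partial>lebesgue) = (\<integral>\<^sup>+x. enn_powr (k x) p \<partial>\<mu>)"
    by (subst nn_integral_\<mu>) (auto simp: nn_integral_completion)
  finally show ?thesis by (simp add: nn_integral_completion k0)
qed

text \<open>
  A function \<open>\<rho>\<close> that witnesses an exceptional family has finite \<open>p\<close>-energy and so is integrable over
  segments; thus no segment is exceptional.
\<close>

lemma weak_upper_gradient_segment:
  assumes wug: "weak_upper_gradient \<mu> p E u g" and ab: "a < b" "{a..b} \<subseteq> E"
  shows "ereal_gap (u a) (u b) \<le> (\<integral>\<^sup>+x\<in>{a..b}. g x \<partial>lborel)"
    and "(\<lambda>x. g x * indicator {a..b} x) \<in> borel_measurable lebesgue"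
proof -
  have seg: "line_integral h (\<lambda>t. a + t) (b - a) = (\<integral>\<^sup>+x\<in>{a..b}. h x \<partial>lborel)"
    if "(\<lambda>x. h x * indicator {a..b} x) \<in> borel_measurable lebesgue" for h
  proof -
    have "(\<integral>\<^sup>+x\<in>{a..b}. h x \<partial>lebesgue) = ennreal \<bar>1\<bar> * (\<integral>\<^sup>+x. h (a + 1 * x) * indicator {a..b} (a + 1 * x) \<partial>lebesgue)"
      using that by (rule nn_integral_real_affine_lebesgue) simp
    also have "\<dots> = (\<integral>\<^sup>+x. h (a + x) * indicator {0..b - a} x \<partial>lebesgue)"
      by (auto intro!: nn_integral_cong split: split_indicator)
    finally show ?thesis unfolding line_integral_def by (simp add: nn_integral_completion)
  qed
  have meas: "(\<lambda>x. h x * indicator {a..b} x) \<in> borel_measurable N"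
    if "h \<in> borel_measurable (restrict_space N E)" "space N = UNIV" "{a..b} \<in> sets N" for h :: "real \<Rightarrow> ennreal" and N
  proof -
    have "h \<in> borel_measurable (restrict_space N {a..b})"
      using that(1) ab(2) by (rule measurable_restrict_mono)
    then show ?thesis using that by (subst (asm) borel_measurable_restrict_space_iff_ennreal) auto
  qed
  have "g \<in> borel_measurable (restrict_space \<mu> E)" using wug by (simp add: weak_upper_gradient_def)
  then show gm: "(\<lambda>x. g x * indicator {a..b} x) \<in> borel_measurable lebesgue"
    using meas[of g \<mu>] by (simp add: borel_measurable_\<mu> sets_\<mu> sets_completionI_sets)
  from wug obtain \<rho> where \<rho>: "\<rho> \<in> borel_measurable (restrict_space borel E)"
    "(\<integral>\<^sup>+x\<in>E. enn_powr (\<rho> x) p \<partial>\<mu>) < \<infinity>"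
    and exc: "\<And>\<gamma> l. arclength_curve E \<gamma> l \<Longrightarrow> \<not> ereal_gap (u (\<gamma> 0)) (u (\<gamma> l)) \<le> line_integral g \<gamma> l \<Longrightarrow> line_integral \<rho> \<gamma> l = \<infinity>"
    unfolding weak_upper_gradient_def p_almost_every_curve_def by blast
  have "(\<lambda>x. \<rho> x * indicator {a..b} x) \<in> borel_measurable borel"
    by (rule meas[OF \<rho>(1)]) auto
  then have \<rho>m: "(\<lambda>x. \<rho> x * indicator {a..b} x) \<in> borel_measurable lebesgue"
    by (intro measurable_completion) simp
  have "line_integral \<rho> (\<lambda>t. a + t) (b - a) = (\<integral>\<^sup>+x\<in>{a..b}. \<rho> x \<partial>lborel)" by (rule seg[OF \<rho>m])
  also have "\<dots> \<le> ennreal 1 * dual_mass {a..b} + ennreal (1 powr (1 - p)) * (\<integral>\<^sup>+x\<in>{a..b}. enn_powr (\<rho> x) p \<partial>\<mu>)"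
    by (rule nn_integral_le_dual_plus_energy[OF _ \<rho>m]) auto
  also have "(\<integral>\<^sup>+x\<in>{a..b}. enn_powr (\<rho> x) p \<partial>\<mu>) \<le> (\<integral>\<^sup>+x\<in>E. enn_powr (\<rho> x) p \<partial>\<mu>)"
    using ab(2) by (intro nn_integral_mono) (auto split: split_indicator)
  finally have "line_integral \<rho> (\<lambda>t. a + t) (b - a) < \<infinity>"
    using dual_integral_finite[of a b] \<rho>(2) by (auto intro: le_less_trans add_left_mono)
  then have "ereal_gap (u a) (u b) \<le> line_integral g (\<lambda>t. a + t) (b - a)"
    using exc[OF arclength_curve_segment[OF ab]] by fastforce
  then show "ereal_gap (u a) (u b) \<le> (\<integral>\<^sup>+x\<in>{a..b}. g x \<partial>lborel)"
    by (simp add: seg[OF gm])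
qed

lemma weak_upper_gradient_ac:
  assumes u: "ac_derivative u f"
  shows "weak_upper_gradient \<mu> p E (\<lambda>x. ereal (u x)) (\<lambda>x. ennreal \<bar>f x\<bar>)"
proof (rule weak_upper_gradientI[OF _ _ \<mu>_eq])
  have [measurable]: "f \<in> borel_measurable borel" using u by measurable
  show "(\<lambda>x. ennreal \<bar>f x\<bar>) \<in> borel_measurable borel" by measurable
qed (use p ac_derivative_abs_le[OF u] in auto)

text \<open>
  Every competitor with locally finite \<open>p\<close>-energy is locally integrable and controls increments over segments, so it lies above
  \<open>\<bar>f\<bar>\<close>, which is itself an upper gradient. The choice made in the definition of
  \<^const>\<open>minimal_weak_upper_gradient\<close> is then determined almost everywhere.
\<close>

lemma minimal_weak_upper_gradient_ac:
  assumes u: "ac_derivative u f" and loc: "\<And>n. energy f {-real n..real n} < \<infinity>"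
  shows "AE x in lborel. minimal_weak_upper_gradient \<mu> p (\<lambda>x. ereal (u x)) x = ennreal \<bar>f x\<bar>"
proof -
  have [measurable]: "f \<in> borel_measurable borel" using u by measurable
  define g where "g x = ennreal \<bar>f x\<bar>" for x
  have [measurable]: "g \<in> borel_measurable borel" unfolding g_def by measurable
  let ?u = "\<lambda>x. ereal (u x)"
  have wg: "weak_upper_gradient \<mu> p UNIV ?u g" unfolding g_def[abs_def] by (rule weak_upper_gradient_ac[OF u])
  have Lg: "Lp_loc \<mu> p g"
    unfolding Lp_loc_def
  proof (intro conjI allI)
    show "g \<in> borel_measurable \<mu>" unfolding borel_measurable_\<mu> by (rule measurable_completion) simp
    fix x :: real
    obtain n :: nat where n: "\<bar>x\<bar> + 1 < real n" using reals_Archimedean2 by blast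
    have "(\<integral>\<^sup>+y\<in>ball x 1. enn_powr (g y) p \<partial>\<mu>) \<le> (\<integral>\<^sup>+y\<in>{-real n..real n}. enn_powr (g y) p \<partial>\<mu>)"
      using n by (intro nn_integral_mono) (auto simp: dist_real_def abs_if split: split_indicator if_splits)
    also have "\<dots> < \<infinity>" using loc[of n] by (simp add: g_def energy_eq)
    finally show "\<exists>r>0. (\<integral>\<^sup>+y\<in>ball x r. enn_powr (g y) p \<partial>\<mu>) < \<infinity>" by (intro exI[of _ 1]) simp
  qed
  have mn: "AE x in lborel. g x \<le> h x" if h: "weak_upper_gradient \<mu> p UNIV ?u h" "Lp_loc \<mu> p h" for h
    unfolding g_def
  proof (rule ac_derivative_AE_le[OF u])
    have hm[measurable]: "h \<in> borel_measurable lebesgue" using h(2) by (simp add: Lp_loc_def borel_measurable_\<mu>)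
    then show "h \<in> borel_measurable lebesgue" .
    fix a b :: real assume ab: "a < b"
    show "ennreal \<bar>u b - u a\<bar> \<le> (\<integral>\<^sup>+x\<in>{a..b}. h x \<partial>lborel)"
      using weak_upper_gradient_segment(1)[OF h(1) ab] by (simp add: ereal_gap_def abs_minus_commute)
    obtain h' where h'[measurable]: "h' \<in> borel_measurable borel" and hh: "AE x in lborel. h x = h' x"
      using completion_ex_borel_measurable[of h lborel] hm by auto
    have hi: "emeasure (density lborel h') A = (\<integral>\<^sup>+x\<in>A. h x \<partial>lborel)" if "A \<in> sets borel" for A
      using hh that by (subst emeasure_density) (auto intro!: nn_integral_cong_AE elim!: eventually_mono)
    have "emeasure (density lborel h') {a..b} < \<infinity>"
    proof (rule locally_finite_imp_finite_Icc)
      fix x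
      obtain r where r: "0 < r" "(\<integral>\<^sup>+y\<in>ball x r. enn_powr (h y) p \<partial>\<mu>) < \<infinity>" using h(2) unfolding Lp_loc_def by blast
      have bm: "(\<lambda>y. h y * indicator (ball x r) y) \<in> borel_measurable lebesgue"
        using hm by (intro borel_measurable_times_ennreal borel_measurable_indicator) (auto simp: sets_completionI_sets)
      have "(\<integral>\<^sup>+y\<in>ball x r. h y \<partial>lborel) \<le> ennreal 1 * dual_mass (ball x r) + ennreal (1 powr (1 - p)) * (\<integral>\<^sup>+y\<in>ball x r. enn_powr (h y) p \<partial>\<mu>)"
        by (rule nn_integral_le_dual_plus_energy[OF _ bm]) auto
      also have "dual_mass (ball x r) \<le> dual_mass {x-r..x+r}"
        by (intro nn_integral_mono) (auto simp: dist_real_def split: split_indicator)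
      finally have "(\<integral>\<^sup>+y\<in>ball x r. h y \<partial>lborel) < \<infinity>"
        using dual_integral_finite[of "x-r" "x+r"] r(2) by (auto intro: le_less_trans add_right_mono)
      then show "\<exists>\<delta>>0. emeasure (density lborel h') (ball x \<delta>) < \<infinity>" using r by (intro exI[of _ r]) (simp add: hi)
    qed simp
    then show "(\<integral>\<^sup>+x\<in>{a..b}. h x \<partial>lborel) < \<infinity>" by (simp add: hi)
  qed
  have gmin: "is_minimal_weak_upper_gradient \<mu> p ?u g"
    unfolding is_minimal_weak_upper_gradient_def AE_\<mu> using wg Lg mn by blast
  then have m: "is_minimal_weak_upper_gradient \<mu> p ?u (minimal_weak_upper_gradient \<mu> p ?u)"
    using someI[of "is_minimal_weak_upper_gradient \<mu> p ?u" g] by (simp add: minimal_weak_upper_gradient_def)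
  have "AE x in lborel. minimal_weak_upper_gradient \<mu> p ?u x \<le> g x" "AE x in lborel. g x \<le> minimal_weak_upper_gradient \<mu> p ?u x"
    using gmin m unfolding is_minimal_weak_upper_gradient_def AE_\<mu> by blast+
  then show ?thesis by eventually_elim (simp add: g_def)
qed

lemma N1p_ac:
  assumes E: "E \<in> sets borel" and u: "ac_derivative u f"
    and "energy u E < \<infinity>" "energy f E < \<infinity>"
  shows "(\<lambda>x. ereal (u x)) \<in> N1p \<mu> p E"
proof -
  have [measurable]: "f \<in> borel_measurable borel" using u by measurable
  have [measurable]: "u \<in> borel_measurable borel" using u by measurable
  let ?u = "\<lambda>x. ereal (u x)"
  have "?u \<in> borel_measurable \<mu>" unfolding borel_measurable_\<mu> by (rule measurable_completion) measurable
  then have um: "?u \<in> borel_measurable (restrict_space \<mu> E)" by (rule measurable_restrict_space1)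
  have "(INF g \<in> {g. weak_upper_gradient \<mu> p E ?u g}. \<integral>\<^sup>+x\<in>E. enn_powr (g x) p \<partial>\<mu>) \<le> (\<integral>\<^sup>+x\<in>E. enn_powr (ennreal \<bar>f x\<bar>) p \<partial>\<mu>)"
    by (rule INF_lower) (use weak_upper_gradient_ac[OF u] in auto)
  also have "\<dots> < \<infinity>" using assms(4) E by (simp add: energy_eq)
  finally have 1: "(INF g \<in> {g. weak_upper_gradient \<mu> p E ?u g}. \<integral>\<^sup>+x\<in>E. enn_powr (g x) p \<partial>\<mu>) < \<infinity>" .
  have "(\<integral>\<^sup>+x\<in>E. enn_powr (e2ennreal \<bar>?u x\<bar>) p \<partial>\<mu>) < \<infinity>"
    using assms(3) E by (simp add: energy_eq)
  with 1 have "N1p_norm \<mu> p E ?u < \<infinity>"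
    unfolding N1p_norm_def using p by (simp add: enn_powr_less_top_iff)
  with um show ?thesis by (simp add: N1p_def)
qed

lemma N1p_imp_gradient:
  assumes "u \<in> N1p \<mu> p E"
  obtains g where "weak_upper_gradient \<mu> p E u g" "(\<integral>\<^sup>+x\<in>E. enn_powr (g x) p \<partial>\<mu>) < \<infinity>"
    "(\<integral>\<^sup>+x\<in>E. enn_powr (e2ennreal \<bar>u x\<bar>) p \<partial>\<mu>) < \<infinity>"
proof -
  have "(\<integral>\<^sup>+x\<in>E. enn_powr (e2ennreal \<bar>u x\<bar>) p \<partial>\<mu>) +
               (INF g \<in> {g. weak_upper_gradient \<mu> p E u g}. \<integral>\<^sup>+x\<in>E. enn_powr (g x) p \<partial>\<mu>) < \<infinity>"
    using assms p unfolding N1p_def N1p_norm_def by (simp add: enn_powr_less_top_iff)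
  then have "(\<integral>\<^sup>+x\<in>E. enn_powr (e2ennreal \<bar>u x\<bar>) p \<partial>\<mu>) < \<infinity>"
    "(INF g \<in> {g. weak_upper_gradient \<mu> p E u g}. \<integral>\<^sup>+x\<in>E. enn_powr (g x) p \<partial>\<mu>) < \<infinity>" by auto
  then show thesis using that by (auto simp: INF_less_iff)
qed

text \<open>
  The sets \<open>G n\<close> exceed \<open>[-n,n]\<close> so that the restrictions of the gradients \<open>g n\<close> to a nondegenerate
  segment inside \<open>G n\<close> are measurable on the whole line, also for \<open>n = 0\<close>.
\<close>

lemma N1p_local_imp_ac:
  assumes G: "\<And>n. (\<lambda>x. ereal (u x)) \<in> N1p \<mu> p (G n)" and sub: "\<And>n. {- real n - 1..real n + 1} \<subseteq> G n"
  obtains f g where "ac_derivative u f" 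
    "\<And>n. weak_upper_gradient \<mu> p (G n) (\<lambda>x. ereal (u x)) (g n)" "\<And>n. (\<integral>\<^sup>+x\<in>G n. enn_powr (g n x) p \<partial>\<mu>) < \<infinity>"
    "\<And>n. AE x in lborel. x \<in> {-real n..real n} \<longrightarrow> ennreal \<bar>f x\<bar> \<le> g n x"
proof -
  have "\<exists>g. weak_upper_gradient \<mu> p (G n) (\<lambda>x. ereal (u x)) g \<and> (\<integral>\<^sup>+x\<in>G n. enn_powr (g x) p \<partial>\<mu>) < \<infinity>" for n
    by (rule N1p_imp_gradient[OF G[of n]]) blast
  then obtain g where g: "\<And>n. weak_upper_gradient \<mu> p (G n) (\<lambda>x. ereal (u x)) (g n)"
    "\<And>n. (\<integral>\<^sup>+x\<in>G n. enn_powr (g n x) p \<partial>\<mu>) < \<infinity>" by metis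
  have sub': "x \<in> G n" if "- real n \<le> x" "x \<le> real n" for x n
    using sub[of n] that by (auto intro!: subsetD[OF sub[of n]])
  define k where "k n x = g n x * indicator {- real n - 1..real n + 1} x" for n x
  obtain f where f: "ac_derivative u f" "\<And>n. AE x in lborel. x \<in> {-real n..real n} \<longrightarrow> ennreal \<bar>f x\<bar> \<le> k n x"
  proof (rule ex_ac_derivative[of k u])
    show km: "k n \<in> borel_measurable lebesgue" for n
      unfolding k_def[abs_def] by (rule weak_upper_gradient_segment(2)[OF g(1) _ sub]) simp
    show "(\<integral>\<^sup>+x\<in>{-real n..real n}. k n x \<partial>lborel) < \<infinity>" for n
    proof -
      have "(\<lambda>x. k n x * indicator {-real n..real n} x) \<in> borel_measurable lebesgue"
        using km[of n] by (intro borel_measurable_times_ennreal borel_measurable_indicator) auto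
      then have "(\<integral>\<^sup>+x\<in>{-real n..real n}. k n x \<partial>lborel) \<le> ennreal 1 * dual_mass {-real n..real n} + ennreal (1 powr (1 - p)) * (\<integral>\<^sup>+x\<in>{-real n..real n}. enn_powr (k n x) p \<partial>\<mu>)"
        by (intro nn_integral_le_dual_plus_energy) auto
      also have "(\<integral>\<^sup>+x\<in>{-real n..real n}. enn_powr (k n x) p \<partial>\<mu>) \<le> (\<integral>\<^sup>+x\<in>G n. enn_powr (g n x) p \<partial>\<mu>)"
        using sub' by (intro nn_integral_mono) (auto simp: k_def split: split_indicator)
      finally show ?thesis using dual_integral_finite[of "-real n" "real n"] g(2)[of n]
        by (auto intro: le_less_trans add_left_mono)
    qed
    fix n a b assume ab: "- real n \<le> a" "a < b" "b \<le> real n"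
    have "ennreal \<bar>u b - u a\<bar> \<le> (\<integral>\<^sup>+x\<in>{a..b}. g n x \<partial>lborel)"
      using weak_upper_gradient_segment(1)[OF g(1) ab(2), of n] ab sub[of n]
      by (force simp: ereal_gap_def abs_minus_commute)
    also have "\<dots> = (\<integral>\<^sup>+x\<in>{a..b}. k n x \<partial>lborel)"
      using ab by (intro nn_integral_cong) (auto simp: k_def split: split_indicator)
    finally show "ennreal \<bar>u b - u a\<bar> \<le> (\<integral>\<^sup>+x\<in>{a..b}. k n x \<partial>lborel)" .
  qed auto
  show thesis
  proof (rule that[OF f(1) g])
    show "AE x in lborel. x \<in> {-real n..real n} \<longrightarrow> ennreal \<bar>f x\<bar> \<le> g n x" for n
      using f(2)[of n] by eventually_elim (auto simp: k_def)
  qed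
qed

end

section \<open>The primitive of the dual weight is p-harmonic\<close>

text \<open>
  The tangent inequality for the convex function \<open>\<bar>_\<bar>\<^bsup>p\<^esup>\<close> at \<open>s\<close>. For \<open>y = (s + t) / s > 0\<close> it is
  Bernoulli's inequality \<open>y\<^bsup>p\<^esup> \<ge> 1 + p (y - 1)\<close>, an instance of Young's inequality.
\<close>

lemma powr_convex_tangent:
  fixes s t p :: real
  assumes p: "1 < p" and s: "0 < s"
  shows "s powr p + p * s powr (p - 1) * t \<le> \<bar>s + t\<bar> powr p"
proof -
  have sp: "s powr p = s powr (p - 1) * s" using s powr_add[of s "p - 1" 1] by simp
  show ?thesis
  proof (cases "s + t \<le> 0")
    case True
    have "s powr p + p * s powr (p - 1) * t \<le> s powr p + p * s powr (p - 1) * (- s)"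
      using True p by (intro add_left_mono mult_left_mono) auto
    also have "\<dots> = (1 - p) * s powr p" by (simp add: sp algebra_simps)
    also have "\<dots> \<le> 0" using p by (simp add: mult_nonpos_nonneg)
    finally show ?thesis using powr_ge_zero[of "\<bar>s + t\<bar>" p] by linarith
  next
    case False
    define y where "y = (s + t) / s"
    have y: "0 < y" "s + t = s * y" using False s by (auto simp: y_def)
    have "(y powr p) powr (1 / p) * 1 powr (1 - 1 / p) \<le> (1 / p) * (y powr p) + (1 - 1 / p) * 1"
      using p y by (intro Youngs_inequality_0) auto
    then have "y \<le> y powr p / p + 1 - 1 / p" using p y by (simp add: powr_powr)
    then have "p * y \<le> p * (y powr p / p + 1 - 1 / p)" using p by (intro mult_left_mono) auto
    also have "\<dots> = y powr p + p - 1" using p by (simp add: field_simps)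
    finally have "1 + p * (y - 1) \<le> y powr p" by (simp add: algebra_simps)
    then have "s powr p * (1 + p * (y - 1)) \<le> s powr p * y powr p" by (intro mult_left_mono) auto
    also have "\<dots> = \<bar>s + t\<bar> powr p" using y s by (simp add: powr_mult)
    also have "s powr p * (1 + p * (y - 1)) = s powr p + p * s powr (p - 1) * t"
      using s by (simp add: sp y_def field_simps)
    finally show ?thesis .
  qed
qed

lemma powr_add_le:
  fixes s t p :: real
  assumes p: "0 < p"
  shows "\<bar>s + t\<bar> powr p \<le> 2 powr p * (\<bar>s\<bar> powr p + \<bar>t\<bar> powr p)"
proof -
  have "\<bar>s + t\<bar> powr p \<le> (2 * max \<bar>s\<bar> \<bar>t\<bar>) powr p" using p by (intro powr_mono2) auto
  also have "\<dots> = 2 powr p * max \<bar>s\<bar> \<bar>t\<bar> powr p" by (simp add: powr_mult)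
  also have "max \<bar>s\<bar> \<bar>t\<bar> powr p \<le> \<bar>s\<bar> powr p + \<bar>t\<bar> powr p" by (auto simp: max_def)
  finally show ?thesis by simp
qed

context weighted_line
begin

lemma ex_dual_primitive: obtains \<Sigma> where "ac_derivative \<Sigma> dual"
proof (rule ex_ac_primitive[of dual])
  fix a b
  have "(\<integral>\<^sup>+x. ennreal (norm (indicator {a..b} x *\<^sub>R dual x)) \<partial>lborel) = dual_mass {a..b}"
    using dual_pos by (intro nn_integral_cong) (auto simp: less_imp_le split: split_indicator)
  then show "set_integrable lborel {a..b} dual"
    unfolding set_integrable_def using dual_integral_finite[of a b] by (intro integrableI_bounded) auto
qed auto

lemma dual_primitive_integral:
  assumes \<Sigma>: "ac_derivative \<Sigma> dual" and ab: "a \<le> b"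
  shows "dual_mass {a..b} = ennreal (\<Sigma> b - \<Sigma> a)"
proof -
  have "(\<integral>\<^sup>+x. ennreal (indicator {a..b} x *\<^sub>R dual x) \<partial>lborel) = ennreal (LINT x:{a..b}|lborel. dual x)"
    unfolding set_lebesgue_integral_def using ac_derivativeD(1)[OF \<Sigma> ab] dual_pos
    by (intro nn_integral_eq_integral) (auto simp: set_integrable_def less_imp_le)
  moreover have "(\<integral>\<^sup>+x. ennreal (indicator {a..b} x *\<^sub>R dual x) \<partial>lborel) = dual_mass {a..b}"
    by (intro nn_integral_cong) (auto split: split_indicator)
  ultimately show ?thesis using ac_derivativeD(2)[OF \<Sigma> ab] by simp
qed

lemma dual_primitive_strict_mono:
  assumes \<Sigma>: "ac_derivative \<Sigma> dual" and ab: "a < b"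
  shows "\<Sigma> a < \<Sigma> b"
proof (rule ccontr)
  assume "\<not> \<Sigma> a < \<Sigma> b"
  then have "dual_mass {a..b} = 0"
    using dual_primitive_integral[OF \<Sigma>, of a b] ab by (simp add: ennreal_neg)
  then have "AE x in lborel. ennreal (dual x) * indicator {a..b} x = 0"
    by (subst (asm) nn_integral_0_iff_AE) auto
  then have "AE x in lborel. x \<notin> {a..b}"
  proof eventually_elim
    case (elim x)
    then show ?case using dual_pos[of x] by (auto simp: ennreal_eq_0_iff split: split_indicator_asm)
  qed
  then have "(\<integral>\<^sup>+x. indicator {a..b} x \<partial>lborel) = 0"
    by (subst nn_integral_0_iff_AE) (auto split: split_indicator)
  then show False using ab by simp
qed

text \<open>
  Turns the integral condition on the weight into one-sided boundedness of the natural coordinate.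
\<close>

lemma dual_right_finite_iff:
  assumes \<Sigma>: "ac_derivative \<Sigma> dual"
  shows "dual_mass {0..} < \<infinity> \<longleftrightarrow> (\<exists>B. \<forall>x. \<Sigma> x \<le> B)"
proof
  assume fin: "dual_mass {0..} < \<infinity>"
  have "\<Sigma> x \<le> \<Sigma> 0 + enn2real (dual_mass {0..})" for x
  proof (cases "0 \<le> x")
    case True
    have "ennreal (\<Sigma> x - \<Sigma> 0) \<le> dual_mass {0..}"
      unfolding dual_primitive_integral[OF \<Sigma> True, symmetric] by (intro nn_integral_mono) (auto split: split_indicator)
    also have "\<dots> = ennreal (enn2real (dual_mass {0..}))" using fin by simp
    finally show ?thesis by (simp add: ennreal_le_iff)
  next
    case False
    then have "\<Sigma> x \<le> \<Sigma> 0" using dual_primitive_strict_mono[OF \<Sigma>, of x 0] by simp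
    then show ?thesis by (simp add: add_increasing2)
  qed
  then show "\<exists>B. \<forall>x. \<Sigma> x \<le> B" by blast
next
  assume "\<exists>B. \<forall>x. \<Sigma> x \<le> B"
  then obtain B where B: "\<And>x. \<Sigma> x \<le> B" by blast
  define L where "L = density lborel (\<lambda>x. ennreal (dual x))"
  have L: "emeasure L A = dual_mass A" if "A \<in> sets borel" for A
    unfolding L_def using that by (subst emeasure_density) auto
  have "(\<Union>n. {0..real n}) = {0..}" using real_arch_simple by auto
  moreover have "range (\<lambda>n. {0..real n}) \<subseteq> sets L" "incseq (\<lambda>n. {0..real n})"
    by (auto simp: L_def incseq_def)
  ultimately have "emeasure L {0..} = (SUP n. emeasure L {0..real n})"
    using SUP_emeasure_incseq[of "\<lambda>n. {0..real n}" L] by simp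
  also have "\<dots> \<le> ennreal (B - \<Sigma> 0)"
    using B by (intro SUP_least) (simp add: L dual_primitive_integral[OF \<Sigma>] ennreal_leI)
  finally show "dual_mass {0..} < \<infinity>" by (auto simp: L intro: le_less_trans)
qed

lemma dual_left_finite_iff:
  assumes \<Sigma>: "ac_derivative \<Sigma> dual"
  shows "dual_mass {..0} < \<infinity> \<longleftrightarrow> (\<exists>B. \<forall>x. B \<le> \<Sigma> x)"
proof
  assume fin: "dual_mass {..0} < \<infinity>"
  have "\<Sigma> 0 - enn2real (dual_mass {..0}) \<le> \<Sigma> x" for x
  proof (cases "x \<le> 0")
    case True
    have "ennreal (\<Sigma> 0 - \<Sigma> x) \<le> dual_mass {..0}"
      unfolding dual_primitive_integral[OF \<Sigma> True, symmetric] by (intro nn_integral_mono) (auto split: split_indicator)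
    also have "\<dots> = ennreal (enn2real (dual_mass {..0}))" using fin by simp
    finally show ?thesis by (simp add: ennreal_le_iff)
  next
    case False
    then have "\<Sigma> 0 \<le> \<Sigma> x" using dual_primitive_strict_mono[OF \<Sigma>, of 0 x] by simp
    moreover have "0 \<le> enn2real (dual_mass {..0})" by simp
    ultimately show ?thesis by linarith
  qed
  then show "\<exists>B. \<forall>x. B \<le> \<Sigma> x" by blast
next
  assume "\<exists>B. \<forall>x. B \<le> \<Sigma> x"
  then obtain B where B: "\<And>x. B \<le> \<Sigma> x" by blast
  define L where "L = density lborel (\<lambda>x. ennreal (dual x))"
  have L: "emeasure L A = dual_mass A" if "A \<in> sets borel" for A
    unfolding L_def using that by (subst emeasure_density) auto
  have "(\<Union>n. {- real n..0}) = {..0}"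
  proof (intro set_eqI iffI)
    fix x :: real assume "x \<in> {..0}"
    moreover obtain n where "- x \<le> real n" using real_arch_simple by blast
    ultimately show "x \<in> (\<Union>n. {- real n..0})" by (intro UN_I[of n]) auto
  qed auto
  moreover have "range (\<lambda>n. {- real n..0}) \<subseteq> sets L" "incseq (\<lambda>n. {- real n..0})"
    by (auto simp: L_def incseq_def)
  ultimately have "emeasure L {..0} = (SUP n. emeasure L {- real n..0})"
    using SUP_emeasure_incseq[of "\<lambda>n. {- real n..0}" L] by simp
  also have "\<dots> \<le> ennreal (\<Sigma> 0 - B)"
    using B by (intro SUP_least) (simp add: L dual_primitive_integral[OF \<Sigma>] ennreal_leI)
  finally show "dual_mass {..0} < \<infinity>" by (auto simp: L intro: le_less_trans)
qed

lemma energy_add_finite: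
  assumes [measurable]: "f \<in> borel_measurable borel" "g \<in> borel_measurable borel" "A \<in> sets borel"
    and "energy f A < \<infinity>" "energy g A < \<infinity>"
  shows "energy (\<lambda>x. f x + g x) A < \<infinity>"
proof -
  have "energy (\<lambda>x. f x + g x) A
      \<le> (\<integral>\<^sup>+x. ennreal (2 powr p) * (ennreal (\<bar>f x\<bar> powr p * w x) * indicator A x + ennreal (\<bar>g x\<bar> powr p * w x) * indicator A x) \<partial>lborel)"
  proof (rule nn_integral_mono)
    fix x
    have "\<bar>f x + g x\<bar> powr p * w x \<le> 2 powr p * (\<bar>f x\<bar> powr p + \<bar>g x\<bar> powr p) * w x"
      using powr_add_le[of p "f x" "g x"] p w_pos[of x] by (intro mult_right_mono) auto
    also have "\<dots> = 2 powr p * (\<bar>f x\<bar> powr p * w x + \<bar>g x\<bar> powr p * w x)" by (simp add: algebra_simps)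
    finally have "ennreal (\<bar>f x + g x\<bar> powr p * w x) \<le> ennreal (2 powr p) * (ennreal (\<bar>f x\<bar> powr p * w x) + ennreal (\<bar>g x\<bar> powr p * w x))"
      using w_pos[of x] by (simp add: ennreal_mult[symmetric] ennreal_plus[symmetric] less_imp_le del: ennreal_plus)
    then show "ennreal (\<bar>f x + g x\<bar> powr p * w x) * indicator A x \<le> ennreal (2 powr p) * (ennreal (\<bar>f x\<bar> powr p * w x) * indicator A x + ennreal (\<bar>g x\<bar> powr p * w x) * indicator A x)"
      by (auto split: split_indicator)
  qed
  also have "\<dots> = ennreal (2 powr p) * (energy f A + energy g A)"
    by (subst nn_integral_cmult, simp, subst nn_integral_add) auto
  also have "\<dots> < \<infinity>" using assms(4,5) by (simp add: ennreal_mult_less_top)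
  finally show ?thesis .
qed

lemma dual_multiple_energy: "ennreal (\<bar>c * dual x\<bar> powr p * w x) = ennreal (\<bar>c\<bar> powr p) * ennreal (dual x)"
proof -
  have "\<bar>c * dual x\<bar> powr p * w x = \<bar>c\<bar> powr p * (dual x powr p * w x)"
    using dual_pos[of x] by (simp add: abs_mult powr_mult)
  then show ?thesis using dual_pos[of x] by (simp add: dual_energy ennreal_mult less_imp_le)
qed

lemma minimal_energy:
  assumes u: "ac_derivative u f" and loc: "\<And>n. energy f {-real n..real n} < \<infinity>"
    and A: "A \<in> sets borel"
  shows "(\<integral>\<^sup>+x\<in>A. enn_powr (minimal_weak_upper_gradient \<mu> p (\<lambda>x. ereal (u x)) x) p \<partial>\<mu>) = energy f A"
proof -
  have [measurable]: "f \<in> borel_measurable borel" using u by measurable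
  have "AE x in \<mu>. minimal_weak_upper_gradient \<mu> p (\<lambda>x. ereal (u x)) x = ennreal \<bar>f x\<bar>"
    unfolding AE_\<mu> by (rule minimal_weak_upper_gradient_ac[OF u loc])
  then have "(\<integral>\<^sup>+x\<in>A. enn_powr (minimal_weak_upper_gradient \<mu> p (\<lambda>x. ereal (u x)) x) p \<partial>\<mu>) = (\<integral>\<^sup>+x\<in>A. enn_powr (ennreal \<bar>f x\<bar>) p \<partial>\<mu>)"
    by (intro nn_integral_cong_AE) auto
  then show ?thesis using A by (simp add: energy_eq)
qed

text \<open>
  Newtonian functions on the line are finite everywhere, since an infinite value would make the
  increments next to it infinite although upper gradients of finite energy are locally integrable.
\<close>

lemma N1p_UNIV_imp_ac:
  assumes \<phi>: "\<phi> \<in> N1p \<mu> p UNIV"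
  obtains v f where "\<phi> = (\<lambda>x. ereal (v x))" "ac_derivative v f"
    "(\<integral>\<^sup>+x. ennreal (\<bar>v x\<bar> powr p * w x) \<partial>lborel) < \<infinity>" "(\<integral>\<^sup>+x. ennreal (\<bar>f x\<bar> powr p * w x) \<partial>lborel) < \<infinity>"
proof -
  obtain g where g: "weak_upper_gradient \<mu> p UNIV \<phi> g" "(\<integral>\<^sup>+x. enn_powr (g x) p \<partial>\<mu>) < \<infinity>"
    and \<phi>p: "(\<integral>\<^sup>+x. enn_powr (e2ennreal \<bar>\<phi> x\<bar>) p \<partial>\<mu>) < \<infinity>"
    by (rule N1p_imp_gradient[OF \<phi>]) simp
  have gm: "g \<in> borel_measurable lebesgue"
    using g(1) measurable_cong_sets[OF sets_restrict_UNIV refl, of \<mu> "borel :: ennreal measure"]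
    by (simp add: weak_upper_gradient_def borel_measurable_\<mu>)
  have gfin: "(\<integral>\<^sup>+x\<in>{a..b}. g x \<partial>lborel) < \<infinity>" for a b
  proof -
    have gm': "(\<lambda>x. g x * indicator {a..b} x) \<in> borel_measurable lebesgue"
      using gm by (intro borel_measurable_times_ennreal borel_measurable_indicator) auto
    have "(\<integral>\<^sup>+x\<in>{a..b}. g x \<partial>lborel) \<le> ennreal 1 * dual_mass {a..b} + ennreal (1 powr (1 - p)) * (\<integral>\<^sup>+x\<in>{a..b}. enn_powr (g x) p \<partial>\<mu>)"
      by (rule nn_integral_le_dual_plus_energy[OF _ gm']) auto
    also have "(\<integral>\<^sup>+x\<in>{a..b}. enn_powr (g x) p \<partial>\<mu>) \<le> (\<integral>\<^sup>+x. enn_powr (g x) p \<partial>\<mu>)"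
      by (intro nn_integral_mono) (auto split: split_indicator)
    finally show ?thesis using dual_integral_finite[of a b] g(2)
      by (auto intro: le_less_trans add_left_mono)
  qed
  have fin: "\<bar>\<phi> x\<bar> \<noteq> \<infinity>" for x
  proof
    assume "\<bar>\<phi> x\<bar> = \<infinity>"
    then have "ereal_gap (\<phi> x) (\<phi> (x + 1)) = \<infinity>" by (simp add: ereal_gap_def)
    moreover have "ereal_gap (\<phi> x) (\<phi> (x + 1)) \<le> (\<integral>\<^sup>+t\<in>{x..x+1}. g t \<partial>lborel)"
      by (rule weak_upper_gradient_segment[OF g(1)]) auto
    ultimately show False using gfin[of x "x + 1"] by simp
  qed
  define v where "v x = real_of_ereal (\<phi> x)" for x
  have \<phi>v: "\<phi> = (\<lambda>x. ereal (v x))" using fin by (auto simp: v_def ereal_real)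
  have inc: "ennreal \<bar>v b - v a\<bar> \<le> (\<integral>\<^sup>+x\<in>{a..b}. g x \<partial>lborel)" if "a < b" for a b
    using weak_upper_gradient_segment(1)[OF g(1) that] by (simp add: \<phi>v ereal_gap_def abs_minus_commute)
  obtain f where f: "ac_derivative v f"
    by (rule ex_ac_derivative[of "\<lambda>_. g" v]) (use gm gfin inc in auto)
  have [measurable]: "f \<in> borel_measurable borel" using f by measurable
  have [measurable]: "v \<in> borel_measurable borel" using f by measurable
  have le: "AE x in lborel. ennreal \<bar>f x\<bar> \<le> g x" by (rule ac_derivative_AE_le[OF f gm inc gfin])
  have eq: "(\<integral>\<^sup>+x. ennreal (\<bar>k x\<bar> powr p * w x) \<partial>lborel) = (\<integral>\<^sup>+x. enn_powr (ennreal \<bar>k x\<bar>) p \<partial>\<mu>)"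
    if "k \<in> borel_measurable borel" for k
    using energy_eq[OF that, of UNIV] by simp
  have "(\<integral>\<^sup>+x. enn_powr (ennreal \<bar>f x\<bar>) p \<partial>\<mu>) \<le> (\<integral>\<^sup>+x. enn_powr (g x) p \<partial>\<mu>)"
    using le by (intro nn_integral_mono_AE) (use p in \<open>auto simp: AE_\<mu> enn_powr_mono elim!: eventually_mono\<close>)
  then have "(\<integral>\<^sup>+x. ennreal (\<bar>f x\<bar> powr p * w x) \<partial>lborel) < \<infinity>" using g(2) by (simp add: eq)
  moreover have "(\<integral>\<^sup>+x. ennreal (\<bar>v x\<bar> powr p * w x) \<partial>lborel) < \<infinity>"
    using \<phi>p by (simp add: eq \<phi>v)
  ultimately show thesis using that \<phi>v f by blast
qed

text \<open>
  Where \<open>\<bar>v\<bar> \<ge> e\<close> one has \<open>1 \<le> \<sigma> + w \<le> \<sigma> + e\<^bsup>-p\<^esup> \<bar>v\<bar>\<^bsup>p\<^esup> w\<close>, and the right side is integrable over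
  \<open>{v \<noteq> 0}\<close>; so this cannot happen on a set of infinite length.
\<close>

lemma N1p_small_value:
  assumes v: "v \<in> borel_measurable borel" "(\<integral>\<^sup>+x. ennreal (\<bar>v x\<bar> powr p * w x) \<partial>lborel) < \<infinity>"
    and fin: "(\<integral>\<^sup>+x\<in>{x. v x \<noteq> 0}. ennreal (dual x) \<partial>lborel) < \<infinity>"
    and S: "S \<in> sets borel" "emeasure lborel S = \<infinity>" and e: "0 < e"
  shows "\<exists>x\<in>S. \<bar>v x\<bar> < e"
proof (rule ccontr)
  assume "\<not> ?thesis"
  then have ge: "\<And>x. x \<in> S \<Longrightarrow> e \<le> \<bar>v x\<bar>" by auto
  note [measurable] = v(1) S(1)
  have "emeasure lborel S = (\<integral>\<^sup>+x. indicator S x \<partial>lborel)" by simp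
  also have "\<dots> \<le> (\<integral>\<^sup>+x. ennreal (dual x) * indicator {x. v x \<noteq> 0} x + ennreal (e powr (-p)) * ennreal (\<bar>v x\<bar> powr p * w x) \<partial>lborel)"
  proof (rule nn_integral_mono)
    fix x
    show "indicator S x \<le> ennreal (dual x) * indicator {x. v x \<noteq> 0} x + ennreal (e powr (-p)) * ennreal (\<bar>v x\<bar> powr p * w x)"
    proof (cases "x \<in> S")
      case True
      have "1 \<le> dual x + w x" using young_dual[of 1 1 x] by simp
      also have "w x \<le> e powr (-p) * (\<bar>v x\<bar> powr p * w x)"
      proof -
        have "1 = e powr (-p) * e powr p" using e by (simp add: powr_add[symmetric])
        also have "\<dots> \<le> e powr (-p) * \<bar>v x\<bar> powr p" using ge[OF True] e p by (intro mult_left_mono powr_mono2) auto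
        finally have "1 * w x \<le> e powr (-p) * \<bar>v x\<bar> powr p * w x" using w_pos[of x] by (intro mult_right_mono) auto
        then show ?thesis by (simp add: mult.assoc)
      qed
      finally have "ennreal 1 \<le> ennreal (dual x + e powr (-p) * (\<bar>v x\<bar> powr p * w x))" by (intro ennreal_leI) simp
      also have "\<dots> = ennreal (dual x) + ennreal (e powr (-p)) * ennreal (\<bar>v x\<bar> powr p * w x)"
        using dual_pos[of x] w_pos[of x] by (subst ennreal_plus) (auto simp: ennreal_mult less_imp_le)
      finally show ?thesis using True ge[OF True] e by auto
    qed simp
  qed
  also have "\<dots> = (\<integral>\<^sup>+x\<in>{x. v x \<noteq> 0}. ennreal (dual x) \<partial>lborel) + ennreal (e powr (-p)) * (\<integral>\<^sup>+x. ennreal (\<bar>v x\<bar> powr p * w x) \<partial>lborel)"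
    by (subst nn_integral_add) (auto simp: nn_integral_cmult)
  also have "\<dots> < \<infinity>" using fin v(2) by (simp add: ennreal_mult_less_top)
  finally show False using S(2) by simp
qed

text \<open>
  Since \<open>f\<close> vanishes almost everywhere on \<open>{v = 0}\<close>, its integral over \<open>{v \<noteq> 0} \<inter> [a,b]\<close> is
  \<open>v(b) - v(a)\<close>. The end points can be sent to infinity along points where \<open>v\<close> tends to \<open>0\<close>.
\<close>

lemma integral_derivative_eq_0:
  assumes v: "ac_derivative v f" and vp: "(\<integral>\<^sup>+x. ennreal (\<bar>v x\<bar> powr p * w x) \<partial>lborel) < \<infinity>"
    and fin: "(\<integral>\<^sup>+x\<in>{x. v x \<noteq> 0}. ennreal (dual x) \<partial>lborel) < \<infinity>"
    and fi: "set_integrable lborel {x. v x \<noteq> 0} f"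
  shows "(LINT x:{x. v x \<noteq> 0}|lborel. f x) = 0"
proof -
  have [measurable]: "f \<in> borel_measurable borel" using v by measurable
  have [measurable]: "v \<in> borel_measurable borel" using v by measurable
  define F where "F x = indicator {x. v x \<noteq> 0} x *\<^sub>R f x" for x
  have [measurable]: "F \<in> borel_measurable borel" unfolding F_def by measurable
  have Fi: "integrable lborel F" using fi by (simp add: set_integrable_def F_def[abs_def])
  have "\<exists>a b. a \<le> - real k \<and> real k \<le> b \<and> \<bar>v a\<bar> < 1 / real (Suc k) \<and> \<bar>v b\<bar> < 1 / real (Suc k)" for k
  proof -
    have inf: "emeasure lborel {real k..} = \<infinity>" "emeasure lborel {..- real k} = \<infinity>"
    proof -
      have "of_nat n \<le> emeasure lborel {real k..}" for n
        using emeasure_mono[of "{real k..real k + real n}" "{real k..}" lborel] by (auto simp: ennreal_of_nat_eq_real_of_nat)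
      then show "emeasure lborel {real k..} = \<infinity>" using ennreal_SUP_of_nat_eq_top by (metis SUP_least infinity_ennreal_def top.extremum_unique)
      have "of_nat n \<le> emeasure lborel {..- real k}" for n
        using emeasure_mono[of "{- real k - real n..- real k}" "{..- real k}" lborel] by (auto simp: ennreal_of_nat_eq_real_of_nat)
      then show "emeasure lborel {..- real k} = \<infinity>" using ennreal_SUP_of_nat_eq_top by (metis SUP_least infinity_ennreal_def top.extremum_unique)
    qed
    obtain a where "a \<in> {..- real k}" "\<bar>v a\<bar> < 1 / real (Suc k)"
      using N1p_small_value[OF _ vp fin _ inf(2), of "1 / real (Suc k)"] by auto
    moreover obtain b where "b \<in> {real k..}" "\<bar>v b\<bar> < 1 / real (Suc k)"
      using N1p_small_value[OF _ vp fin _ inf(1), of "1 / real (Suc k)"] by auto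
    ultimately show ?thesis by auto
  qed
  then obtain a b where ab: "\<And>k. a k \<le> - real k" "\<And>k. real k \<le> b k" "\<And>k. \<bar>v (a k)\<bar> < 1 / real (Suc k)" "\<And>k. \<bar>v (b k)\<bar> < 1 / real (Suc k)"
    by metis
  have I: "(\<integral>x. indicator {a k..b k} x *\<^sub>R F x \<partial>lborel) = v (b k) - v (a k)" for k
  proof -
    have "a k \<le> b k" using ab(1,2)[of k] by linarith
    have "(\<integral>x. indicator {a k..b k} x *\<^sub>R F x \<partial>lborel) = (LINT x:{a k..b k}|lborel. f x)"
      unfolding set_lebesgue_integral_def using ac_derivative_zero_on_zeros[OF v]
      by (intro integral_cong_AE) (auto simp: F_def split: split_indicator elim!: eventually_mono)
    then show ?thesis using ac_derivativeD(2)[OF v \<open>a k \<le> b k\<close>] by simp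
  qed
  have "(\<lambda>k. \<integral>x. indicator {a k..b k} x *\<^sub>R F x \<partial>lborel) \<longlonglongrightarrow> (\<integral>x. F x \<partial>lborel)"
  proof (rule integral_dominated_convergence[where w="\<lambda>x. norm (F x)"])
    show "AE x in lborel. (\<lambda>k. indicator {a k..b k} x *\<^sub>R F x) \<longlonglongrightarrow> F x"
    proof (rule AE_I2)
      fix x :: real
      obtain n :: nat where n: "\<bar>x\<bar> < real n" using reals_Archimedean2 by blast
      have "\<forall>\<^sub>F k in sequentially. indicator {a k..b k} x *\<^sub>R F x = F x"
        using eventually_ge_at_top[of n]
      proof eventually_elim
        case (elim k)
        then have "real n \<le> real k" by simp
        then have "x \<in> {a k..b k}" using n ab(1,2)[of k] unfolding atLeastAtMost_iff by linarith
        then show ?case by simp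
      qed
      then show "(\<lambda>k. indicator {a k..b k} x *\<^sub>R F x) \<longlonglongrightarrow> F x" by (rule tendsto_eventually)
    qed
  qed (use Fi in \<open>auto split: split_indicator\<close>)
  moreover have "(\<lambda>k. v (b k) - v (a k)) \<longlonglongrightarrow> 0 - 0"
  proof (rule tendsto_diff)
    have z: "(\<lambda>k. 1 / real (Suc k)) \<longlonglongrightarrow> 0" using LIMSEQ_inverse_real_of_nat by (simp add: inverse_eq_divide)
    show "(\<lambda>k. v (b k)) \<longlonglongrightarrow> 0" by (rule Lim_null_comparison[OF always_eventually z]) (use ab(4) in \<open>auto intro: less_imp_le\<close>)
    show "(\<lambda>k. v (a k)) \<longlonglongrightarrow> 0" by (rule Lim_null_comparison[OF always_eventually z]) (use ab(3) in \<open>auto intro: less_imp_le\<close>)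
  qed
  ultimately have "(\<integral>x. F x \<partial>lborel) = 0" unfolding I using LIMSEQ_unique by fastforce
  then show ?thesis by (simp add: set_lebesgue_integral_def F_def)
qed

text \<open>
  Integrate the tangent inequality \<open>\<bar>c \<sigma> + f\<bar>\<^bsup>p\<^esup> w \<ge> \<sigma> + p c f\<close>, whose linear term has integral zero. The
  integrals make sense as soon as the perturbed energy is finite: then the energy of \<open>\<sigma>\<close> over
  \<open>{v \<noteq> 0}\<close> is finite too, because that of \<open>f\<close> is.
\<close>

lemma dual_energy_minimal:
  assumes c: "\<bar>c\<bar> = 1" and v: "ac_derivative v f"
    and vp: "(\<integral>\<^sup>+x. ennreal (\<bar>v x\<bar> powr p * w x) \<partial>lborel) < \<infinity>" and fp: "(\<integral>\<^sup>+x. ennreal (\<bar>f x\<bar> powr p * w x) \<partial>lborel) < \<infinity>"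
  shows "(\<integral>\<^sup>+x\<in>{x. v x \<noteq> 0}. ennreal (dual x) \<partial>lborel) \<le> (\<integral>\<^sup>+x\<in>{x. v x \<noteq> 0}. ennreal (\<bar>c * dual x + f x\<bar> powr p * w x) \<partial>lborel)"
proof -
  have [measurable]: "f \<in> borel_measurable borel" using v by measurable
  have [measurable]: "v \<in> borel_measurable borel" using v by measurable
  define A where "A = {x. v x \<noteq> 0}"
  have [measurable]: "A \<in> sets borel" unfolding A_def by measurable
  have fpA: "energy f A < \<infinity>"
    by (rule le_less_trans[OF _ fp]) (auto intro!: nn_integral_mono split: split_indicator)
  show ?thesis
  proof (cases "energy (\<lambda>x. c * dual x + f x) A < \<infinity>")
    case False
    then show ?thesis by (simp add: A_def not_less top_unique)
  next
    case True
    have "energy (\<lambda>x. (c * dual x + f x) + (- 1) * f x) A < \<infinity>"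
      using energy_add_finite[of "\<lambda>x. c * dual x + f x" "\<lambda>x. - 1 * f x" A] True fpA by simp
    then have finA: "dual_mass A < \<infinity>"
      using c by (simp add: dual_multiple_energy)
    have nnint: "set_integrable lborel A h" "(\<integral>\<^sup>+x\<in>A. ennreal (h x) \<partial>lborel) = ennreal (LINT x:A|lborel. h x)"
      if [measurable]: "h \<in> borel_measurable borel" and h0: "\<And>x. 0 \<le> h x" and hf: "(\<integral>\<^sup>+x\<in>A. ennreal (h x) \<partial>lborel) < \<infinity>" for h
    proof -
      have eq: "(\<integral>\<^sup>+x. ennreal (indicator A x *\<^sub>R h x) \<partial>lborel) = (\<integral>\<^sup>+x\<in>A. ennreal (h x) \<partial>lborel)"
        by (intro nn_integral_cong) (auto split: split_indicator)
      show 1: "set_integrable lborel A h" unfolding set_integrable_def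
        using h0 hf eq by (intro integrableI_nonneg) auto
      show "(\<integral>\<^sup>+x\<in>A. ennreal (h x) \<partial>lborel) = ennreal (LINT x:A|lborel. h x)"
        unfolding eq[symmetric] set_lebesgue_integral_def using 1 h0
        by (intro nn_integral_eq_integral) (auto simp: set_integrable_def)
    qed
    have w0: "0 \<le> w x" "0 \<le> dual x" for x using w_pos[of x] dual_pos[of x] by (auto intro: less_imp_le)
    note d = nnint[OF dual_measurable w0(2) finA]
    have "(\<lambda>x. \<bar>c * dual x + f x\<bar> powr p * w x) \<in> borel_measurable borel" by measurable
    note e = nnint[OF this _ True]
    have "set_integrable lborel A (\<lambda>x. dual x + \<bar>f x\<bar> powr p * w x)"
      by (intro set_integral_add d nnint fpA) (auto simp: w0)
    then have fi: "set_integrable lborel A f"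
    proof (rule set_integrable_bound)
      show "AE x in lborel. x \<in> A \<longrightarrow> norm (f x) \<le> norm (dual x + \<bar>f x\<bar> powr p * w x)"
      proof (intro AE_I2 impI)
        fix x
        show "norm (f x) \<le> norm (dual x + \<bar>f x\<bar> powr p * w x)"
          using young_dual[of "\<bar>f x\<bar>" 1 x] w0[of x] by simp
      qed
    qed (auto simp: set_borel_measurable_def)
    have f0: "(LINT x:A|lborel. f x) = 0"
      unfolding A_def by (rule integral_derivative_eq_0[OF v vp]) (use finA fi in \<open>auto simp: A_def\<close>)
    have pw: "dual x + p * c * f x \<le> \<bar>c * dual x + f x\<bar> powr p * w x" for x
    proof -
      have cc: "c * c = 1" using c by (metis abs_mult_self_eq mult_1)
      have "\<bar>c * dual x + f x\<bar> = \<bar>c\<bar> * \<bar>dual x + c * f x\<bar>"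
        unfolding abs_mult[symmetric] using cc by (simp add: distrib_left mult.assoc[symmetric])
      then have "\<bar>c * dual x + f x\<bar> = \<bar>dual x + c * f x\<bar>" using c by simp
      moreover have "(dual x powr p + p * dual x powr (p - 1) * (c * f x)) * w x \<le> \<bar>dual x + c * f x\<bar> powr p * w x"
        using powr_convex_tangent[OF p dual_pos] w0 by (intro mult_right_mono) auto
      moreover have "(dual x powr p + p * dual x powr (p - 1) * (c * f x)) * w x = dual x powr p * w x + p * c * f x * (dual x powr (p - 1) * w x)"
        by (simp add: algebra_simps)
      ultimately show ?thesis by (simp add: dual_energy dual_powr_weight)
    qed
    have "(LINT x:A|lborel. dual x) = (LINT x:A|lborel. dual x + p * c * f x)"
      using d(1) fi f0 by (subst set_integral_add) (auto intro: set_integrable_mult_right)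
    also have "\<dots> \<le> (LINT x:A|lborel. \<bar>c * dual x + f x\<bar> powr p * w x)"
      using d(1) fi e(1) w0 pw by (intro set_integral_mono set_integral_add set_integrable_mult_right) auto
    finally show ?thesis
      unfolding A_def[symmetric] d(2) using e(2) w0 by (simp add: ennreal_leI)
  qed
qed

lemma energy_continuous_finite:
  assumes u: "continuous_on UNIV u"
  shows "energy u {a..b} < \<infinity>"
proof -
  have "continuous_on {a..b} u" using u by (rule continuous_on_subset) auto
  then have "bounded (u ` {a..b})" by (intro compact_imp_bounded compact_continuous_image) auto
  then obtain B where "\<forall>y\<in>u ` {a..b}. norm y \<le> B" unfolding bounded_iff by blast
  then have B: "\<And>x. x \<in> {a..b} \<Longrightarrow> \<bar>u x\<bar> \<le> B" by auto
  have "energy u {a..b} \<le> (\<integral>\<^sup>+x. ennreal (B powr p) * (ennreal (w x) * indicator {a..b} x) \<partial>lborel)"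
  proof (rule nn_integral_mono)
    fix x
    show "ennreal (\<bar>u x\<bar> powr p * w x) * indicator {a..b} x \<le> ennreal (B powr p) * (ennreal (w x) * indicator {a..b} x)"
    proof (cases "x \<in> {a..b}")
      case True
      have "\<bar>u x\<bar> powr p * w x \<le> B powr p * w x"
        using B[OF True] p w_pos[of x] by (intro mult_right_mono powr_mono2) auto
      then show ?thesis using True w_pos[of x] by (simp add: ennreal_mult[symmetric] ennreal_leI less_imp_le)
    qed simp
  qed
  also have "\<dots> = ennreal (B powr p) * (\<integral>\<^sup>+x\<in>{a..b}. ennreal (w x) \<partial>lborel)"
    by (rule nn_integral_cmult) measurable
  also have "\<dots> < \<infinity>" using w_finite by (simp add: ennreal_mult_less_top)
  finally show ?thesis .
qed

lemma N1p_ac_bounded: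
  assumes u: "ac_derivative u f" and loc: "\<And>n. energy f {-real n..real n} < \<infinity>"
    and G: "G \<in> sets borel" "bounded G"
  shows "(\<lambda>x. ereal (u x)) \<in> N1p \<mu> p G"
proof (rule N1p_ac[OF G(1) u])
  obtain B where "\<And>x. x \<in> G \<Longrightarrow> \<bar>x\<bar> \<le> B" using G(2) unfolding bounded_iff by auto
  moreover obtain n where "B \<le> real n" using real_arch_simple by blast
  ultimately have n: "G \<subseteq> {- real n..real n}" by (force simp: abs_le_iff)
  have mono: "energy h G \<le> energy h {-real n..real n}" for h
    using n by (intro nn_integral_mono) (auto split: split_indicator)
  show "energy u G < \<infinity>"
    using mono energy_continuous_finite[OF ac_derivative_imp_continuous[OF u]] by (rule le_less_trans)
  show "energy f G < \<infinity>"
    using mono loc[of n] by (rule le_less_trans)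
qed

text \<open>
  Minimal upper gradients are absolute values of derivatives, so quasiminimality with \<open>Q = 1\<close> is the
  minimality of the energy of \<open>\<sigma>\<close> under perturbations by Newtonian functions.
\<close>

lemma p_harmonic_dual_primitive:
  assumes c: "\<bar>c\<bar> = 1" and u: "ac_derivative u (\<lambda>x. c * dual x)"
  shows "p_harmonic \<mu> p u"
proof -
  have loc: "energy (\<lambda>x. c * dual x) {-real n..real n} < \<infinity>" for n
    using dual_integral_finite c by (simp add: dual_multiple_energy)
  have "quasiminimizer_with \<mu> p 1 (\<lambda>x. ereal (u x))"
    unfolding quasiminimizer_with_def
  proof (intro conjI allI ballI impI)
    fix G :: "real set" assume "open G \<and> bounded G"
    then show "(\<lambda>x. ereal (u x)) \<in> N1p \<mu> p G" by (intro N1p_ac_bounded[OF u loc]) auto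
  next
    fix \<phi> assume "\<phi> \<in> N1p_test_functions \<mu> p"
    then have "\<phi> \<in> N1p \<mu> p UNIV" by (simp add: N1p_test_functions_def)
    then obtain v f where \<phi>: "\<phi> = (\<lambda>x. ereal (v x))" and v: "ac_derivative v f"
      and vp: "(\<integral>\<^sup>+x. ennreal (\<bar>v x\<bar> powr p * w x) \<partial>lborel) < \<infinity>" and fp: "(\<integral>\<^sup>+x. ennreal (\<bar>f x\<bar> powr p * w x) \<partial>lborel) < \<infinity>"
      by (rule N1p_UNIV_imp_ac)
    have [measurable]: "f \<in> borel_measurable borel" using v by measurable
    have [measurable]: "v \<in> borel_measurable borel" using v by measurable
    have A: "{x. \<phi> x \<noteq> 0} = {x. v x \<noteq> 0}" and Ab: "{x. v x \<noteq> 0} \<in> sets borel" by (auto simp: \<phi> zero_ereal_def)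
    have "energy f {-real n..real n} < \<infinity>" for n
      by (rule le_less_trans[OF _ fp]) (auto intro!: nn_integral_mono split: split_indicator)
    then have loc2: "energy (\<lambda>x. c * dual x + f x) {-real n..real n} < \<infinity>" for n
      using loc by (intro energy_add_finite) auto
    have "(\<lambda>y. ereal (u y) + \<phi> y) = (\<lambda>y. ereal (u y + v y))" by (simp add: \<phi>)
    then show "(\<integral>\<^sup>+x\<in>{x. \<phi> x \<noteq> 0}. enn_powr (minimal_weak_upper_gradient \<mu> p (\<lambda>x. ereal (u x)) x) p \<partial>\<mu>)
        \<le> ennreal 1 * (\<integral>\<^sup>+x\<in>{x. \<phi> x \<noteq> 0}. enn_powr (minimal_weak_upper_gradient \<mu> p (\<lambda>y. ereal (u y) + \<phi> y) x) p \<partial>\<mu>)"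
      unfolding A using dual_energy_minimal[OF c v vp fp] c
      by (simp add: minimal_energy[OF u loc Ab] minimal_energy[OF ac_derivative_add[OF u v] loc2 Ab] dual_multiple_energy)
  qed
  then show ?thesis using ac_derivative_imp_continuous[OF u] by (simp add: p_harmonic_def)
qed

lemma ex_positive_p_harmonic:
  assumes "min (dual_mass {..0}) (dual_mass {0..}) < \<infinity>"
  shows "\<exists>u. p_harmonic \<mu> p u \<and> (\<forall>x. 0 < u x) \<and> \<not> u constant_on UNIV"
proof -
  obtain \<Sigma> where \<Sigma>: "ac_derivative \<Sigma> dual" by (rule ex_dual_primitive)
  have sm: "\<Sigma> 0 < \<Sigma> 1" by (rule dual_primitive_strict_mono[OF \<Sigma>]) simp
  consider B where "\<And>x. B \<le> \<Sigma> x" | B where "\<And>x. \<Sigma> x \<le> B"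
    using assms dual_left_finite_iff[OF \<Sigma>] dual_right_finite_iff[OF \<Sigma>] by (auto simp: min_less_iff_disj)
  then show ?thesis
  proof cases
    case 1
    have "ac_derivative (\<lambda>x. 1 * \<Sigma> x + (1 - B)) (\<lambda>x. 1 * dual x)"
      by (intro ac_derivative_add_const ac_derivative_cmult \<Sigma>)
    then have "p_harmonic \<mu> p (\<lambda>x. 1 * \<Sigma> x + (1 - B))" by (intro p_harmonic_dual_primitive[of 1]) auto
    moreover have "0 < 1 * \<Sigma> x + (1 - B)" for x using 1[of x] by linarith
    moreover have "\<not> (\<lambda>x. 1 * \<Sigma> x + (1 - B)) constant_on UNIV"
    proof
      assume "(\<lambda>x. 1 * \<Sigma> x + (1 - B)) constant_on UNIV"
      then obtain y where "\<And>x. 1 * \<Sigma> x + (1 - B) = y" unfolding constant_on_def by auto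
      from this[of 0] this[of 1] sm show False by simp
    qed
    ultimately show ?thesis by blast
  next
    case 2
    have "ac_derivative (\<lambda>x. - 1 * \<Sigma> x + (B + 1)) (\<lambda>x. - 1 * dual x)"
      by (intro ac_derivative_add_const ac_derivative_cmult \<Sigma>)
    then have "p_harmonic \<mu> p (\<lambda>x. - 1 * \<Sigma> x + (B + 1))" by (intro p_harmonic_dual_primitive[of "-1"]) auto
    moreover have "0 < - 1 * \<Sigma> x + (B + 1)" for x using 2[of x] by linarith
    moreover have "\<not> (\<lambda>x. - 1 * \<Sigma> x + (B + 1)) constant_on UNIV"
    proof
      assume "(\<lambda>x. - 1 * \<Sigma> x + (B + 1)) constant_on UNIV"
      then obtain y where "\<And>x. - 1 * \<Sigma> x + (B + 1) = y" unfolding constant_on_def by auto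
      from this[of 0] this[of 1] sm show False by simp
    qed
    ultimately show ?thesis by blast
  qed
qed

end

section \<open>Quasiharmonic functions and the dual weight\<close>

context weighted_line
begin

lemma N1p_norm_zero: "N1p_norm \<mu> p UNIV (\<lambda>x. 0) = 0"
proof -
  have z: "enn_powr 0 p = 0" "enn_powr 0 (1 / p) = 0"
    using enn_powr_ennreal[of 0 p] enn_powr_ennreal[of 0 "1 / p"] p by auto
  have "ac_derivative (\<lambda>x. 0) (\<lambda>x. 0)" by (simp add: ac_derivative_def set_integrable_def set_lebesgue_integral_def)
  from weak_upper_gradient_ac[OF this, of UNIV]
  have "weak_upper_gradient \<mu> p UNIV (\<lambda>x. 0) (\<lambda>x. 0)" by (simp add: zero_ereal_def)
  then have "(INF g \<in> {g. weak_upper_gradient \<mu> p UNIV (\<lambda>x. 0) g}. \<integral>\<^sup>+x\<in>UNIV. enn_powr (g x) p \<partial>\<mu>) \<le> (\<integral>\<^sup>+x\<in>UNIV. enn_powr 0 p \<partial>\<mu>)"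
    by (intro INF_lower2[of "\<lambda>x. 0"]) auto
  moreover have "e2ennreal 0 = 0" by (rule e2ennreal_neg) simp
  ultimately show ?thesis by (simp add: N1p_norm_def z)
qed

text \<open>
  Compare \<open>u\<close> on \<open>[x,y]\<close> with the function affine in \<open>\<Sigma>\<close> that has the same values at \<open>x\<close> and \<open>y\<close>; the
  right side is \<open>Q\<close> times the energy of that function. The difference may have further zeros inside
  \<open>[x,y]\<close>. There both derivatives agree almost everywhere, and since \<open>Q \<ge> 1\<close> the missing part of the
  energy may be added on both sides.
\<close>

lemma quasiminimizer_energy_le:
  assumes qm: "quasiminimizer_with \<mu> p Q (\<lambda>x. ereal (u x))" and Q: "1 \<le> Q"
    and u: "ac_derivative u f" and loc: "\<And>n. energy f {-real n..real n} < \<infinity>"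
    and \<Sigma>: "ac_derivative \<Sigma> dual" and xy: "x < y"
  shows "energy f {x..y}
    \<le> ennreal (Q * ((\<bar>u y - u x\<bar> / (\<Sigma> y - \<Sigma> x)) powr p * (\<Sigma> y - \<Sigma> x)))"
proof -
  have [measurable]: "f \<in> borel_measurable borel" using u by measurable
  define S where "S = \<Sigma> y - \<Sigma> x"
  define c where "c = (u y - u x) / S"
  have S: "0 < S" using dual_primitive_strict_mono[OF \<Sigma> xy] by (simp add: S_def)
  define d where "d t = (c * \<Sigma> t + - 1 * u t) + (u x - c * \<Sigma> x)" for t
  have d: "ac_derivative d (\<lambda>t. c * dual t + - 1 * f t)"
    unfolding d_def by (intro ac_derivative_add_const ac_derivative_add ac_derivative_cmult \<Sigma> u)
  have dx: "d x = 0" by (simp add: d_def)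
  have dy: "d y = 0"
  proof -
    have "c * S = u y - u x" using S by (simp add: c_def)
    then show ?thesis by (simp add: d_def S_def algebra_simps)
  qed
  define v where "v t = d (max x (min y t))" for t
  define k where "k t = (c * dual t + - 1 * f t) * indicator {x..y} t" for t
  have v: "ac_derivative v k"
    unfolding v_def[abs_def] k_def[abs_def] by (rule ac_derivative_restrict[OF d]) (use xy in simp)
  have [measurable]: "k \<in> borel_measurable borel" using v by measurable
  have [measurable]: "v \<in> borel_measurable borel" using v by measurable
  have v0: "v t = 0" if "t \<notin> {x<..<y}" for t
    using that dx dy xy by (cases "t \<le> x") (auto simp: v_def max_def min_def)
  have fin_c: "energy (\<lambda>t. c * dual t) {-real n..real n} < \<infinity>" for n
  proof -
    have "energy (\<lambda>t. c * dual t) {-real n..real n}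
       = ennreal (\<bar>c\<bar> powr p) * dual_mass {-real n..real n}"
      unfolding dual_multiple_energy mult.assoc by (rule nn_integral_cmult) measurable
    then show ?thesis using dual_integral_finite by (simp add: ennreal_mult_less_top)
  qed
  obtain N :: nat where N: "{x..y} \<subseteq> {- real N..real N}"
  proof -
    obtain N :: nat where "max \<bar>x\<bar> \<bar>y\<bar> < real N" using reals_Archimedean2 by blast
    then show thesis by (intro that[of N]) auto
  qed
  have k_fin: "(\<integral>\<^sup>+t. ennreal (\<bar>k t\<bar> powr p * w t) \<partial>lborel) < \<infinity>"
  proof -
    have "energy (\<lambda>t. c * dual t + - 1 * f t) {-real N..real N} < \<infinity>"
      using energy_add_finite[of "\<lambda>t. c * dual t" "\<lambda>t. - 1 * f t" "{-real N..real N}"] fin_c[of N] loc[of N] by simp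
    then show ?thesis
      using N by (elim le_less_trans[rotated]) (auto simp: k_def intro!: nn_integral_mono split: split_indicator)
  qed
  have k_loc: "energy k {-real n..real n} < \<infinity>" for n
    by (rule le_less_trans[OF _ k_fin]) (auto intro!: nn_integral_mono split: split_indicator)
  have fk_loc: "energy (\<lambda>t. f t + k t) {-real n..real n} < \<infinity>" for n
    by (rule energy_add_finite) (use loc k_loc in auto)
  define \<phi> where "\<phi> t = ereal (v t)" for t
  have "\<phi> \<in> N1p \<mu> p UNIV"
    unfolding \<phi>_def[abs_def]
  proof (rule N1p_ac[OF _ v])
    have "energy v UNIV = energy v {x..y}"
      using v0 p by (intro nn_integral_cong) (auto split: split_indicator)
    then show "energy v UNIV < \<infinity>"
      using energy_continuous_finite[OF ac_derivative_imp_continuous[OF v]] by simp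
  qed (use k_fin in auto)
  then have "\<phi> \<in> N1p_bounded_support \<mu> p"
    unfolding N1p_bounded_support_def using v0
    by (auto simp: \<phi>_def zero_ereal_def intro!: exI[of _ "{x<..<y}"])
  moreover have "N1p_norm \<mu> p UNIV (\<lambda>t. \<phi> t - \<phi> t) = 0" using N1p_norm_zero by (simp add: \<phi>_def zero_ereal_def)
  ultimately have "\<phi> \<in> N1p_test_functions \<mu> p"
    using \<open>\<phi> \<in> N1p \<mu> p UNIV\<close> unfolding N1p_test_functions_def by (auto intro!: bexI[of _ \<phi>])
  with qm have test: "(\<integral>\<^sup>+t\<in>{t. \<phi> t \<noteq> 0}. enn_powr (minimal_weak_upper_gradient \<mu> p (\<lambda>x. ereal (u x)) t) p \<partial>\<mu>)
     \<le> ennreal Q * (\<integral>\<^sup>+t\<in>{t. \<phi> t \<noteq> 0}. enn_powr (minimal_weak_upper_gradient \<mu> p (\<lambda>y. ereal (u y) + \<phi> y) t) p \<partial>\<mu>)"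
    unfolding quasiminimizer_with_def by blast
  define A where "A = {t. v t \<noteq> 0}"
  have A: "{t. \<phi> t \<noteq> 0} = A" and [measurable]: "A \<in> sets borel" by (auto simp: A_def \<phi>_def zero_ereal_def)
  have sum: "(\<lambda>y. ereal (u y) + \<phi> y) = (\<lambda>y. ereal (u y + v y))" by (simp add: \<phi>_def)
  have Axy: "A \<subseteq> {x..y}" 
  proof
    fix t assume "t \<in> A"
    then have "t \<in> {x<..<y}" using v0[of t] unfolding A_def by blast
    then show "t \<in> {x..y}" by simp
  qed
  have "energy f A \<le> ennreal Q * energy (\<lambda>t. f t + k t) A"
    using test unfolding A sum
    by (simp add: minimal_energy[OF u loc] minimal_energy[OF ac_derivative_add[OF u v] fk_loc])
  also have "energy (\<lambda>t. f t + k t) A = energy (\<lambda>t. c * dual t) A"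
    using Axy by (intro nn_integral_cong) (auto simp: k_def split: split_indicator)
  finally have EA: "energy f A \<le> ennreal Q * energy (\<lambda>t. c * dual t) A" .
  have "energy f ({x..y} - A) = energy (\<lambda>t. c * dual t) ({x..y} - A)"
    using ac_derivative_zero_on_zeros[OF v]
    by (intro nn_integral_cong_AE) (auto simp: k_def A_def split: split_indicator elim!: eventually_mono)
  also have "\<dots> \<le> ennreal Q * \<dots>"
  proof -
    have "1 \<le> ennreal Q" using Q ennreal_leI[of 1 Q] by simp
    from mult_right_mono[OF this, of "energy (\<lambda>t. c * dual t) ({x..y} - A)"] show ?thesis by simp
  qed
  finally have EB: "energy f ({x..y} - A) \<le> ennreal Q * energy (\<lambda>t. c * dual t) ({x..y} - A)" .
  have split: "energy h {x..y} = energy h A + energy h ({x..y} - A)" if [measurable]: "h \<in> borel_measurable borel" for h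
    using Axy by (subst nn_integral_add[symmetric]) (auto intro!: nn_integral_cong split: split_indicator)
  have "energy f {x..y} \<le> ennreal Q * energy (\<lambda>t. c * dual t) {x..y}"
    using add_mono[OF EA EB] by (simp add: split distrib_left)
  also have "energy (\<lambda>t. c * dual t) {x..y} = ennreal (\<bar>c\<bar> powr p) * dual_mass {x..y}"
    unfolding dual_multiple_energy mult.assoc by (rule nn_integral_cmult) measurable
  also have "\<dots> = ennreal (\<bar>c\<bar> powr p) * ennreal S"
    using xy by (simp add: dual_primitive_integral[OF \<Sigma>] S_def)
  also have "ennreal Q * \<dots> = ennreal (Q * (\<bar>c\<bar> powr p * S))" using Q S by (simp add: ennreal_mult)
  also have "\<bar>c\<bar> = \<bar>u y - u x\<bar> / S" using S by (simp add: c_def)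
  finally show ?thesis by (simp add: S_def)
qed

text \<open>
  The increment over \<open>[a,b]\<close> is bounded through the dual weight on \<open>[a,b]\<close> and the energy on the
  larger interval \<open>[x,y]\<close>. This is a reverse Hoelder inequality for \<open>u'\<close> in the coordinate \<open>\<Sigma>\<close>: as
  \<open>[x,y]\<close> grows, \<open>u\<close> either oscillates much more on it than on \<open>[a,b]\<close> or is constant on \<open>[a,b]\<close>.
\<close>

lemma quasiminimizer_oscillation:
  assumes qm: "quasiminimizer_with \<mu> p Q (\<lambda>x. ereal (u x))" and Q: "1 \<le> Q"
    and u: "ac_derivative u f" and loc: "\<And>n. energy f {-real n..real n} < \<infinity>"
    and \<Sigma>: "ac_derivative \<Sigma> dual" and ord: "x \<le> a" "a < b" "b \<le> y"
  shows "\<bar>u b - u a\<bar> \<le> (1 + Q) * ((\<Sigma> b - \<Sigma> a) / (\<Sigma> y - \<Sigma> x)) powr (1 - 1 / p) * \<bar>u y - u x\<bar>"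
proof -
  have [measurable]: "f \<in> borel_measurable borel" using u by measurable
  define S where "S = \<Sigma> y - \<Sigma> x"
  define s where "s = \<Sigma> b - \<Sigma> a"
  define D where "D = \<bar>u y - u x\<bar>"
  have S: "0 < S" and s: "0 < s"
    using dual_primitive_strict_mono[OF \<Sigma>, of x y] dual_primitive_strict_mono[OF \<Sigma>, of a b] ord by (auto simp: S_def s_def)
  have main: "\<bar>u b - u a\<bar> \<le> c * s + c powr (1 - p) * (Q * ((D / S) powr p * S))" if c: "0 < c" for c
  proof -
    have m: "(\<lambda>t. ennreal \<bar>f t\<bar> * indicator {a..b} t) \<in> borel_measurable lebesgue"
      by (rule measurable_completion) measurable
    have "ennreal \<bar>u b - u a\<bar> \<le> (\<integral>\<^sup>+t\<in>{a..b}. ennreal \<bar>f t\<bar> \<partial>lborel)"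
      using ord by (intro ac_derivative_abs_le[OF u]) simp
    also have "\<dots> \<le> ennreal c * dual_mass {a..b} + ennreal (c powr (1 - p)) * (\<integral>\<^sup>+t\<in>{a..b}. enn_powr (ennreal \<bar>f t\<bar>) p \<partial>\<mu>)"
      by (rule nn_integral_le_dual_plus_energy[OF _ m c]) simp
    also have "(\<integral>\<^sup>+t\<in>{a..b}. enn_powr (ennreal \<bar>f t\<bar>) p \<partial>\<mu>) = energy f {a..b}"
      by (rule energy_eq) auto
    also have "\<dots> \<le> energy f {x..y}"
      using ord by (intro nn_integral_mono) (auto split: split_indicator)
    also have "\<dots> \<le> ennreal (Q * ((D / S) powr p * S))"
      unfolding D_def S_def using ord by (intro quasiminimizer_energy_le[OF qm Q u loc \<Sigma>]) simp
    also have "dual_mass {a..b} = ennreal s"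
      unfolding s_def using ord by (intro dual_primitive_integral[OF \<Sigma>]) simp
    also have "ennreal c * ennreal s + ennreal (c powr (1 - p)) * ennreal (Q * ((D / S) powr p * S))
        = ennreal (c * s + c powr (1 - p) * (Q * ((D / S) powr p * S)))"
      using c s S Q by (simp add: ennreal_mult[symmetric] ennreal_plus[symmetric] del: ennreal_plus)
    finally have "ennreal \<bar>u b - u a\<bar> \<le> ennreal (c * s + c powr (1 - p) * (Q * ((D / S) powr p * S)))"
      by (simp add: add_left_mono mult_left_mono)
    then show ?thesis by (subst (asm) ennreal_le_iff) (use c s S Q in auto)
  qed
  show ?thesis
  proof (cases "D = 0")
    case True
    have "\<bar>u b - u a\<bar> \<le> 0"
    proof (rule field_le_epsilon)
      fix e :: real assume "0 < e"
      then show "\<bar>u b - u a\<bar> \<le> 0 + e" using main[of "e / s"] s True p by simp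
    qed
    then show ?thesis using True by (simp add: D_def)
  next
    case False
    then have D: "0 < D" by (simp add: D_def)
    define r where "r = s / S"
    have r: "0 < r" using s S by (simp add: r_def)
    \<comment> \<open>this choice makes both terms of the bound multiples of the same power of \<open>r\<close>\<close>
    define c where "c = r powr (- 1 / p) * (D / S)"
    have c: "0 < c" using r D S by (simp add: c_def)
    have "c * s = r powr (- 1 / p) * r * D" by (simp add: c_def r_def)
    also have "r powr (- 1 / p) * r = r powr (1 - 1 / p)"
      using r powr_add[of r "- 1 / p" 1] by (simp add: algebra_simps)
    finally have 1: "c * s = r powr (1 - 1 / p) * D" .
    have "c powr (1 - p) * (Q * ((D / S) powr p * S)) = Q * (r powr (- 1 / p)) powr (1 - p) * ((D / S) powr (1 - p) * (D / S) powr p * S)"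
    proof -
      have "c powr (1 - p) = (r powr (- 1 / p)) powr (1 - p) * (D / S) powr (1 - p)"
        unfolding c_def by (rule powr_mult)
      then show ?thesis by (simp only: mult_ac)
    qed
    also have "(D / S) powr (1 - p) * (D / S) powr p * S = D"
      using D S by (simp add: powr_add[symmetric])
    also have "(r powr (- 1 / p)) powr (1 - p) = r powr (1 - 1 / p)"
    proof -
      have "- 1 / p * (1 - p) = 1 - 1 / p" using p by (simp add: field_simps)
      then show ?thesis by (simp only: powr_powr)
    qed
    finally have 2: "c powr (1 - p) * (Q * ((D / S) powr p * S)) = Q * r powr (1 - 1 / p) * D" .
    have "\<bar>u b - u a\<bar> \<le> r powr (1 - 1 / p) * D + Q * r powr (1 - 1 / p) * D" using main[OF c] unfolding 1 2 .
    then show ?thesis by (simp add: r_def s_def S_def D_def algebra_simps)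
  qed
qed

lemma quasiminimizer_ac:
  assumes qm: "quasiminimizer_with \<mu> p Q (\<lambda>x. ereal (u x))"
  obtains f where "ac_derivative u f" "\<And>n. energy f {-real n..real n} < \<infinity>"
proof -
  define G where "G n = {- real n - 2<..<real n + 2}" for n
  have "(\<lambda>x. ereal (u x)) \<in> N1p \<mu> p (G n)" for n
    using qm unfolding quasiminimizer_with_def G_def by auto
  then obtain f g where f: "ac_derivative u f" and gf: "\<And>n. (\<integral>\<^sup>+x\<in>G n. enn_powr (g n x) p \<partial>\<mu>) < \<infinity>"
    and le: "\<And>n. AE x in lborel. x \<in> {-real n..real n} \<longrightarrow> ennreal \<bar>f x\<bar> \<le> g n x"
    by (rule N1p_local_imp_ac[of u G]) (auto simp: G_def)
  have [measurable]: "f \<in> borel_measurable borel" using f by measurable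
  have "energy f {-real n..real n} < \<infinity>" for n
  proof -
    have "energy f {-real n..real n} = (\<integral>\<^sup>+x\<in>{-real n..real n}. enn_powr (ennreal \<bar>f x\<bar>) p \<partial>\<mu>)"
      by (rule energy_eq[symmetric]) auto
    also have "\<dots> \<le> (\<integral>\<^sup>+x\<in>G n. enn_powr (g n x) p \<partial>\<mu>)"
    proof (rule nn_integral_mono_AE)
      have "AE x in \<mu>. x \<in> {-real n..real n} \<longrightarrow> ennreal \<bar>f x\<bar> \<le> g n x" unfolding AE_\<mu> by (rule le)
      then show "AE x in \<mu>. enn_powr (ennreal \<bar>f x\<bar>) p * indicator {-real n..real n} x \<le> enn_powr (g n x) p * indicator (G n) x"
        by eventually_elim (use p in \<open>auto simp: G_def intro: enn_powr_mono split: split_indicator\<close>)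
    qed
    finally show ?thesis using gf[of n] by (rule le_less_trans)
  qed
  with f show thesis by (rule that)
qed

text \<open>
  If \<open>\<Sigma>\<close> is unbounded in both directions, the oscillation estimate forces \<open>\<bar>u(y) - u(x)\<bar> \<ge> R\<close> once
  \<open>\<Sigma>(y) - \<Sigma>(x)\<close> is large. Positivity of \<open>u\<close> decides the sign: \<open>u\<close> becomes large on both sides. Then
  \<open>u\<close> has equal values at some \<open>x \<le> a\<close> and \<open>y \<ge> b\<close>, and the estimate gives \<open>u(a) = u(b)\<close>.
\<close>

lemma quasiharmonic_imp_dual_finite:
  assumes qh: "quasiharmonic \<mu> p u" and pos: "\<And>x. 0 < u x" and nc: "\<not> u constant_on UNIV"
  shows "min (dual_mass {..0}) (dual_mass {0..}) < \<infinity>"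
proof (rule ccontr)
  assume inf: "\<not> ?thesis"
  obtain \<Sigma> where \<Sigma>: "ac_derivative \<Sigma> dual" by (rule ex_dual_primitive)
  have unb: "\<exists>x. B < \<Sigma> x" "\<exists>x. \<Sigma> x < B" for B
    using inf dual_left_finite_iff[OF \<Sigma>] dual_right_finite_iff[OF \<Sigma>] by (auto simp: min_less_iff_disj not_le)
  have mono: "\<Sigma> x \<le> \<Sigma> y" if "x \<le> y" for x y
    using dual_primitive_strict_mono[OF \<Sigma>, of x y] that by (cases "x = y") auto
  obtain Q where Q: "1 \<le> Q" and qm: "quasiminimizer_with \<mu> p Q (\<lambda>x. ereal (u x))" and cont: "continuous_on UNIV u"
    using qh unfolding quasiharmonic_def by blast
  obtain f where f: "ac_derivative u f" and loc: "\<And>n. energy f {-real n..real n} < \<infinity>"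
    by (rule quasiminimizer_ac[OF qm]) blast
  note osc = quasiminimizer_oscillation[OF qm Q f loc \<Sigma>]
  obtain a b where ab: "a < b" "u a \<noteq> u b"
  proof -
    obtain x y where "u x \<noteq> u y" using nc unfolding constant_on_def by blast
    then show thesis using that[of x y] that[of y x] by (cases x y rule: linorder_cases) auto
  qed
  define \<delta> where "\<delta> = \<bar>u b - u a\<bar>"
  \<comment> \<open>a positive function cannot drop by \<open>R\<close> from \<open>u a\<close> or \<open>u b\<close>, so a change by \<open>R\<close> is an increase\<close>
  define R where "R = max (u a) (u b) + 1"
  have \<delta>: "0 < \<delta>" using ab by (simp add: \<delta>_def)
  have R: "0 < R" using pos[of a] by (simp add: R_def)
  define s where "s = \<Sigma> b - \<Sigma> a"
  have s: "0 < s" using dual_primitive_strict_mono[OF \<Sigma> ab(1)] by (simp add: s_def)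
  obtain T where T: "0 < T" "(1 + Q) * (s / T) powr (1 - 1 / p) * R \<le> \<delta>"
  proof -
    define q where "q = 1 - 1 / p"
    have q: "0 < q" using p by (simp add: q_def)
    \<comment> \<open>solves \<open>(1 + Q) (s / T)\<^bsup>q\<^esup> R = \<delta>\<close>\<close>
    define T where "T = s * (((1 + Q) * R / \<delta>) powr (1 / q))"
    have pos': "0 < (1 + Q) * R / \<delta>" using Q R \<delta> by simp
    then have "0 < ((1 + Q) * R / \<delta>) powr (1 / q)" by (metis powr_gt_zero less_irrefl)
    then have "0 < T" unfolding T_def using s by (rule mult_pos_pos[rotated])
    moreover have "(s / T) powr q = \<delta> / ((1 + Q) * R)"
    proof -
      have "s / T = ((1 + Q) * R / \<delta>) powr (- (1 / q))" using s pos' by (simp add: T_def powr_minus field_simps)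
      then have "(s / T) powr q = ((1 + Q) * R / \<delta>) powr (- (1 / q) * q)" by (simp only: powr_powr)
      also have "- (1 / q) * q = - 1" using q by simp
      finally show ?thesis using Q R \<delta> by (simp add: powr_minus)
    qed
    moreover have "z * (\<delta> / (z * R)) * R = \<delta>" if "z \<noteq> 0" for z using that R by simp
    from this[of "1 + Q"] have "(1 + Q) * (\<delta> / ((1 + Q) * R)) * R = \<delta>" using Q by linarith
    ultimately show thesis using that[of T] unfolding q_def by simp
  qed
  have far: "R \<le> \<bar>u y - u x\<bar>" if xy: "x \<le> a" "b \<le> y" and large: "T \<le> \<Sigma> y - \<Sigma> x" for x y
  proof (rule ccontr)
    assume "\<not> R \<le> \<bar>u y - u x\<bar>"
    then have lt: "\<bar>u y - u x\<bar> < R" by simp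
    have "\<delta> \<le> (1 + Q) * (s / (\<Sigma> y - \<Sigma> x)) powr (1 - 1 / p) * \<bar>u y - u x\<bar>"
      unfolding \<delta>_def s_def by (rule osc[OF xy(1) ab(1) xy(2)])
    also have "\<dots> \<le> (1 + Q) * (s / T) powr (1 - 1 / p) * \<bar>u y - u x\<bar>"
      using large T s p Q by (intro mult_right_mono mult_left_mono powr_mono2 divide_left_mono) auto
    also have "\<dots> < (1 + Q) * (s / T) powr (1 - 1 / p) * R"
      using lt T s Q by (intro mult_strict_left_mono) auto
    also have "\<dots> \<le> \<delta>" by (rule T)
    finally show False by simp
  qed
  obtain y where y: "b \<le> y" "R + u a \<le> u y"
  proof -
    obtain y0 where "\<Sigma> a + T < \<Sigma> y0" using unb(1) by blast
    then have "T \<le> \<Sigma> (max b y0) - \<Sigma> a" using mono[of y0 "max b y0"] by linarith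
    from far[OF order_refl _ this] have "R \<le> \<bar>u (max b y0) - u a\<bar>" by simp
    then have "R + u a \<le> u (max b y0)" using pos[of "max b y0"] by (auto simp: R_def abs_if split: if_splits)
    then show thesis by (intro that[of "max b y0"]) auto
  qed
  obtain x where x: "x \<le> a" "R + u b \<le> u x"
  proof -
    obtain x0 where "\<Sigma> x0 < \<Sigma> b - T" using unb(2) by blast
    then have "T \<le> \<Sigma> b - \<Sigma> (min a x0)" using mono[of "min a x0" x0] by linarith
    from far[OF _ order_refl this] have "R \<le> \<bar>u b - u (min a x0)\<bar>" by simp
    then have "R + u b \<le> u (min a x0)" using pos[of "min a x0"] by (auto simp: R_def abs_if split: if_splits)
    then show thesis by (intro that[of "min a x0"]) auto
  qed
  have no_eq: False if "x' \<le> a" "b \<le> y'" "u x' = u y'" for x' y'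
    using osc[OF that(1) ab(1) that(2)] that(3) ab(2) by simp
  have c1: "continuous_on {x..a} u" and c2: "continuous_on {b..y} u"
    using cont by (auto intro: continuous_on_subset)
  show False
  proof (cases "u y \<le> u x")
    case True
    obtain x' where "x \<le> x'" "x' \<le> a" "u x' = u y"
      using IVT2'[of u a "u y" x] c1 x(1) y(2) True R by auto
    then show False using no_eq[of x' y] y by simp
  next
    case False
    obtain y' where "b \<le> y'" "y' \<le> y" "u y' = u x"
      using IVT'[of u b "u x" y] c2 x(2) y(1) False R by auto
    then show False using no_eq[of x y'] x by simp
  qed
qed

lemma weight_w: "weight w"
  unfolding weight_def
proof (intro conjI allI impI)
  show "0 \<le> w x" for x using w_pos[of x] by simp
  fix K :: "real set" assume K: "compact K"
  then obtain B where B: "\<And>x. x \<in> K \<Longrightarrow> \<bar>x\<bar> \<le> B" using compact_imp_bounded bounded_iff by (metis real_norm_def)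
  have [measurable]: "K \<in> sets borel" using K by (simp add: borel_compact)
  have "set_integrable lborel K w"
    unfolding set_integrable_def
  proof (rule integrableI_bounded)
    have "(\<integral>\<^sup>+x. ennreal (norm (indicator K x *\<^sub>R w x)) \<partial>lborel) \<le> (\<integral>\<^sup>+x\<in>{-B..B}. ennreal (w x) \<partial>lborel)"
      using B w_pos by (intro nn_integral_mono) (auto simp: less_imp_le abs_le_iff minus_le_iff split: split_indicator)
    then show "(\<integral>\<^sup>+x. ennreal (norm (indicator K x *\<^sub>R w x)) \<partial>lborel) < \<infinity>" using w_finite by (rule le_less_trans)
  qed measurable
  then show "set_integrable lebesgue K w"
    unfolding set_integrable_def by (subst integrable_completion) auto
qed

lemma has_weight_w: "has_weight \<mu> w"
proof -
  have "completion \<mu> = \<mu>"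
  proof (rule measure_eqI)
    show s: "sets (completion \<mu>) = sets \<mu>"
    proof
      show "sets (completion \<mu>) \<subseteq> sets \<mu>"
      proof
        fix A assume "A \<in> sets (completion \<mu>)"
        then obtain S N N' where A: "A = S \<union> N" "N \<subseteq> N'" "N' \<in> null_sets \<mu>" "S \<in> sets \<mu>" by (rule sets_completionE)
        then have "N \<in> null_sets \<mu>" unfolding \<mu>_eq using null_sets_completion_subset by blast
        then have "N \<in> sets \<mu>" by (rule null_setsD2)
        then show "A \<in> sets \<mu>" using A by auto
      qed
    qed auto
    fix A assume "A \<in> sets (completion \<mu>)"
    then show "emeasure (completion \<mu>) A = emeasure \<mu> A" unfolding s by simp
  qed
  then show ?thesis unfolding has_weight_def \<mu>_density by simp
qed

text \<open>
  The density of \<open>\<mu>\<close> is unique up to null sets, so that the integral condition may be checked for any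
  weight representing \<open>\<mu>\<close>.
\<close>

lemma has_weight_AE_eq:
  assumes v: "weight v" and hw: "has_weight \<mu> v"
  shows "AE x in lborel. v x = w x"
proof -
  have v0: "0 \<le> v x" for x using v by (simp add: weight_def)
  have vm: "v \<in> borel_measurable lebesgue"
  proof (rule borel_measurable_LIMSEQ_real)
    show "(\<lambda>x. indicator {-real n..real n} x *\<^sub>R v x) \<in> borel_measurable lebesgue" for n
      using v unfolding weight_def set_integrable_def by (auto intro: borel_measurable_integrable)
    fix x :: real
    obtain n :: nat where n: "\<bar>x\<bar> < real n" using reals_Archimedean2 by blast
    have "\<forall>\<^sub>F k in sequentially. indicator {-real k..real k} x *\<^sub>R v x = v x"
      using eventually_ge_at_top[of n]
    proof eventually_elim
      case (elim k)
      then have "real n \<le> real k" by simp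
      then have "x \<in> {-real k..real k}" using n unfolding atLeastAtMost_iff by linarith
      then show ?case by simp
    qed
    then show "(\<lambda>k. indicator {-real k..real k} x *\<^sub>R v x) \<longlonglongrightarrow> v x" by (rule tendsto_eventually)
  qed
  obtain v' where v'[measurable]: "v' \<in> borel_measurable lborel" and vv: "AE x in lborel. v x = v' x"
    using completion_ex_borel_measurable_real[OF vm] by auto
  have "density lborel (\<lambda>x. ennreal (v' x)) = density lborel (\<lambda>x. ennreal (w x))"
  proof (rule measure_eqI)
    fix A assume "A \<in> sets (density lborel (\<lambda>x. ennreal (v' x)))"
    then have A[measurable]: "A \<in> sets borel" by simp
    then have AL: "A \<in> sets lebesgue" by (simp add: sets_completionI_sets)
    have "emeasure (density lborel (\<lambda>x. ennreal (v' x))) A = (\<integral>\<^sup>+x\<in>A. ennreal (v' x) \<partial>lborel)"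
      by (subst emeasure_density) auto
    also have "\<dots> = (\<integral>\<^sup>+x\<in>A. ennreal (v x) \<partial>lborel)" using vv by (intro nn_integral_cong_AE) auto
    also have "\<dots> = emeasure (density lebesgue (\<lambda>x. ennreal (v x))) A"
      using AL vm by (subst emeasure_density) (auto simp: nn_integral_completion)
    also have "\<dots> = emeasure \<mu> A" using hw AL unfolding has_weight_def by simp
    also have "\<dots> = emeasure (density lborel (\<lambda>x. ennreal (w x))) A" unfolding \<mu>_eq using A by simp
    finally show "emeasure (density lborel (\<lambda>x. ennreal (v' x))) A = emeasure (density lborel (\<lambda>x. ennreal (w x))) A" .
  qed simp
  then have "AE x in lborel. ennreal (v' x) = ennreal (w x)"
    using v' by (subst (asm) sigma_finite_measure.density_unique_iff[OF sigma_finite_lborel]) auto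
  then show ?thesis using vv
  proof eventually_elim
    case (elim x)
    then show ?case using v0[of x] w_pos[of x] by (simp add: ennreal_inj less_imp_le)
  qed
qed

lemma dual_of_weight:
  assumes "AE x in lborel. v x = w x"
  shows "(\<integral>\<^sup>+x\<in>A. enn_powr (ennreal (v x)) (1 / (1 - p)) \<partial>lebesgue) = dual_mass A"
proof -
  have "(\<integral>\<^sup>+x\<in>A. enn_powr (ennreal (v x)) (1 / (1 - p)) \<partial>lborel) = dual_mass A"
    using assms by (intro nn_integral_cong_AE) (auto simp: dual_def enn_powr_ennreal w_pos elim!: eventually_mono)
  then show ?thesis by (simp add: nn_integral_completion)
qed

end

section \<open>The equivalence\<close>

theorem theorem1p3:
  fixes \<mu> :: "real measure" and p :: real
  assumes "1 < p"
    and "complete_borel_measure \<mu>"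
    and "positive_finite_on_balls \<mu>"
    and "locally_doubling \<mu>"
    and "local_Poincare \<mu> p"
  shows "((\<exists>u. p_harmonic \<mu> p u \<and> (\<forall>x. 0 < u x) \<and> \<not> u constant_on UNIV) \<longleftrightarrow>
          (\<exists>u. quasiharmonic \<mu> p u \<and> (\<forall>x. 0 < u x) \<and> \<not> u constant_on UNIV)) \<and>
         ((\<exists>u. quasiharmonic \<mu> p u \<and> (\<forall>x. 0 < u x) \<and> \<not> u constant_on UNIV) \<longleftrightarrow>
          (\<exists>w. weight w \<and> has_weight \<mu> w \<and>
               min (\<integral>\<^sup>+x\<in>{..0}. enn_powr (ennreal (w x)) (1 / (1 - p)) \<partial>lebesgue)
                   (\<integral>\<^sup>+x\<in>{0..}. enn_powr (ennreal (w x)) (1 / (1 - p)) \<partial>lebesgue) < \<infinity>))"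
  (is "(?a \<longleftrightarrow> ?b) \<and> (?b \<longleftrightarrow> ?c)")
proof -
  obtain v where "weighted_line \<mu> v p" by (rule poincare_imp_weighted_line[OF assms])
  then interpret weighted_line \<mu> v p .
  have "?a \<Longrightarrow> ?b" unfolding p_harmonic_def quasiharmonic_def by (meson order_refl)
  moreover have "?b \<Longrightarrow> ?c"
  proof -
    assume ?b
    then obtain u where u: "quasiharmonic \<mu> p u" "\<And>x. 0 < u x" "\<not> u constant_on UNIV" by blast
    show ?c using quasiharmonic_imp_dual_finite[OF u] weight_w has_weight_w
      by (intro exI[of _ v]) (simp add: dual_of_weight)
  qed
  moreover have "?c \<Longrightarrow> ?a"
  proof -
    assume ?c
    then obtain w where w: "weight w" "has_weight \<mu> w"
      and fin: "min (\<integral>\<^sup>+x\<in>{..0}. enn_powr (ennreal (w x)) (1 / (1 - p)) \<partial>lebesgue)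
                   (\<integral>\<^sup>+x\<in>{0..}. enn_powr (ennreal (w x)) (1 / (1 - p)) \<partial>lebesgue) < \<infinity>" by blast
    show ?a using fin unfolding dual_of_weight[OF has_weight_AE_eq[OF w]] by (rule ex_positive_p_harmonic)
  qed
  ultimately show ?thesis by blast
qed

end
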